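(* Let $\mathcal X,\mathcal Y$ be countable sets, $\lambda>0$, $c\colon\mathcal X\times\mathcal Y\to\mathbb R$, $r\in\mathcal P(\mathcal X)$, $s\in\mathcal P(\mathcal Y)$. Let $\hat r_n=\frac1n\sum_{i=1}^n\delta_{X_i}$ with $X_1,\dots,X_n$ i.i.d. $\sim r$, and let $\hat r_n^*=\frac1n\sum_{i=1}^n\delta_{X_i^*}$ be the empirical bootstrap estimator based on a sample $X_1^*,\dots,X_n^*$ i.i.d. $\sim\hat r_n$ (conditionally on $X_1,\dots,X_n$). (a) Assume that $c$ admits two collections of dominating functions, with weights $\mathcal C_{\mathcal X},\mathcal C_{\mathcal Y},\phi_{\mathcal Y}$ for the first and $\tilde{\mathcal C}_{\mathcal X},\tilde{\mathcal C}_{\mathcal Y},\tilde\phi_{\mathcal X}$ for the second, such that $$\sum_{x}\Big(\mathcal C_{\mathcal X}(x)\sqrt{r_x}+(\tilde{\mathcal C}_{\mathcal X}^2+\tilde\phi_{\mathcal X}^2)(x)r_x\Big)<\infty,\qquad\sum_y(\mathcal C_{\mathcal Y}+\tilde{\mathcal C}_{\mathcal Y}+\phi_{\mathcal Y})(y)s_y<\infty.$$ Then, as $n\to\infty$, $$\sup_{h\in BL_1(\mathbb R)}\Big|\mathbb E\big[h\big(\sqrt n(EROT^\lambda(\hat r_n^*,s)-EROT^\lambda(\hat r_n,s))\big)\,\big|\,X_1,\dots,X_n\big]-\mathbb E\big[h\big(\sqrt n(EROT^\lambda(\hat r_n,s)-EROT^\lambda(r,s))\big)\big]\Big|\xrightarrow{\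 \mathbb P^*\ }0.$$ (b) Assume that $c$ admits a collection of dominating functions with $\|c_{\mathcal X}^+-c_{\mathcal X}^-\|_{\ell^\infty(\mathcal X)}<\infty$ and weights $\mathcal C_{\mathcal X},\mathcal C_{\mathcal Y},\phi_{\mathcal Y}$ such that $\sum_x\mathcal C_{\mathcal X}(x)\sqrt{r_x}<\infty$ and $\sum_y\mathcal C_{\mathcal Y}(y)\phi_{\mathcal Y}^4(y)s_y<\infty$. Then, with $B=\ell^1_{\mathcal C_{\mathcal X}\oplus\mathcal C_{\mathcal Y}}(\mathcal X\times\mathcal Y)$, as $n\to\infty$, $$\sup_{h\in BL_1(B)}\Big|\mathbb E\big[h\big(\sqrt n(\pi^\lambda(\hat r_n^*,s)-\pi^\lambda(\hat r_n,s))\big)\,\big|\,X_1,\dots,X_n\big]-\mathbb E\big[h\big(\sqrt n(\pi^\lambda(\hat r_n,s)-\pi^\lambda(r,s))\big)\big]\Big|\xrightarrow{\ \mathbb P^*\ }0.$$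
   Context: $\mathcal P(\mathcal X)$: probability measures $r=(r_x)$ on the countable set $\mathcal X$. $\xrightarrow{\mathbb P^*}$ denotes convergence in outer probability. For a Banach space $B$, $BL_1(B)$ is the set of $g\colon B\to\mathbb R$ with $\sup|g|\le1$ and $|g(b_1)-g(b_2)|\le\|b_1-b_2\|_B$ for all $b_1,b_2\in B$. For a positive weight $f$ on a countable set $Z$, $\ell^1_f(Z)$ has norm $\sum_zf(z)|a_z|$; $(\mathcal C_{\mathcal X}\oplus\mathcal C_{\mathcal Y})(x,y)=\mathcal C_{\mathcal X}(x)+\mathcal C_{\mathcal Y}(y)$. EROT: $\Pi(r,s)$ is the set of couplings of $r,s$; $M(\pi)=\sum_{x,y}\pi_{xy}\log(\pi_{xy}/(r_xs_y))$ (with $0\log 0=0$); $EROT^\lambda(r,s)=\inf_{\pi\in\Pi(r,s)}\langle c,\pi\rangle+\lambda M(\pi)$. If $c$ is $r\otimes s$-integrable there is a unique minimizer, the EROT plan $\pi^\lambda(r,s)$. Dominating functions for $c$: real functions $c_{\mathcal X}^-\le c_{\mathcal X}^+$ on $\mathcal X$, $c_{\mathcal Y}^-\le c_{\mathcal Y}^+$ on $\mathcal Y$ with $c_{\mathcal X}^-(x)+c_{\mathcal Y}^-(y)\le c(x,y)\le c_{\mathcal X}^+(x)+c_{\mathcal Y}^+(y)$ for all $(x,y)$. Weights: $\mathcal C_{\mathcal X}=1+|c_{\mathcal X}^+|+|c_{\mathcal X}^-|$, $\mathcal C_{\mathcal Y}=1+|c_{\mathcal Y}^+|+|c_{\mathcal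 Y}^-|$, $\phi_{\mathcal X}=\exp((c_{\mathcal X}^+-c_{\mathcal X}^-)/\lambda)$, $\phi_{\mathcal Y}=\exp((c_{\mathcal Y}^+-c_{\mathcal Y}^-)/\lambda)$; for a second collection $\tilde c_{\mathcal X}^\pm,\tilde c_{\mathcal Y}^\pm$ (possibly equal to the first) the weights are defined by the same formulas and carry a tilde. *)

theory Defs
  imports "HOL-Probability.Probability"
begin

section \<open>Entropy-regularized optimal transport\<close>

text \<open>Sum of a real family with values in \<open>[-\<infinity>, \<infinity>]\<close>: positive part minus negative part.
  With the \<^typ>\<open>ereal\<close> convention \<open>\<infinity> - \<infinity> = \<infinity>\<close>, an undefined sum takes the value \<open>\<infinity>\<close>.\<close>

definition ext_sum :: "('z \<Rightarrow> real) \<Rightarrow> ereal" where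
  "ext_sum f = enn2ereal (\<integral>\<^sup>+z. ennreal (f z) \<partial>count_space UNIV)
             - enn2ereal (\<integral>\<^sup>+z. ennreal (- f z) \<partial>count_space UNIV)"

definition couplings :: "'x pmf \<Rightarrow> 'y pmf \<Rightarrow> ('x \<times> 'y) pmf set" where
  "couplings r s = {\<pi>. map_pmf fst \<pi> = r \<and> map_pmf snd \<pi> = s}"

definition transport_cost :: "('x \<times> 'y \<Rightarrow> real) \<Rightarrow> ('x \<times> 'y) pmf \<Rightarrow> ereal" where
  "transport_cost c \<pi> = ext_sum (\<lambda>z. c z * pmf \<pi> z)"

text \<open>The relative entropy may be infinite, hence the type \<^typ>\<open>ereal\<close> (the library's
  \<open>KL_divergence\<close> is real-valued). If \<open>\<pi>\<close> is a coupling of \<open>r\<close> and \<open>s\<close>, the denominator vanishes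
  only where \<open>\<pi>\<close> does, and there the summand is \<open>0\<close>.\<close>

definition mutual_info :: "'x pmf \<Rightarrow> 'y pmf \<Rightarrow> ('x \<times> 'y) pmf \<Rightarrow> ereal" where
  "mutual_info r s \<pi> =
     ext_sum (\<lambda>(x, y). pmf \<pi> (x, y) * ln (pmf \<pi> (x, y) / (pmf r x * pmf s y)))"

definition erot_objective ::
  "real \<Rightarrow> ('x \<times> 'y \<Rightarrow> real) \<Rightarrow> 'x pmf \<Rightarrow> 'y pmf \<Rightarrow> ('x \<times> 'y) pmf \<Rightarrow> ereal" where
  "erot_objective lam c r s \<pi> = transport_cost c \<pi> + ereal lam * mutual_info r s \<pi>"

text \<open>The infimum is finite whenever \<open>c\<close> is bounded below and above by functions of the form
  \<open>f \<oplus> g\<close> with \<open>f\<close>, \<open>g\<close> integrable with respect to the marginals, so that the conversion to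
  \<^typ>\<open>real\<close> is harmless there.\<close>

definition EROT :: "real \<Rightarrow> ('x \<times> 'y \<Rightarrow> real) \<Rightarrow> 'x pmf \<Rightarrow> 'y pmf \<Rightarrow> real" where
  "EROT lam c r s = real_of_ereal (INF \<pi>\<in>couplings r s. erot_objective lam c r s \<pi>)"

definition erot_plan :: "real \<Rightarrow> ('x \<times> 'y \<Rightarrow> real) \<Rightarrow> 'x pmf \<Rightarrow> 'y pmf \<Rightarrow> ('x \<times> 'y) pmf" where
  "erot_plan lam c r s =
     (THE \<pi>. is_arg_min (erot_objective lam c r s) (\<lambda>\<pi>. \<pi> \<in> couplings r s) \<pi>)"


section \<open>Dominating functions and weights\<close>

definition dominating ::
  "('x \<times> 'y \<Rightarrow> real) \<Rightarrow> ('x \<Rightarrow> real) \<Rightarrow> ('x \<Rightarrow> real) \<Rightarrow> ('y \<Rightarrow> real) \<Rightarrow> ('y \<Rightarrow> real) \<Rightarrow> bool" where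
  "dominating c cXm cXp cYm cYp \<longleftrightarrow>
     (\<forall>x. cXm x \<le> cXp x) \<and> (\<forall>y. cYm y \<le> cYp y) \<and>
     (\<forall>x y. cXm x + cYm y \<le> c (x, y) \<and> c (x, y) \<le> cXp x + cYp y)"

definition C_weight :: "('z \<Rightarrow> real) \<Rightarrow> ('z \<Rightarrow> real) \<Rightarrow> 'z \<Rightarrow> real" where
  "C_weight cm cp z = 1 + \<bar>cp z\<bar> + \<bar>cm z\<bar>"

definition phi_weight :: "real \<Rightarrow> ('z \<Rightarrow> real) \<Rightarrow> ('z \<Rightarrow> real) \<Rightarrow> 'z \<Rightarrow> real" where
  "phi_weight lam cm cp z = exp ((cp z - cm z) / lam)"


section \<open>Weighted summable families and bounded Lipschitz functions\<close>

definition osum :: "('x \<Rightarrow> real) \<Rightarrow> ('y \<Rightarrow> real) \<Rightarrow> 'x \<times> 'y \<Rightarrow> real" where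
  "osum f g = (\<lambda>(x, y). f x + g y)"

definition l1_space :: "('z \<Rightarrow> real) \<Rightarrow> ('z \<Rightarrow> real) set" where
  "l1_space f = {a. (\<lambda>z. f z * \<bar>a z\<bar>) summable_on UNIV}"

definition l1_norm :: "('z \<Rightarrow> real) \<Rightarrow> ('z \<Rightarrow> real) \<Rightarrow> real" where
  "l1_norm f a = (\<Sum>\<^sub>\<infinity>z. f z * \<bar>a z\<bar>)"

text \<open>The Banach space is given by its carrier \<open>B\<close> and its norm \<open>nrm\<close>; the values of a member
  outside \<open>B\<close> are unconstrained and irrelevant.\<close>

definition BL1 :: "'b::minus set \<Rightarrow> ('b \<Rightarrow> real) \<Rightarrow> ('b \<Rightarrow> real) set" where
  "BL1 B nrm = {h. (\<forall>b\<in>B. \<bar>h b\<bar> \<le> 1) \<and> (\<forall>b1\<in>B. \<forall>b2\<in>B. \<bar>h b1 - h b2\<bar> \<le> nrm (b1 - b2))}"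


section \<open>Sampling, bootstrap and convergence in outer probability\<close>

text \<open>\<open>empirical n x\<close> is \<open>1/n\<close> times the sum of the point masses at \<open>x 0, \<dots>, x (n - 1)\<close>, i.e.
  the law of \<open>x i\<close> for a uniformly distributed index \<open>i\<close>. It is meaningful for \<open>n > 0\<close> only.\<close>

definition empirical :: "nat \<Rightarrow> (nat \<Rightarrow> 'x) \<Rightarrow> 'x pmf" where
  "empirical n x = map_pmf x (pmf_of_set {..<n})"

lemma pmf_empirical:
  assumes "n > 0"
  shows "pmf (empirical n x) a = (\<Sum>i<n. indicator {a} (x i)) / real n"
proof -
  have ne: "{..<n} \<noteq> {}" using assms by auto
  have "pmf (empirical n x) a = measure (pmf_of_set {..<n}) (x -` {a})"
    by (simp add: empirical_def pmf_map)
  also have "\<dots> = real (card ({..<n} \<inter> x -` {a})) / real n"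
    using ne by (simp add: measure_pmf_of_set)
  also have "real (card ({..<n} \<inter> x -` {a})) = (\<Sum>i<n. indicator {a} (x i))"
    by (simp add: indicator_def sum.If_cases Int_def vimage_def)
  finally show ?thesis .
qed

definition iid_sample :: "'w measure \<Rightarrow> (nat \<Rightarrow> 'w \<Rightarrow> 'x) \<Rightarrow> 'x pmf \<Rightarrow> bool" where
  "iid_sample M X r \<longleftrightarrow>
     prob_space.indep_vars M (\<lambda>_. count_space UNIV) X UNIV \<and>
     (\<forall>i. distr M (count_space UNIV) (X i) = measure_pmf r)"

text \<open>The \<open>\<sigma>\<close>-algebra generated by the first \<open>n\<close> observations, as conditioning argument for
  \<open>real_cond_exp\<close>.\<close>

definition sample_algebra :: "'w measure \<Rightarrow> (nat \<Rightarrow> 'w \<Rightarrow> 'x) \<Rightarrow> nat \<Rightarrow> 'w measure" where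
  "sample_algebra M X n =
     vimage_algebra (space M) (\<lambda>\<omega>. \<lambda>i\<in>{..<n}. X i \<omega>) (\<Pi>\<^sub>M i\<in>{..<n}. count_space UNIV)"

text \<open>Conditionally on the first \<open>n\<close> observations, \<open>Z 0, \<dots>, Z (n - 1)\<close> are independent with law
  the empirical measure: the conditional probability mass function of the vector is the product
  of the masses of the empirical measure.\<close>

definition bootstrap_sample ::
  "'w measure \<Rightarrow> (nat \<Rightarrow> 'w \<Rightarrow> 'x) \<Rightarrow> nat \<Rightarrow> (nat \<Rightarrow> 'w \<Rightarrow> 'x) \<Rightarrow> bool" where
  "bootstrap_sample M X n Z \<longleftrightarrow>
     (\<forall>i<n. Z i \<in> M \<rightarrow>\<^sub>M count_space UNIV) \<and>
     (\<forall>z. AE \<omega> in M.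
        real_cond_exp M (sample_algebra M X n) (indicator {\<omega>\<in>space M. \<forall>i<n. Z i \<omega> = z i}) \<omega>
        = (\<Prod>i<n. pmf (empirical n (\<lambda>i. X i \<omega>)) (z i)))"

definition tendsto_zero_outer_prob :: "'w measure \<Rightarrow> (nat \<Rightarrow> 'w \<Rightarrow> ennreal) \<Rightarrow> bool" where
  "tendsto_zero_outer_prob M D \<longleftrightarrow>
     (\<forall>\<epsilon>>0. (\<lambda>n. outer_measure_of M {\<omega>\<in>space M. ennreal \<epsilon> < D n \<omega>}) \<longlonglongrightarrow> 0)"

text \<open>Bounded Lipschitz distance between the conditional law of \<open>V\<close> given the first \<open>n\<close>
  observations and the law of \<open>U\<close>. The supremum is taken in \<^typ>\<open>ennreal\<close>, because a version of
  the conditional expectation may be unbounded on a null set.\<close>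

definition cond_BL_dist ::
  "'w measure \<Rightarrow> (nat \<Rightarrow> 'w \<Rightarrow> 'x) \<Rightarrow> nat \<Rightarrow> 'b::minus set \<Rightarrow> ('b \<Rightarrow> real) \<Rightarrow>
   ('w \<Rightarrow> 'b) \<Rightarrow> ('w \<Rightarrow> 'b) \<Rightarrow> 'w \<Rightarrow> ennreal" where
  "cond_BL_dist M X n B nrm V U \<omega> =
     (SUP h\<in>BL1 B nrm.
        ennreal \<bar>real_cond_exp M (sample_algebra M X n) (\<lambda>\<omega>'. h (V \<omega>')) \<omega> - (\<integral>\<omega>'. h (U \<omega>') \<partial>M)\<bar>)"

end

theory Submission
  imports Defs "HOL-Library.Diagonal_Subsequence"
begin

text \<open>
  No limit law is needed. Given the data, couple each bootstrap draw (law \<open>p\<close>, the empirical measure)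
  with a fresh draw from \<open>r\<close> by a maximal coupling. Writing \<open>p\<^sub>2\<close> for the empirical measure of the
  fresh draws, \<open>p\<^sub>3 = p\<close> and \<open>p\<^sub>4\<close> for the bootstrap measure, the second moment of a centred sum gives
  \<open>E \<Sum>\<^sub>x C x * sqrt n * \<bar>p\<^sub>4 - p\<^sub>3 - (p\<^sub>2 - r)\<bar> x \<le> \<Sum>\<^sub>x C x * sqrt \<bar>r x - p x\<bar>\<close>, and this tends to \<open>0\<close> in
  probability by dominated convergence. For a functional that is differentiable at \<open>r\<close> in the weighted
  norm, the four-point difference of its values at \<open>p\<^sub>4, p\<^sub>3, p\<^sub>2, r\<close> is controlled by the four-point
  difference of the measures up to an error \<open>o(n\<^sup>-\<^sup>1\<^sup>/\<^sup>2)\<close>, which bounds the distance of the two laws.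

  The cost is convex in its first argument, with the dual potential as subgradient; compactness of
  the admissible potentials and uniqueness up to constants make the subgradient continuous. For the
  plan, the logarithmic increments of the Schroedinger potentials solve a linear system up to
  quadratic errors, and a Doeblin minorization makes this system contract oscillations.
\<close>

section \<open>Semi-dual of entropy-regularized optimal transport\<close>

text \<open>The obstacle is that the weights may be unbounded and that compactness yields only
  pointwise convergence of potentials, so the gradient of the cost is continuous merely coordinate
  by coordinate. A remainder is therefore small on a finite set only; outside it is just bounded by
  a multiple of the weight. Since \<open>sqrt n\<close> times the deviation of an empirical measure
  at \<open>x\<close> has mean at most \<open>sqrt (pmf r x)\<close>, a remainder is negligible as
  soon as its weight has a small sum against \<open>sqrt (pmf r x)\<close>; this is where
  summability of the weight against the standard deviations enters. For the plan the errors are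
  quadratic and no finite set is needed, but the increments must first be bounded linearly without
  knowing that they are small. Both functionals meet the same interface
  \<open>four_point_approx\<close>. Measurability of suprema over test functions never arises: one
  coupling bounds all test functions at once by a function of the sample, and the sample takes
  countably many values.\<close>

lemma exp_integral_le:
  fixes p :: "'a pmf" and f :: "'a \<Rightarrow> real"
  assumes f: "integrable p f" and e: "integrable p (\<lambda>x. exp (f x))"
  shows "exp (\<integral>x. f x \<partial>p) \<le> (\<integral>x. exp (f x) \<partial>p)"
proof -
  let ?m = "\<integral>x. f x \<partial>p"
  \<comment> \<open>The left integrand is the tangent of \<open>exp\<close> at the mean, which makes
    this Jensen's inequality.\<close>
  have "(\<integral>x. exp ?m * (1 + (f x - ?m)) \<partial>p) \<le> (\<integral>x. exp (f x) \<partial>p)"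
  proof (rule Bochner_Integration.integral_mono)
    show "integrable p (\<lambda>x. exp ?m * (1 + (f x - ?m)))" using f by simp
    show "exp ?m * (1 + (f x - ?m)) \<le> exp (f x)" for x
      using mult_left_mono[OF exp_ge_add_one_self[of "f x - ?m"], of "exp ?m"]
      by (simp add: exp_add[symmetric])
  qed (fact e)
  also have "(\<integral>x. exp ?m * (1 + (f x - ?m)) \<partial>p) = exp ?m" using f by simp
  finally show ?thesis .
qed

text \<open>Integrating \<open>u \<le> exp u - 1\<close> bounds the mean by zero, and a zero mean
  makes the nonnegative gap vanish on the support. The minorant \<open>l\<close> provides
  integrability of \<open>u\<close> from below. Later \<open>u\<close> is the scaled difference of a
  potential and its Sinkhorn update.\<close>

lemma exp_integral_one:
  fixes p :: "'a pmf" and u l :: "'a \<Rightarrow> real"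
  assumes one: "(\<integral>\<^sup>+x. ennreal (exp (u x)) \<partial>p) = 1"
    and l: "integrable p l" "\<And>x. x \<in> set_pmf p \<Longrightarrow> l x \<le> u x"
  shows "integrable p u" "(\<integral>x. u x \<partial>p) \<le> 0"
    and "(\<integral>x. u x \<partial>p) = 0 \<Longrightarrow> x \<in> set_pmf p \<Longrightarrow> u x = 0"
proof -
  have ie: "integrable p (\<lambda>x. exp (u x))"
    by (rule integrableI_bounded) (use one in auto)
  have Ie: "(\<integral>x. exp (u x) \<partial>p) = 1"
    using nn_integral_eq_integral[OF ie] one by simp
  show iu: "integrable p u"
  proof (rule Bochner_Integration.integrable_bound)
    show "integrable p (\<lambda>x. exp (u x) + \<bar>l x\<bar>)" using ie l(1) by simp
    show "AE x in p. norm (u x) \<le> norm (exp (u x) + \<bar>l x\<bar>)"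
    proof (rule AE_pmfI)
      fix x assume "x \<in> set_pmf p"
      then show "norm (u x) \<le> norm (exp (u x) + \<bar>l x\<bar>)"
        using l(2)[of x] exp_ge_add_one_self[of "u x"] exp_gt_zero[of "u x"]
        unfolding real_norm_def by linarith
    qed
  qed simp
  have i0: "integrable p (\<lambda>x. exp (u x) - 1 - u x)" using ie iu by simp
  have I0: "(\<integral>x. exp (u x) - 1 - u x \<partial>p) = - (\<integral>x. u x \<partial>p)" using ie iu Ie by simp
  have nn: "0 \<le> exp (u x) - 1 - u x" for x using exp_ge_add_one_self[of "u x"] by linarith
  have "0 \<le> (\<integral>x. exp (u x) - 1 - u x \<partial>p)" by (rule integral_nonneg_AE) (use nn in auto)
  with I0 show "(\<integral>x. u x \<partial>p) \<le> 0" by simp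
  assume z: "(\<integral>x. u x \<partial>p) = 0" and x: "x \<in> set_pmf p"
  have "AE x in p. exp (u x) - 1 - u x = 0"
    using integral_nonneg_eq_0_iff_AE[OF i0] nn I0 z by simp
  with x have "exp (u x) - 1 - u x = 0" by (simp add: AE_measure_pmf_iff)
  then show "u x = 0" using ln_eq_minus_one[of "exp (u x)"] by simp
qed

lemma nn_integral_pmf_swap:
  fixes p :: "'a pmf" and q :: "'b pmf"
  shows "(\<integral>\<^sup>+x. \<integral>\<^sup>+y. f x y \<partial>q \<partial>p) = (\<integral>\<^sup>+y. \<integral>\<^sup>+x. f x y \<partial>p \<partial>q)"
proof -
  have "(\<integral>\<^sup>+x. \<integral>\<^sup>+y. f x y \<partial>q \<partial>p) = (\<integral>\<^sup>+z. f (fst z) (snd z) \<partial>pair_pmf p q)"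
    by (simp add: nn_integral_pair_pmf')
  also have "\<dots> = (\<integral>\<^sup>+y. \<integral>\<^sup>+x. f x y \<partial>p \<partial>q)"
    by (subst pair_commute_pmf) (simp add: nn_integral_pair_pmf' split_beta)
  finally show ?thesis .
qed

text \<open>Countable products of compact intervals are sequentially compact: \<open>P n\<close>
  says that the coordinate with code \<open>n\<close> converges, and the diagonal sequence
  eventually runs inside every extracted subsequence.\<close>

lemma pointwise_compact:
  fixes g :: "nat \<Rightarrow> 'b::countable \<Rightarrow> real"
  assumes "\<And>k y. lo y \<le> g k y" "\<And>k y. g k y \<le> hi y"
  obtains \<sigma> l where "strict_mono \<sigma>" "\<And>y. (\<lambda>k. g (\<sigma> k) y) \<longlonglongrightarrow> l y"
proof -
  define P where "P n \<sigma> \<longleftrightarrow> convergent (\<lambda>k. g (\<sigma> k) (from_nat n :: 'b))" for n and \<sigma> :: "nat \<Rightarrow> nat"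
  interpret subseqs P
  proof
    fix n and \<sigma> :: "nat \<Rightarrow> nat" assume "strict_mono \<sigma>"
    have "bounded (range (\<lambda>k. g (\<sigma> k) (from_nat n)))"
      by (rule bounded_subset[OF bounded_closed_interval[of "lo (from_nat n)" "hi (from_nat n)"]])
        (use assms in auto)
    then obtain l \<tau> where "strict_mono \<tau>" "((\<lambda>k. g (\<sigma> k) (from_nat n)) \<circ> \<tau>) \<longlonglongrightarrow> l"
      using bounded_imp_convergent_subsequence by blast
    then show "\<exists>\<tau>. strict_mono \<tau> \<and> P n (\<sigma> \<circ> \<tau>)"
      by (auto simp: P_def convergent_def o_def)
  qed
  \<comment> \<open>Only the tail of the diagonal from index \<open>Suc n\<close> on is a
    subsequence for coordinate \<open>n\<close>; the initial segment is restored below, as it does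
    not affect convergence.\<close>
  have "P n (diagseq \<circ> (+) (Suc n))" for n
  proof (rule diagseq_holds)
    fix \<tau> \<sigma> :: "nat \<Rightarrow> nat" and n assume "strict_mono \<tau>" "P n \<sigma>"
    then show "P n (\<sigma> \<circ> \<tau>)"
      using convergent_subseq_convergent[of "\<lambda>k. g (\<sigma> k) (from_nat n)" \<tau>] by (simp add: P_def o_def)
  qed
  then have "convergent (\<lambda>k. g (diagseq (Suc n + k)) (from_nat n))" for n
    unfolding P_def o_def .
  then have "convergent (\<lambda>k. g (diagseq (k + Suc n)) (from_nat n))" for n
    unfolding add.commute[of _ "Suc n"] .
  then have "convergent (\<lambda>k. g (diagseq k) (from_nat n))" for n
    using convergent_ignore_initial_segment[of "\<lambda>k. g (diagseq k) (from_nat n)" "Suc n"] by blast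
  then have "convergent (\<lambda>k. g (diagseq k) y)" for y
    using from_nat_to_nat[of y] by metis
  then have "(\<lambda>k. g (diagseq k) y) \<longlonglongrightarrow> lim (\<lambda>k. g (diagseq k) y)" for y
    by (simp add: convergent_LIMSEQ_iff)
  with subseq_diagseq show ?thesis by (rule that)
qed

text \<open>The second marginal is fixed, while the first stays a parameter of every statement: the
  same estimates are applied to \<open>r\<close>, to empirical measures and to bootstrap
  measures.\<close>

locale erot_cost =
  fixes lam :: real and c :: "'x::countable \<times> 'y::countable \<Rightarrow> real"
    and cXm cXp :: "'x \<Rightarrow> real" and cYm cYp :: "'y \<Rightarrow> real" and s :: "'y pmf"
  assumes lam: "lam > 0" and dom: "dominating c cXm cXp cYm cYp"
    and CY_int: "integrable s (C_weight cYm cYp)"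
    and phiY_int: "integrable s (phi_weight lam cYm cYp)"
begin

abbreviation "CX \<equiv> C_weight cXm cXp"
abbreviation "CY \<equiv> C_weight cYm cYp"
abbreviation "phiY \<equiv> phi_weight lam cYm cYp"

definition Phi :: real where "Phi = (\<integral>y. phiY y \<partial>s)"

lemma c_le: "c (x, y) \<le> cXp x + cYp y" and c_ge: "cXm x + cYm y \<le> c (x, y)"
  and cY_le: "cYm y \<le> cYp y"
  using dom by (auto simp: dominating_def)

lemma CX_ge: "1 \<le> CX x" "\<bar>cXp x\<bar> \<le> CX x" "\<bar>cXm x\<bar> \<le> CX x"
  and CY_ge: "1 \<le> CY y" "\<bar>cYp y\<bar> \<le> CY y" "\<bar>cYm y\<bar> \<le> CY y"
  by (auto simp: C_weight_def)

lemma abs_c_le: "\<bar>c (x, y)\<bar> \<le> CX x + CY y"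
  using c_le[of x y] c_ge[of x y] by (auto simp: C_weight_def)

lemma phiY_ge: "1 \<le> phiY y"
  using cY_le[of y] lam by (auto simp: phi_weight_def)

lemma Phi_ge: "1 \<le> Phi"
proof -
  have "(\<integral>y. 1 \<partial>s) \<le> Phi" unfolding Phi_def
    by (rule integral_mono) (use phiY_ge phiY_int in auto)
  then show ?thesis by simp
qed

lemma cY_int [simp]: "integrable s cYp" "integrable s cYm"
  by (rule Bochner_Integration.integrable_bound[OF CY_int];
      use CY_ge in \<open>auto intro!: AE_I2 simp: C_weight_def\<close>)+

lemma cX_int: "integrable (measure_pmf r) CX \<Longrightarrow> integrable (measure_pmf r) cXp"
  "integrable (measure_pmf r) CX \<Longrightarrow> integrable (measure_pmf r) cXm"
  by (erule Bochner_Integration.integrable_bound; use CX_ge in \<open>auto intro!: AE_I2 simp: C_weight_def\<close>)+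

lemma c_section_int: "integrable s (\<lambda>y. c (x, y))"
proof (rule Bochner_Integration.integrable_bound)
  show "integrable s (\<lambda>y. CX x + CY y)" using CY_int by simp
  show "AE y in s. norm (c (x, y)) \<le> norm (CX x + CY y)"
    using abs_c_le CX_ge CY_ge by (auto intro!: AE_I2 simp: C_weight_def)
qed simp

section \<open>Soft transforms and the semi-dual functional\<close>

definition regular :: "('y \<Rightarrow> real) \<Rightarrow> bool" where
  "regular g \<longleftrightarrow> integrable (measure_pmf s) g \<and> (\<exists>k. \<forall>y. g y \<le> cYp y + k)"

definition Zp :: "('y \<Rightarrow> real) \<Rightarrow> 'x \<Rightarrow> real" where
  "Zp g x = (\<integral>y. exp ((g y - c (x, y)) / lam) \<partial>s)"

text \<open>The soft c-transform: the first potential that makes the Gibbs density integrate to one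
  over \<open>y\<close> for every \<open>x\<close>, including points without mass.\<close>

definition fpot :: "('y \<Rightarrow> real) \<Rightarrow> 'x \<Rightarrow> real" where
  "fpot g x = - lam * ln (Zp g x)"

text \<open>The semi-dual functional. The exponential term of the full dual is constant once the
  first potential is the soft transform, hence absent. The result is affine in the marginal
  \<open>r\<close>, which the envelope argument exploits.\<close>

definition dual :: "'x pmf \<Rightarrow> ('y \<Rightarrow> real) \<Rightarrow> real" where
  "dual r g = (\<integral>y. g y \<partial>s) + (\<integral>x. fpot g x \<partial>r)"

lemma kernel_le:
  assumes "g y \<le> cYp y + k"
  shows "exp ((g y - c (x, y)) / lam) \<le> exp ((k - cXm x) / lam) * phiY y"
proof -
  have "(g y - c (x, y)) / lam \<le> (k - cXm x) / lam + (cYp y - cYm y) / lam"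
    unfolding add_divide_distrib[symmetric] by (rule divide_right_mono) (use assms c_ge[of x y] lam in auto)
  then show ?thesis by (simp add: phi_weight_def exp_add[symmetric])
qed

text \<open>The upper bound by \<open>cYp + k\<close> makes the kernel integrals finite through
  \<open>phiY\<close>; the integrability of \<open>g\<close> demanded by \<open>regular\<close>
  serves the lower bound by Jensen's inequality.\<close>

lemma kernel_int:
  assumes "\<And>y. g y \<le> cYp y + k"
  shows "integrable s (\<lambda>y. exp ((g y - c (x, y)) / lam))"
proof (rule Bochner_Integration.integrable_bound)
  show "integrable s (\<lambda>y. exp ((k - cXm x) / lam) * phiY y)" using phiY_int by simp
  show "AE y in s. norm (exp ((g y - c (x, y)) / lam)) \<le> norm (exp ((k - cXm x) / lam) * phiY y)"
    using kernel_le[of g _ k x, OF assms] phiY_ge by (auto intro!: AE_I2 simp: phi_weight_def)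
qed simp

lemma regular_kernel_int: "regular g \<Longrightarrow> integrable s (\<lambda>y. exp ((g y - c (x, y)) / lam))"
  unfolding regular_def using kernel_int by blast

lemma Zp_ge:
  assumes "regular g"
  shows "exp (((\<integral>y. g y \<partial>s) - (\<integral>y. c (x, y) \<partial>s)) / lam) \<le> Zp g x"
proof -
  have g: "integrable s g" using assms by (simp add: regular_def)
  have "exp (\<integral>y. (g y - c (x, y)) / lam \<partial>s) \<le> Zp g x" unfolding Zp_def
    by (rule exp_integral_le) (use g c_section_int regular_kernel_int[OF assms] in auto)
  then show ?thesis using g c_section_int by simp
qed

lemma Zp_pos: "regular g \<Longrightarrow> 0 < Zp g x"
  using Zp_ge[of g x] exp_gt_zero less_le_trans by blast

lemma exp_fpot: "regular g \<Longrightarrow> exp (fpot g x / lam) = 1 / Zp g x"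
  and exp_neg_fpot: "regular g \<Longrightarrow> exp (- fpot g x / lam) = Zp g x"
  using Zp_pos[of g x] lam by (simp_all add: fpot_def exp_minus inverse_eq_divide)

text \<open>Jensen's inequality sees \<open>g\<close> only through its mean, so no pointwise lower
  bound on \<open>g\<close> enters. The opposite estimate \<open>fpot_ge\<close> uses the pointwise
  upper bound instead.\<close>

lemma fpot_le:
  assumes "regular g"
  shows "fpot g x \<le> cXp x + (\<integral>y. cYp y - g y \<partial>s)"
proof -
  have g: "integrable s g" using assms by (simp add: regular_def)
  have "((\<integral>y. g y \<partial>s) - (\<integral>y. c (x, y) \<partial>s)) / lam \<le> ln (Zp g x)"
    using Zp_ge[OF assms, of x] Zp_pos[OF assms, of x] by (simp add: ln_ge_iff)
  then have "fpot g x \<le> (\<integral>y. c (x, y) \<partial>s) - (\<integral>y. g y \<partial>s)"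
    using lam by (simp add: fpot_def field_simps)
  also have "(\<integral>y. c (x, y) \<partial>s) \<le> (\<integral>y. cXp x + cYp y \<partial>s)"
    by (rule integral_mono) (use c_section_int c_le in auto)
  finally show ?thesis using g by simp
qed

lemma fpot_ge:
  assumes "regular g" "\<And>y. g y \<le> cYp y + k"
  shows "cXm x - k - lam * ln Phi \<le> fpot g x"
proof -
  have "Zp g x \<le> (\<integral>y. exp ((k - cXm x) / lam) * phiY y \<partial>s)" unfolding Zp_def
    by (rule integral_mono) (use kernel_le[of g _ k x, OF assms(2)] kernel_int[OF assms(2)] phiY_int in auto)
  then have "Zp g x \<le> exp ((k - cXm x) / lam) * Phi" by (simp add: Phi_def)
  then have "ln (Zp g x) \<le> ln (exp ((k - cXm x) / lam) * Phi)"
    using Zp_pos[OF assms(1)] Phi_ge by (subst ln_le_cancel_iff) auto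
  then have "ln (Zp g x) \<le> (k - cXm x) / lam + ln Phi"
    using Phi_ge by (simp add: ln_mult)
  then show ?thesis using lam by (simp add: fpot_def field_simps)
qed

lemma fpot_int:
  assumes "regular g" "integrable (measure_pmf r) CX"
  shows "integrable (measure_pmf r) (fpot g)"
proof -
  obtain k where k: "\<And>y. g y \<le> cYp y + k" using assms(1) by (auto simp: regular_def)
  let ?K = "\<bar>k\<bar> + \<bar>lam * ln Phi\<bar> + \<bar>\<integral>y. cYp y - g y \<partial>s\<bar>"
  show ?thesis
  proof (rule Bochner_Integration.integrable_bound)
    show "integrable r (\<lambda>x. CX x + ?K)" using assms(2) by simp
    have "\<bar>fpot g x\<bar> \<le> CX x + ?K" for x
      using fpot_le[OF assms(1), of x] fpot_ge[OF assms(1) k, of x] CX_ge[of x] by linarith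
    then show "AE x in r. norm (fpot g x) \<le> norm (CX x + ?K)" by (auto intro!: AE_I2 intro: order_trans[OF _ abs_ge_self])
  qed simp
qed

lemma regular_shift: "regular g \<Longrightarrow> regular (\<lambda>y. g y + a)"
proof -
  assume "regular g"
  then obtain k where "integrable s g" "\<And>y. g y \<le> cYp y + k" by (auto simp: regular_def)
  then show ?thesis unfolding regular_def by (auto intro!: exI[of _ "k + a"] simp: add.assoc[symmetric])
qed

lemma fpot_shift:
  assumes "regular g"
  shows "fpot (\<lambda>y. g y + a) x = fpot g x - a"
proof -
  have "Zp (\<lambda>y. g y + a) x = exp (a / lam) * Zp g x"
    unfolding Zp_def integral_mult_right_zero[symmetric]
    by (rule Bochner_Integration.integral_cong) (simp_all add: exp_add[symmetric] add_divide_distrib[symmetric] algebra_simps)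
  then show ?thesis using Zp_pos[OF assms, of x] lam by (simp add: fpot_def ln_mult field_simps)
qed

lemma dual_shift:
  assumes "regular g" "integrable (measure_pmf r) CX"
  shows "dual r (\<lambda>y. g y + a) = dual r g"
  using assms fpot_int[OF assms] by (simp add: dual_def fpot_shift regular_def)

text \<open>The soft transform back to the second space. Off the support of \<open>s\<close> the
  marginal equation says nothing, and \<open>cYp y\<close> is the value that \<open>adm\<close>
  prescribes.\<close>

definition gpot :: "'x pmf \<Rightarrow> ('x \<Rightarrow> real) \<Rightarrow> 'y \<Rightarrow> real" where
  "gpot r f y = (if pmf s y = 0 then cYp y else - lam * ln (\<integral>x. exp ((f x - c (x, y)) / lam) \<partial>r))"

text \<open>Both inequalities come from \<open>1 + u \<le> exp u\<close> for an \<open>u\<close> with \<open>\<integral> exp u = 1\<close>; strictness of this bound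
  settles the equality case, which replaces a first-order condition for maximizers.\<close>

lemma sinkhorn_step:
  assumes g: "regular g" and r: "integrable (measure_pmf r) CX"
    and norm: "(\<integral>x. exp ((fpot g x - cXp x) / lam) \<partial>r) = 1"
  defines "g' \<equiv> gpot r (fpot g)"
  shows "\<And>y. g' y \<le> cYp y" and "\<And>y. pmf s y = 0 \<Longrightarrow> g' y = cYp y" and "regular g'"
    and "(\<integral>y. g y \<partial>s) \<le> (\<integral>y. g' y \<partial>s)" and "(\<integral>x. fpot g x \<partial>r) \<le> (\<integral>x. fpot g' x \<partial>r)"
    and "\<And>y. (\<integral>y. g y \<partial>s) = (\<integral>y. g' y \<partial>s) \<Longrightarrow> y \<in> set_pmf s \<Longrightarrow> g y = g' y"
    and "\<And>y. y \<in> set_pmf s \<Longrightarrow> (\<integral>\<^sup>+x. ennreal (exp ((fpot g x + g' y - c (x, y)) / lam)) \<partial>r) = 1"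
proof -
  let ?f = "fpot g"
  define Q where "Q y = (\<integral>x. exp ((?f x - c (x, y)) / lam) \<partial>r)" for y
  define nQ where "nQ y = (\<integral>\<^sup>+x. ennreal (exp ((?f x - c (x, y)) / lam)) \<partial>r)" for y
  have gi: "integrable s g" using g by (simp add: regular_def)
  \<comment> \<open>Total mass of a Gibbs density: the choice of \<open>fpot\<close> makes each
    inner integral over \<open>y\<close> equal to one, and Tonelli carries this to the other
    order.\<close>
  have T1: "(\<integral>\<^sup>+y. ennreal (exp (g y / lam)) * nQ y \<partial>s) = 1"
  proof -
    have "(\<integral>\<^sup>+y. ennreal (exp (g y / lam)) * nQ y \<partial>s)
      = (\<integral>\<^sup>+y. \<integral>\<^sup>+x. ennreal (exp (?f x / lam)) * ennreal (exp ((g y - c (x, y)) / lam)) \<partial>r \<partial>s)"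
      unfolding nQ_def
      by (subst nn_integral_cmult[symmetric], simp)
        (auto intro!: nn_integral_cong simp: ennreal_mult[symmetric] exp_add[symmetric] add_divide_distrib diff_divide_distrib)
    also have "\<dots> = (\<integral>\<^sup>+x. \<integral>\<^sup>+y. ennreal (exp (?f x / lam)) * ennreal (exp ((g y - c (x, y)) / lam)) \<partial>s \<partial>r)"
      by (rule nn_integral_pmf_swap)
    also have "\<dots> = (\<integral>\<^sup>+x. ennreal (exp (?f x / lam)) * ennreal (Zp g x) \<partial>r)"
      by (subst nn_integral_cmult, simp)
        (auto intro!: nn_integral_cong simp: Zp_def nn_integral_eq_integral[OF regular_kernel_int[OF g]])
    also have "\<dots> = (\<integral>\<^sup>+x. 1 \<partial>r)"
      using Zp_pos[OF g] by (auto intro!: nn_integral_cong simp: exp_fpot[OF g] ennreal_mult[symmetric] less_imp_le less_imp_neq[THEN not_sym])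
    finally show ?thesis by simp
  qed
  have nQ_fin: "nQ y < \<infinity>" if "y \<in> set_pmf s" for y
  proof -
    have "AE y in s. ennreal (exp (g y / lam)) * nQ y \<noteq> \<infinity>"
      by (rule nn_integral_PInf_AE) (use T1 in auto)
    then show ?thesis using that by (auto simp: AE_measure_pmf_iff ennreal_mult_eq_top_iff top.not_eq_extremum)
  qed
  have Qi: "integrable r (\<lambda>x. exp ((?f x - c (x, y)) / lam))" if "y \<in> set_pmf s" for y
    by (rule integrableI_bounded) (use nQ_fin[OF that] in \<open>auto simp: nQ_def\<close>)
  have nQ: "nQ y = ennreal (Q y)" if "y \<in> set_pmf s" for y
    unfolding nQ_def Q_def by (rule nn_integral_eq_integral[OF Qi[OF that]]) auto
  \<comment> \<open>A function that is not integrable has Bochner integral 0, so the value 1 in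
    \<open>norm\<close> already gives integrability.\<close>
  have ni: "integrable r (\<lambda>x. exp ((?f x - cXp x) / lam))"
    using norm not_integrable_integral_eq by fastforce
  \<comment> \<open>The normalisation against \<open>cXp\<close> turns
    \<open>c \<le> cXp + cYp\<close> into the lower bound on \<open>Q\<close> that yields
    \<open>g' \<le> cYp\<close>.\<close>
  have Qge: "exp (- cYp y / lam) \<le> Q y" if "y \<in> set_pmf s" for y
  proof -
    have "(\<integral>x. exp (- cYp y / lam) * exp ((?f x - cXp x) / lam) \<partial>r) \<le> Q y" unfolding Q_def
    proof (rule integral_mono)
      show "exp (- cYp y / lam) * exp ((?f x - cXp x) / lam) \<le> exp ((?f x - c (x, y)) / lam)" for x
        unfolding exp_add[symmetric] exp_le_cancel_iff add_divide_distrib[symmetric]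
        by (rule divide_right_mono) (use c_le[of x y] lam in auto)
    qed (use ni Qi[OF that] in auto)
    then show ?thesis using norm by simp
  qed
  have Qpos: "0 < Q y" if "y \<in> set_pmf s" for y
    using Qge[OF that] exp_gt_zero[of "- cYp y / lam"] by linarith
  have g'_eq: "g' y = - lam * ln (Q y)" if "y \<in> set_pmf s" for y
    using that by (simp add: g'_def gpot_def Q_def set_pmf_iff)
  show g'_le: "g' y \<le> cYp y" for y
  proof (cases "y \<in> set_pmf s")
    case True
    have "- cYp y / lam \<le> ln (Q y)" using Qge[OF True] Qpos[OF True] by (simp add: ln_ge_iff)
    then show ?thesis using lam by (simp add: g'_eq[OF True] field_simps)
  qed (simp add: g'_def gpot_def set_pmf_iff)
  show "pmf s y = 0 \<Longrightarrow> g' y = cYp y" for y by (simp add: g'_def gpot_def)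
  have expg': "exp (- g' y / lam) = Q y" if "y \<in> set_pmf s" for y
    using Qpos[OF that] lam by (simp add: g'_eq[OF that])
  \<comment> \<open>The total mass again, now read as \<open>exp ((g - g') / lam)\<close> having
    mean one, which is the hypothesis of \<open>exp_integral_one\<close>.\<close>
  have one: "(\<integral>\<^sup>+y. ennreal (exp ((g y - g' y) / lam)) \<partial>s) = 1"
  proof -
    have "(\<integral>\<^sup>+y. ennreal (exp ((g y - g' y) / lam)) \<partial>s) = (\<integral>\<^sup>+y. ennreal (exp (g y / lam)) * nQ y \<partial>s)"
    proof (rule nn_integral_cong_AE, rule AE_pmfI)
      fix y assume y: "y \<in> set_pmf s"
      show "ennreal (exp ((g y - g' y) / lam)) = ennreal (exp (g y / lam)) * nQ y"
        using Qpos[OF y] by (simp add: nQ[OF y] expg'[OF y, symmetric] ennreal_mult[symmetric] exp_add[symmetric] diff_divide_distrib)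
    qed
    with T1 show ?thesis by simp
  qed
  have li: "integrable s (\<lambda>y. (g y - cYp y) / lam)" using gi by simp
  have lb: "(g y - cYp y) / lam \<le> (g y - g' y) / lam" for y
    using g'_le[of y] lam by (simp add: divide_right_mono)
  note E = exp_integral_one[OF one li lb]
  have "integrable s (\<lambda>y. g y - lam * ((g y - g' y) / lam))"
    by (rule Bochner_Integration.integrable_diff[OF gi], rule integrable_mult_right, rule E(1))
  then have g'i: "integrable s g'" using lam by simp
  then show reg': "regular g'" using g'_le by (auto simp: regular_def intro!: exI[of _ 0])
  show "(\<integral>y. g y \<partial>s) \<le> (\<integral>y. g' y \<partial>s)" using E(2) gi g'i lam by (simp add: divide_le_0_iff)
  show "g y = g' y" if "(\<integral>y. g y \<partial>s) = (\<integral>y. g' y \<partial>s)" "y \<in> set_pmf s" for y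
    using E(3)[of y] that gi g'i lam by simp
  show sys: "(\<integral>\<^sup>+x. ennreal (exp ((fpot g x + g' y - c (x, y)) / lam)) \<partial>r) = 1" if y: "y \<in> set_pmf s" for y
  proof -
    have "(\<integral>\<^sup>+x. ennreal (exp ((fpot g x + g' y - c (x, y)) / lam)) \<partial>r) = ennreal (exp (g' y / lam)) * nQ y"
      unfolding nQ_def by (subst nn_integral_cmult[symmetric], simp)
        (auto intro!: nn_integral_cong simp: ennreal_mult[symmetric] exp_add[symmetric] add_divide_distrib diff_divide_distrib)
    also have "\<dots> = 1"
      using Qpos[OF y] by (simp add: nQ[OF y] expg'[OF y, symmetric] ennreal_mult[symmetric] exp_add[symmetric])
    finally show ?thesis .
  qed
  \<comment> \<open>The analogous identity for the first potentials, with the column equations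
    \<open>sys\<close> in place of the row normalisation.\<close>
  have one': "(\<integral>\<^sup>+x. ennreal (exp ((?f x - fpot g' x) / lam)) \<partial>r) = 1"
  proof -
    have "(\<integral>\<^sup>+x. ennreal (exp ((?f x - fpot g' x) / lam)) \<partial>r) = (\<integral>\<^sup>+x. ennreal (exp (?f x / lam)) * ennreal (Zp g' x) \<partial>r)"
      by (auto intro!: nn_integral_cong simp: ennreal_mult[symmetric] exp_neg_fpot[OF reg', symmetric] exp_add[symmetric] diff_divide_distrib)
    also have "\<dots> = (\<integral>\<^sup>+x. \<integral>\<^sup>+y. ennreal (exp (?f x / lam)) * ennreal (exp ((g' y - c (x, y)) / lam)) \<partial>s \<partial>r)"
      by (subst nn_integral_cmult, simp)
        (auto intro!: nn_integral_cong simp: Zp_def nn_integral_eq_integral[OF regular_kernel_int[OF reg']])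
    also have "\<dots> = (\<integral>\<^sup>+y. \<integral>\<^sup>+x. ennreal (exp (?f x / lam)) * ennreal (exp ((g' y - c (x, y)) / lam)) \<partial>r \<partial>s)"
      by (rule nn_integral_pmf_swap)
    also have "\<dots> = (\<integral>\<^sup>+y. 1 \<partial>s)"
    proof (rule nn_integral_cong_AE, rule AE_pmfI)
      fix y assume y: "y \<in> set_pmf s"
      show "(\<integral>\<^sup>+x. ennreal (exp (?f x / lam)) * ennreal (exp ((g' y - c (x, y)) / lam)) \<partial>r) = 1"
        by (subst sys[OF y, symmetric])
          (auto intro!: nn_integral_cong simp: ennreal_mult[symmetric] exp_add[symmetric] add_divide_distrib diff_divide_distrib)
    qed
    finally show ?thesis by simp
  qed
  let ?u = "\<lambda>x. (?f x - (cXp x + (\<integral>y. cYp y - g' y \<partial>s))) / lam"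
  have fi: "integrable r ?f" "integrable r (fpot g')" using fpot_int g reg' r by auto
  have li': "integrable r ?u" using fi cX_int[OF r] by simp
  have lb': "?u x \<le> (?f x - fpot g' x) / lam" for x
    using fpot_le[OF reg', of x] lam by (simp add: divide_right_mono)
  show "(\<integral>x. fpot g x \<partial>r) \<le> (\<integral>x. fpot g' x \<partial>r)"
    using exp_integral_one(2)[OF one' li' lb'] fi lam by (simp add: divide_le_0_iff)
qed

text \<open>Fixing the value off the support of \<open>s\<close>, where \<open>g\<close> does not matter, makes this class compact for
  pointwise convergence.\<close>

definition adm :: "real \<Rightarrow> ('y \<Rightarrow> real) set" where
  "adm N = {g. (\<forall>y. g y \<le> cYp y) \<and> (\<forall>y. pmf s y = 0 \<longrightarrow> g y = cYp y) \<and>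
               integrable s g \<and> (\<integral>y. cYp y - g y \<partial>s) \<le> N}"

text \<open>The condition for the first marginal holds by the choice of \<open>fpot\<close>.\<close>

definition schroedinger :: "'x pmf \<Rightarrow> ('y \<Rightarrow> real) \<Rightarrow> bool" where
  "schroedinger r g \<longleftrightarrow>
     (\<forall>y\<in>set_pmf s. (\<integral>\<^sup>+x. ennreal (exp ((fpot g x + g y - c (x, y)) / lam)) \<partial>r) = 1)"

text \<open>After normalisation the first potential has integral at most that of \<open>cXp\<close>;
  a dual value no worse than the integrals of the lower dominating functions then limits the deficit
  \<open>\<integral> (cYp - g')\<close> of the update to this number.\<close>

definition Nmin :: "'x pmf \<Rightarrow> real" where
  "Nmin r = (\<integral>y. cYp y - cYm y \<partial>s) + (\<integral>x. cXp x - cXm x \<partial>r)"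

section \<open>Existence of maximizers and the Schroedinger system\<close>

lemma adm_regular: "g \<in> adm N \<Longrightarrow> regular g"
  by (auto simp: adm_def regular_def intro!: exI[of _ 0])

lemma adm_fpot_le: "g \<in> adm N \<Longrightarrow> fpot g x \<le> cXp x + N"
  using fpot_le[OF adm_regular, of g N x] by (auto simp: adm_def)

lemma adm_fpot_ge: "g \<in> adm N \<Longrightarrow> cXm x - lam * ln Phi \<le> fpot g x"
  using fpot_ge[OF adm_regular, of g N 0 x] by (auto simp: adm_def)

text \<open>Adding \<open>a\<close> to \<open>g\<close> multiplies the integral by
  \<open>exp (- a / lam)\<close>, so \<open>a\<close> is \<open>lam\<close> times its logarithm. The
  integral is finite by \<open>fpot_le\<close> and positive by Jensen's inequality.\<close>

lemma normalise:
  assumes g: "regular g" and r: "integrable (measure_pmf r) CX"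
  obtains a where "(\<integral>x. exp ((fpot (\<lambda>y. g y + a) x - cXp x) / lam) \<partial>r) = 1"
proof -
  let ?I = "\<integral>x. exp ((fpot g x - cXp x) / lam) \<partial>r"
  let ?N = "\<integral>y. cYp y - g y \<partial>s"
  have i: "integrable r (\<lambda>x. exp ((fpot g x - cXp x) / lam))"
  proof (rule measure_pmf.integrable_const_bound)
    show "AE x in r. norm (exp ((fpot g x - cXp x) / lam)) \<le> exp (?N / lam)"
      using fpot_le[OF g] lam by (auto intro!: AE_I2 divide_right_mono simp: algebra_simps)
  qed simp
  have "exp (\<integral>x. (fpot g x - cXp x) / lam \<partial>r) \<le> ?I"
    by (rule exp_integral_le) (use i fpot_int[OF g r] cX_int[OF r] in auto)
  then have pos: "0 < ?I" using exp_gt_zero less_le_trans by blast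
  have "(\<integral>x. exp ((fpot (\<lambda>y. g y + lam * ln ?I) x - cXp x) / lam) \<partial>r)
      = (\<integral>x. (1 / ?I) * exp ((fpot g x - cXp x) / lam) \<partial>r)"
  proof (rule Bochner_Integration.integral_cong[OF refl])
    fix x
    have "(fpot (\<lambda>y. g y + lam * ln ?I) x - cXp x) / lam = (fpot g x - cXp x) / lam - ln ?I"
      using lam by (simp add: fpot_shift[OF g] field_simps)
    then show "exp ((fpot (\<lambda>y. g y + lam * ln ?I) x - cXp x) / lam) = (1 / ?I) * exp ((fpot g x - cXp x) / lam)"
      using pos by (simp add: exp_diff)
  qed
  also have "\<dots> = 1" using pos by simp
  finally show ?thesis by (rule that)
qed

text \<open>One normalised Sinkhorn update never lowers the semi-dual value and lands in the compact
  class. If nothing is gained, the equality case says that \<open>g\<close> agrees with its update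
  up to a constant on the support of \<open>s\<close>, and the column equations hold for the update
  by construction.\<close>

lemma improve:
  assumes g: "regular g" and r: "integrable (measure_pmf r) CX" and N: "Nmin r \<le> N"
    and D: "(\<integral>y. cYm y \<partial>s) + (\<integral>x. cXm x \<partial>r) \<le> dual r g"
  shows "\<exists>g'\<in>adm N. dual r g \<le> dual r g' \<and> (dual r g' \<le> dual r g \<longrightarrow> schroedinger r g)"
proof -
  obtain a where a: "(\<integral>x. exp ((fpot (\<lambda>y. g y + a) x - cXp x) / lam) \<partial>r) = 1"
    by (rule normalise[OF g r])
  define g1 where "g1 = (\<lambda>y. g y + a)"
  have g1: "regular g1" unfolding g1_def by (rule regular_shift[OF g])
  have n: "(\<integral>x. exp ((fpot g1 x - cXp x) / lam) \<partial>r) = 1" using a by (simp add: g1_def)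
  define g' where "g' = gpot r (fpot g1)"
  note S = sinkhorn_step[OF g1 r n, folded g'_def]
  have dg1: "dual r g1 = dual r g" unfolding g1_def by (rule dual_shift[OF g r])
  have i: "integrable r (\<lambda>x. exp ((fpot g1 x - cXp x) / lam))"
    using n not_integrable_integral_eq by fastforce
  have fi: "integrable r (fpot g1)" by (rule fpot_int[OF g1 r])
  have "exp (\<integral>x. (fpot g1 x - cXp x) / lam \<partial>r) \<le> 1"
    unfolding n[symmetric] by (rule exp_integral_le) (use i fi cX_int[OF r] in auto)
  then have f1: "(\<integral>x. fpot g1 x \<partial>r) \<le> (\<integral>x. cXp x \<partial>r)"
    using fi cX_int[OF r] lam by (simp add: divide_le_0_iff)
  have g'i: "integrable s g'" using S(3) by (simp add: regular_def)
  have "(\<integral>y. cYp y - g' y \<partial>s) \<le> N"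
    using f1 S(4) D dg1 N g'i cX_int[OF r] by (simp add: dual_def Nmin_def)
  then have A: "g' \<in> adm N" using S(1,2) g'i by (simp add: adm_def)
  have le: "dual r g \<le> dual r g'" using S(4,5) dg1 unfolding dual_def by linarith
  have "schroedinger r g" if "dual r g' \<le> dual r g"
    unfolding schroedinger_def
  proof
    fix y assume y: "y \<in> set_pmf s"
    have "(\<integral>y. g1 y \<partial>s) = (\<integral>y. g' y \<partial>s)"
      using that S(4,5) dg1 unfolding dual_def by linarith
    from S(6)[OF this y] have "g1 y = g' y" .
    then have "fpot g x + g y = fpot g1 x + g' y" for x
      by (simp add: g1_def fpot_shift[OF g])
    then show "(\<integral>\<^sup>+x. ennreal (exp ((fpot g x + g y - c (x, y)) / lam)) \<partial>r) = 1"
      using S(7)[OF y] by simp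
  qed
  with A le show ?thesis by blast
qed

text \<open>The function \<open>cYm\<close> reaches the threshold of \<open>improve\<close>, since
  \<open>c \<ge> cXm + cYm\<close> gives \<open>fpot cYm \<ge> cXm\<close>; its update lies in the
  class.\<close>

lemma adm_base:
  assumes r: "integrable (measure_pmf r) CX" and N: "Nmin r \<le> N"
  shows "\<exists>g\<in>adm N. (\<integral>y. cYm y \<partial>s) + (\<integral>x. cXm x \<partial>r) \<le> dual r g"
proof -
  have g: "regular cYm" using cY_le by (auto simp: regular_def intro!: exI[of _ 0])
  have "cXm x \<le> fpot cYm x" for x
  proof -
    have "Zp cYm x \<le> (\<integral>y. exp (- cXm x / lam) \<partial>s)" unfolding Zp_def
    proof (rule integral_mono)
      show "exp ((cYm y - c (x, y)) / lam) \<le> exp (- cXm x / lam)" for y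
        by (subst exp_le_cancel_iff, rule divide_right_mono) (use c_ge[of x y] lam in auto)
    qed (use regular_kernel_int[OF g] in auto)
    then have "Zp cYm x \<le> exp (- cXm x / lam)" by simp
    then have "ln (Zp cYm x) \<le> - cXm x / lam" using Zp_pos[OF g, of x] by (metis ln_exp ln_le_cancel_iff exp_gt_zero)
    then show ?thesis using lam by (simp add: fpot_def field_simps)
  qed
  then have "(\<integral>x. cXm x \<partial>r) \<le> (\<integral>x. fpot cYm x \<partial>r)"
    by (intro integral_mono) (use cX_int[OF r] fpot_int[OF g r] in auto)
  then have "(\<integral>y. cYm y \<partial>s) + (\<integral>x. cXm x \<partial>r) \<le> dual r cYm" by (simp add: dual_def)
  with improve[OF g r N this] show ?thesis by (meson order_trans)
qed

text \<open>Dominated convergence treats the partition functions, with a majorant built from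
  \<open>phiY\<close>, and the integrals of \<open>fpot\<close>. No majorant is at hand for the
  deficits \<open>cYp - g k\<close>, which may lose mass in the limit; Fatou's lemma gives the
  direction that favours the limit.\<close>

lemma adm_limit:
  assumes g: "\<And>k. g k \<in> adm N" and l: "\<And>y. (\<lambda>k. g k y) \<longlonglongrightarrow> l y"
    and L: "(\<lambda>k. \<integral>y. cYp y - g k y \<partial>s) \<longlonglongrightarrow> L"
  shows "l \<in> adm N" and "(\<integral>y. cYp y - l y \<partial>s) \<le> L"
    and "\<And>x. (\<lambda>k. fpot (g k) x) \<longlonglongrightarrow> fpot l x"
    and "integrable (measure_pmf r) CX \<Longrightarrow> (\<lambda>k. \<integral>x. fpot (g k) x \<partial>r) \<longlonglongrightarrow> (\<integral>x. fpot l x \<partial>r)"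
proof -
  have gi: "integrable s (g k)" for k using g by (simp add: adm_def)
  have gle: "g k y \<le> cYp y" for k y using g by (simp add: adm_def)
  have gN: "(\<integral>y. cYp y - g k y \<partial>s) \<le> N" for k using g[of k] unfolding adm_def by blast
  have lle: "l y \<le> cYp y" for y by (rule LIMSEQ_le_const2[OF l]) (use gle in auto)
  have LN: "L \<le> N" by (rule LIMSEQ_le_const2[OF L]) (use gN in auto)
  have L0: "0 \<le> L" by (rule LIMSEQ_le_const[OF L]) (use gle in \<open>auto intro!: integral_nonneg_AE\<close>)
  have "(\<integral>\<^sup>+y. ennreal (cYp y - l y) \<partial>s) = (\<integral>\<^sup>+y. liminf (\<lambda>k. ennreal (cYp y - g k y)) \<partial>s)"
    by (intro nn_integral_cong lim_imp_Liminf[symmetric] tendsto_ennrealI tendsto_diff tendsto_const l) simp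
  also have "\<dots> \<le> liminf (\<lambda>k. \<integral>\<^sup>+y. ennreal (cYp y - g k y) \<partial>s)"
    by (rule nn_integral_liminf) simp
  also have "\<dots> = liminf (\<lambda>k. ennreal (\<integral>y. cYp y - g k y \<partial>s))"
    by (subst nn_integral_eq_integral) (use gi gle in auto)
  also have "\<dots> = ennreal L"
    by (intro lim_imp_Liminf tendsto_ennrealI L) simp
  finally have F: "(\<integral>\<^sup>+y. ennreal (cYp y - l y) \<partial>s) \<le> ennreal L" .
  have di: "integrable s (\<lambda>y. cYp y - l y)"
    by (rule integrableI_bounded) (use F lle in \<open>auto simp: le_less_trans\<close>)
  have "integrable s (\<lambda>y. cYp y - (cYp y - l y))"
    by (rule Bochner_Integration.integrable_diff[OF _ di]) simp
  then have li: "integrable s l" by simp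
  show iL: "(\<integral>y. cYp y - l y \<partial>s) \<le> L"
    using F L0 nn_integral_eq_integral[OF di] lle by (simp add: )
  have "l y = cYp y" if "pmf s y = 0" for y
  proof -
    have "g k y = cYp y" for k using g[of k] that by (simp add: adm_def)
    then show ?thesis using l[of y] by (simp add: LIMSEQ_const_iff)
  qed
  then show la: "l \<in> adm N" using lle li iL LN by (simp add: adm_def)
  have lr: "regular l" by (rule adm_regular[OF la])
  show fl: "(\<lambda>k. fpot (g k) x) \<longlonglongrightarrow> fpot l x" for x
  proof -
    have "(\<lambda>k. Zp (g k) x) \<longlonglongrightarrow> Zp l x" unfolding Zp_def
    proof (rule integral_dominated_convergence[where w="\<lambda>y. exp ((0 - cXm x) / lam) * phiY y"])
      show "integrable s (\<lambda>y. exp ((0 - cXm x) / lam) * phiY y)" using phiY_int by simp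
      show "AE y in s. (\<lambda>k. exp ((g k y - c (x, y)) / lam)) \<longlonglongrightarrow> exp ((l y - c (x, y)) / lam)"
        using lam by (auto intro!: AE_I2 tendsto_intros l)
      show "AE y in s. norm (exp ((g k y - c (x, y)) / lam)) \<le> exp ((0 - cXm x) / lam) * phiY y" for k
        using kernel_le[of "g k" _ 0 x] gle[of k] by (auto intro!: AE_I2)
    qed auto
    then show ?thesis unfolding fpot_def
      by (intro tendsto_intros) (use Zp_pos[OF lr, of x] in auto)
  qed
  show "(\<lambda>k. \<integral>x. fpot (g k) x \<partial>r) \<longlonglongrightarrow> (\<integral>x. fpot l x \<partial>r)" if r: "integrable (measure_pmf r) CX"
  proof (rule integral_dominated_convergence[where w="\<lambda>x. CX x + \<bar>lam * ln Phi\<bar> + \<bar>N\<bar>"])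
    show "AE x in r. norm (fpot (g k) x) \<le> CX x + \<bar>lam * ln Phi\<bar> + \<bar>N\<bar>" for k
    proof (rule AE_I2)
      fix x show "norm (fpot (g k) x) \<le> CX x + \<bar>lam * ln Phi\<bar> + \<bar>N\<bar>"
        using adm_fpot_le[OF g, of k x] adm_fpot_ge[OF g, of x k] CX_ge[of x] unfolding real_norm_def by linarith
    qed
  qed (use r fl in auto)
qed


text \<open>An atom of mass \<open>pmf s y\<close> cannot carry more than the total deficit. For
  mass zero the quotient is 0 by convention and the value of \<open>g\<close> is exactly
  \<open>cYp y\<close>.\<close>

lemma adm_ge:
  assumes "g \<in> adm N"
  shows "cYp y - N / pmf s y \<le> g y"
proof (cases "pmf s y = 0")
  case True
  then show ?thesis using assms by (simp add: adm_def)
next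
  case False
  have i: "integrable s (\<lambda>y. cYp y - g y)" using assms by (simp add: adm_def)
  have "(\<integral>z. indicator {y} z * (cYp y - g y) \<partial>s) \<le> (\<integral>y. cYp y - g y \<partial>s)"
    by (rule integral_mono_AE'[OF i]) (use assms in \<open>auto simp: adm_def indicator_def intro!: AE_I2\<close>)
  moreover have "(\<integral>y. cYp y - g y \<partial>s) \<le> N" using assms unfolding adm_def by blast
  moreover have "(\<integral>z. indicator {y} z * (cYp y - g y) \<partial>s) = pmf s y * (cYp y - g y)"
    by (simp add: measure_pmf_single)
  ultimately have "pmf s y * (cYp y - g y) \<le> N" by linarith
  then show ?thesis using False by (simp add: field_simps)
qed

text \<open>A second extraction makes the deficits converge; Fatou then gives
  \<open>S \<le> dual r l\<close> and \<open>up\<close> the converse. The convergence of the first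
  potentials is exported for the stability argument.\<close>

lemma maximizing_subseq:
  assumes g: "\<And>k. g k \<in> adm N" and S: "(\<lambda>k. dual r (g k)) \<longlonglongrightarrow> S"
    and up: "\<And>g. g \<in> adm N \<Longrightarrow> dual r g \<le> S" and r: "integrable (measure_pmf r) CX"
  obtains \<sigma> l where "strict_mono \<sigma>" "l \<in> adm N" "dual r l = S"
    "\<And>x. (\<lambda>k. fpot (g (\<sigma> k)) x) \<longlonglongrightarrow> fpot l x"
proof -
  obtain \<sigma> l where \<sigma>: "strict_mono \<sigma>" and l: "\<And>y. (\<lambda>k. g (\<sigma> k) y) \<longlonglongrightarrow> l y"
    by (rule pointwise_compact[of "\<lambda>y. cYp y - N / pmf s y" g cYp])
      (use adm_ge[OF g] g in \<open>auto simp: adm_def\<close>)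
  have gi: "integrable s (g k)" for k using g by (simp add: adm_def)
  have b: "0 \<le> (\<integral>y. cYp y - g k y \<partial>s)" "(\<integral>y. cYp y - g k y \<partial>s) \<le> N" for k
  proof -
    show "0 \<le> (\<integral>y. cYp y - g k y \<partial>s)"
      by (rule integral_nonneg_AE) (use g[of k] in \<open>auto simp: adm_def\<close>)
    show "(\<integral>y. cYp y - g k y \<partial>s) \<le> N" using g[of k] unfolding adm_def by blast
  qed
  have "bounded (range (\<lambda>k. \<integral>y. cYp y - g (\<sigma> k) y \<partial>s))"
    by (rule bounded_subset[OF bounded_closed_interval[of 0 N]]) (rule image_subsetI, rule iffD2[OF atLeastAtMost_iff], rule conjI, rule b, rule b)
  then obtain L \<tau> where \<tau>: "strict_mono \<tau>" "((\<lambda>k. \<integral>y. cYp y - g (\<sigma> k) y \<partial>s) \<circ> \<tau>) \<longlonglongrightarrow> L"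
    using bounded_imp_convergent_subsequence by blast
  define \<rho> where "\<rho> = \<sigma> \<circ> \<tau>"
  have \<rho>: "strict_mono \<rho>" unfolding \<rho>_def by (rule strict_mono_o[OF \<sigma> \<tau>(1)])
  have l': "(\<lambda>k. g (\<rho> k) y) \<longlonglongrightarrow> l y" for y
    using LIMSEQ_subseq_LIMSEQ[OF l \<tau>(1), of y] by (simp add: \<rho>_def o_def)
  have L: "(\<lambda>k. \<integral>y. cYp y - g (\<rho> k) y \<partial>s) \<longlonglongrightarrow> L" using \<tau>(2) by (simp only: \<rho>_def o_def)
  note A = adm_limit[of "\<lambda>k. g (\<rho> k)" N l L, OF g l' L]
  have li: "integrable s l" using A(1) by (simp add: adm_def)
  have "(\<lambda>k. dual r (g (\<rho> k))) \<longlonglongrightarrow> S"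
    using LIMSEQ_subseq_LIMSEQ[OF S \<rho>] by (simp add: o_def)
  moreover have "(\<lambda>k. (\<integral>y. cYp y \<partial>s) - (\<integral>y. cYp y - g (\<rho> k) y \<partial>s) + (\<integral>x. fpot (g (\<rho> k)) x \<partial>r))
      \<longlonglongrightarrow> (\<integral>y. cYp y \<partial>s) - L + (\<integral>x. fpot l x \<partial>r)"
    by (intro tendsto_intros L A(4)[OF r])
  then have "(\<lambda>k. dual r (g (\<rho> k))) \<longlonglongrightarrow> (\<integral>y. cYp y \<partial>s) - L + (\<integral>x. fpot l x \<partial>r)"
    using gi by (simp add: dual_def)
  ultimately have "S = (\<integral>y. cYp y \<partial>s) - L + (\<integral>x. fpot l x \<partial>r)"
    by (rule LIMSEQ_unique)
  also have "\<dots> \<le> dual r l" using A(2) li by (simp add: dual_def)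
  finally have "dual r l = S" using up[OF A(1)] by simp
  from that[OF \<rho> A(1) this A(3)] show ?thesis .
qed

text \<open>The direct method; the level \<open>N\<close> must be large enough for the class to be
  nonempty.\<close>

lemma dual_attained:
  assumes r: "integrable (measure_pmf r) CX" and N: "Nmin r \<le> N"
  obtains g where "g \<in> adm N" "\<And>g'. g' \<in> adm N \<Longrightarrow> dual r g' \<le> dual r g"
proof -
  obtain g0 where g0: "g0 \<in> adm N" using adm_base[OF r N] by blast
  have "dual r g \<le> (\<integral>y. cYp y \<partial>s) + ((\<integral>x. cXp x \<partial>r) + N)" if g: "g \<in> adm N" for g
  proof -
    have "(\<integral>y. g y \<partial>s) \<le> (\<integral>y. cYp y \<partial>s)"
      by (rule integral_mono) (use g in \<open>auto simp: adm_def\<close>)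
    moreover have "(\<integral>x. fpot g x \<partial>r) \<le> (\<integral>x. cXp x + N \<partial>r)"
      by (rule integral_mono) (use fpot_int[OF adm_regular[OF g] r] adm_fpot_le[OF g] cX_int[OF r] in auto)
    ultimately show ?thesis using cX_int[OF r] by (simp add: dual_def)
  qed
  then have bdd: "bdd_above (dual r ` adm N)" by (auto simp: bdd_above_def)
  define S where "S = Sup (dual r ` adm N)"
  have up: "dual r g \<le> S" if "g \<in> adm N" for g
    unfolding S_def by (rule cSUP_upper[OF that bdd])
  have "\<exists>g\<in>adm N. S - 1 / real (Suc k) < dual r g" for k
    using less_cSUP_iff[of "adm N" "dual r" "S - 1 / real (Suc k)"] g0 bdd unfolding S_def by force
  then obtain g where g: "\<And>k. g k \<in> adm N" "\<And>k. S - 1 / real (Suc k) < dual r (g k)" by metis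
  have "(\<lambda>k. dual r (g k)) \<longlonglongrightarrow> S"
  proof (rule tendsto_sandwich)
    show "(\<lambda>k. S - 1 / real (Suc k)) \<longlonglongrightarrow> S"
      using tendsto_diff[OF tendsto_const LIMSEQ_inverse_real_of_nat, of S] by (simp add: inverse_eq_divide)
    show "\<forall>\<^sub>F k in sequentially. S - 1 / real (Suc k) \<le> dual r (g k)"
      using g(2) by (intro always_eventually allI less_imp_le)
    show "\<forall>\<^sub>F k in sequentially. dual r (g k) \<le> S"
      by (intro always_eventually allI up g(1))
  qed auto
  from maximizing_subseq[OF g(1) this up r] obtain l where "l \<in> adm N" "dual r l = S" by metis
  then show ?thesis using up that by blast
qed

text \<open>The update of a maximizer stays in the class and cannot gain, which is the equality case
  of \<open>improve\<close>.\<close>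

lemma maximizer_schroedinger:
  assumes r: "integrable (measure_pmf r) CX" and N: "Nmin r \<le> N"
    and g: "g \<in> adm N" and max: "\<And>g'. g' \<in> adm N \<Longrightarrow> dual r g' \<le> dual r g"
  shows "schroedinger r g"
proof -
  have "(\<integral>y. cYm y \<partial>s) + (\<integral>x. cXm x \<partial>r) \<le> dual r g"
    using adm_base[OF r N] max by (meson order_trans)
  from improve[OF adm_regular[OF g] r N this] max show ?thesis by blast
qed


end

section \<open>Strong duality\<close>

lemma ext_sum_integrable:
  assumes "integrable (count_space UNIV) f"
  shows "ext_sum f = ereal (\<integral>z. f z \<partial>count_space UNIV)"
proof -
  have f: "(\<integral>\<^sup>+z. ennreal (f z) \<partial>count_space UNIV) \<noteq> \<infinity>" "(\<integral>\<^sup>+z. ennreal (- f z) \<partial>count_space UNIV) \<noteq> \<infinity>"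
    using assms by (auto simp: real_integrable_def)
  then have "enn2ereal (\<integral>\<^sup>+z. ennreal (f z) \<partial>count_space UNIV) = ereal (enn2real (\<integral>\<^sup>+z. ennreal (f z) \<partial>count_space UNIV))"
    "enn2ereal (\<integral>\<^sup>+z. ennreal (- f z) \<partial>count_space UNIV) = ereal (enn2real (\<integral>\<^sup>+z. ennreal (- f z) \<partial>count_space UNIV))"
    by (metis enn2ereal_ennreal enn2real_nonneg ennreal_enn2real infinity_ennreal_def top.not_eq_extremum)+
  then show ?thesis using assms by (simp add: ext_sum_def real_lebesgue_integral_def)
qed

lemma ext_sum_infinite:
  assumes "(\<integral>\<^sup>+z. ennreal (- f z) \<partial>count_space UNIV) < \<infinity>" "\<not> integrable (count_space UNIV) f"
  shows "ext_sum f = \<infinity>"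
proof -
  have "(\<integral>\<^sup>+z. ennreal (f z) \<partial>count_space UNIV) = \<infinity>"
    using assms by (auto simp: real_integrable_def)
  then show ?thesis by (simp add: ext_sum_def)
qed

lemma integrable_pmf_count_space:
  fixes f :: "'a \<Rightarrow> real"
  shows "integrable (measure_pmf p) f \<longleftrightarrow> integrable (count_space UNIV) (\<lambda>x. pmf p x * f x)"
  by (subst measure_pmf_eq_density, subst integrable_density) auto

lemma integral_pmf_count_space:
  fixes f :: "'a \<Rightarrow> real"
  shows "(\<integral>x. f x \<partial>measure_pmf p) = (\<integral>x. pmf p x * f x \<partial>count_space UNIV)"
  by (subst measure_pmf_eq_density, subst integral_density) auto

lemma coupling_of_density:
  fixes b :: "'a \<times> 'b \<Rightarrow> real" and r :: "'a pmf" and s :: "'b pmf"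
  assumes b0: "\<And>z. 0 \<le> b z"
    and fst_marginal: "\<And>x. (\<integral>\<^sup>+y. ennreal (b (x, y)) \<partial>count_space UNIV) = ennreal (pmf r x)"
    and snd_marginal: "\<And>y. (\<integral>\<^sup>+x. ennreal (b (x, y)) \<partial>count_space UNIV) = ennreal (pmf s y)"
  shows "\<exists>G\<in>couplings r s. \<forall>z. pmf G z = b z"
proof -
  have b1: "(\<integral>\<^sup>+z. ennreal (b z) \<partial>count_space UNIV) = 1"
    by (subst nn_integral_fst_count_space[symmetric]) (simp add: fst_marginal nn_integral_pmf)
  define G where "G = embed_pmf b"
  have G: "pmf G z = b z" for z unfolding G_def by (rule pmf_embed_pmf[OF b0 b1])
  have Gfst: "map_pmf fst G = r"
  proof (rule pmf_eqI)
    fix x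
    have "ennreal (pmf (map_pmf fst G) x) = (\<integral>\<^sup>+z. ennreal (pmf G z) \<partial>count_space (fst -` {x}))"
      by (simp add: nn_integral_pmf pmf_map measure_pmf.emeasure_eq_measure)
    also have "\<dots> = (\<integral>\<^sup>+y. ennreal (pmf G (x, y)) \<partial>count_space UNIV)"
      by (rule nn_integral_bij_count_space[symmetric]) (auto simp: bij_betw_def inj_on_def)
    finally show "pmf (map_pmf fst G) x = pmf r x" by (simp add: G fst_marginal)
  qed
  have Gsnd: "map_pmf snd G = s"
  proof (rule pmf_eqI)
    fix y
    have "ennreal (pmf (map_pmf snd G) y) = (\<integral>\<^sup>+z. ennreal (pmf G z) \<partial>count_space (snd -` {y}))"
      by (simp add: nn_integral_pmf pmf_map measure_pmf.emeasure_eq_measure)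
    also have "\<dots> = (\<integral>\<^sup>+x. ennreal (pmf G (x, y)) \<partial>count_space UNIV)"
      by (rule nn_integral_bij_count_space[symmetric]) (auto simp: bij_betw_def inj_on_def)
    finally show "pmf (map_pmf snd G) y = pmf s y" by (simp add: G snd_marginal)
  qed
  have "G \<in> couplings r s" using Gfst Gsnd by (simp add: couplings_def)
  with G show ?thesis by blast
qed

section \<open>Gibbs densities as optimal plans\<close>

context erot_cost begin

definition dens :: "('y \<Rightarrow> real) \<Rightarrow> 'x \<Rightarrow> 'y \<Rightarrow> real" where
  "dens g x y = exp ((fpot g x + g y - c (x, y)) / lam)"

lemma dens_pos: "0 < dens g x y" by (simp add: dens_def)

lemma nn_integral_dens:
  assumes "regular g"
  shows "(\<integral>\<^sup>+y. ennreal (dens g x y) \<partial>s) = 1"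
proof -
  have "(\<integral>\<^sup>+y. ennreal (dens g x y) \<partial>s)
      = (\<integral>\<^sup>+y. ennreal (exp (fpot g x / lam)) * ennreal (exp ((g y - c (x, y)) / lam)) \<partial>s)"
    by (auto intro!: nn_integral_cong simp: dens_def ennreal_mult[symmetric] exp_add[symmetric]
        add_divide_distrib diff_divide_distrib)
  also have "\<dots> = ennreal (exp (fpot g x / lam)) * ennreal (Zp g x)"
    by (subst nn_integral_cmult, simp)
      (simp add: Zp_def nn_integral_eq_integral[OF regular_kernel_int[OF assms]])
  also have "\<dots> = 1" using Zp_pos[OF assms, of x]
    by (simp add: exp_fpot[OF assms] ennreal_mult[symmetric])
  finally show ?thesis .
qed

text \<open>For every coupling the objective equals \<open>dual r g\<close> plus \<open>lam\<close>
  times the relative entropy with respect to the Gibbs coupling \<open>b\<close>, because the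
  potentials integrate to the same value under all couplings. Minimality and uniqueness reduce to
  nonnegativity of relative entropy and its equality case.\<close>

lemma erot_primal:
  assumes g: "regular g" and r: "integrable (measure_pmf r) CX" and S: "schroedinger r g"
  shows "EROT lam c r s = dual r g"
    and "pmf (erot_plan lam c r s) (x, y) = pmf r x * pmf s y * dens g x y"
    and "erot_plan lam c r s \<in> couplings r s"
proof -
  define b where "b = (\<lambda>(x, y). pmf r x * pmf s y * dens g x y)"
  have b0: "0 \<le> b z" for z by (auto simp: b_def dens_pos less_imp_le split: prod.split)
  have bx: "(\<integral>\<^sup>+y. ennreal (b (x, y)) \<partial>count_space UNIV) = ennreal (pmf r x)" for x
  proof -
    have "(\<integral>\<^sup>+y. ennreal (b (x, y)) \<partial>count_space UNIV) = (\<integral>\<^sup>+y. ennreal (pmf r x) * (ennreal (pmf s y) * ennreal (dens g x y)) \<partial>count_space UNIV)"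
      by (auto intro!: nn_integral_cong simp: b_def ennreal_mult[symmetric] less_imp_le[OF dens_pos] mult.assoc)
    also have "\<dots> = ennreal (pmf r x) * (\<integral>\<^sup>+y. ennreal (dens g x y) \<partial>s)"
      by (simp add: nn_integral_cmult nn_integral_measure_pmf)
    finally show ?thesis by (simp add: nn_integral_dens[OF g])
  qed
  have "by": "(\<integral>\<^sup>+x. ennreal (b (x, y)) \<partial>count_space UNIV) = ennreal (pmf s y)" for y
  proof (cases "y \<in> set_pmf s")
    case True
    have "(\<integral>\<^sup>+x. ennreal (b (x, y)) \<partial>count_space UNIV) = (\<integral>\<^sup>+x. ennreal (pmf s y) * (ennreal (pmf r x) * ennreal (dens g x y)) \<partial>count_space UNIV)"
      by (auto intro!: nn_integral_cong simp: b_def ennreal_mult[symmetric] less_imp_le[OF dens_pos] mult_ac)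
    also have "\<dots> = ennreal (pmf s y) * (\<integral>\<^sup>+x. ennreal (dens g x y) \<partial>r)"
      by (simp add: nn_integral_cmult nn_integral_measure_pmf)
    finally show ?thesis using S True by (simp add: schroedinger_def dens_def)
  qed (simp add: b_def set_pmf_iff)
  obtain G where Gc: "G \<in> couplings r s" and G: "\<And>z. pmf G z = b z"
    using coupling_of_density[OF b0 bx "by"] by blast
  let ?h = "\<lambda>z. fpot g (fst z) + g (snd z)"
  have gi: "integrable s g" using g by (simp add: regular_def)
  have fi: "integrable r (fpot g)" by (rule fpot_int[OF g r])
  let ?e = "\<lambda>\<pi> z. pmf \<pi> z * ln (pmf \<pi> z / b z)"
  let ?m = "\<lambda>\<pi> z. pmf \<pi> z * ln (pmf \<pi> z / (pmf r (fst z) * pmf s (snd z)))"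
  have pos: "0 < pmf r (fst z) \<and> 0 < pmf s (snd z) \<and> 0 < b z"
    if "\<pi> \<in> couplings r s" "pmf \<pi> z \<noteq> 0" for \<pi> z
  proof -
    have "z \<in> set_pmf \<pi>" using that(2) by (simp add: set_pmf_iff)
    then have "fst z \<in> set_pmf (map_pmf fst \<pi>)" "snd z \<in> set_pmf (map_pmf snd \<pi>)"
      by (simp_all add: imageI)
    then have "fst z \<in> set_pmf r" "snd z \<in> set_pmf s"
      using that(1) unfolding couplings_def by (simp_all only: mem_Collect_eq)
    then have "0 < pmf r (fst z)" "0 < pmf s (snd z)" by (simp_all add: pmf_positive)
    then show ?thesis using dens_pos by (cases z) (simp add: b_def)
  qed
  have e_alt: "?e \<pi> z = - pmf \<pi> z * ln (b z / pmf \<pi> z)" if "\<pi> \<in> couplings r s" for \<pi> z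
    using pos[OF that, of z] by (cases "pmf \<pi> z = 0") (auto simp: ln_div pmf_pos algebra_simps)
  \<comment> \<open>The inequality \<open>ln u \<le> u - 1\<close> in each summand; the left-hand
    sides sum to zero, since both families are probabilities.\<close>
  have e_ge: "pmf \<pi> z - b z \<le> ?e \<pi> z" if "\<pi> \<in> couplings r s" for \<pi> z
  proof (cases "pmf \<pi> z = 0")
    case False
    then have "ln (b z / pmf \<pi> z) \<le> b z / pmf \<pi> z - 1"
      using pos[OF that False] by (intro ln_le_minus_one) (simp add: pmf_pos)
    from mult_left_mono[OF this pmf_nonneg[of \<pi> z]] False show ?thesis
      by (simp add: e_alt[OF that] right_diff_distrib)
  qed (simp add: b0)
  have e_eq: "pmf \<pi> z = b z" if "\<pi> \<in> couplings r s" "pmf \<pi> z - b z = ?e \<pi> z" for \<pi> z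
  proof (cases "pmf \<pi> z = 0")
    case False
    have "pmf \<pi> z * ln (b z / pmf \<pi> z) = pmf \<pi> z * (b z / pmf \<pi> z - 1)"
      using that(2) False unfolding e_alt[OF that(1)] by (simp add: right_diff_distrib)
    then have "ln (b z / pmf \<pi> z) = b z / pmf \<pi> z - 1" using False by simp
    then have "b z / pmf \<pi> z = 1"
      using pos[OF that(1) False] False by (intro ln_eq_minus_one) (simp_all add: pmf_pos)
    then show ?thesis using False by simp
  qed (use that in simp)
  \<comment> \<open>Splitting the logarithm of the density: the entropy relative to the product is
    the one relative to \<open>b\<close> plus a term that trades the cost for the
    potentials.\<close>
  have m_eq: "?m \<pi> z = ?e \<pi> z + pmf \<pi> z * ((?h z - c z) / lam)" if "\<pi> \<in> couplings r s" for \<pi> z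
  proof (cases "pmf \<pi> z = 0")
    case False
    note p = pos[OF that False] pmf_pos[OF False]
    have "ln (b z) = ln (pmf r (fst z) * pmf s (snd z)) + (?h z - c z) / lam"
      using p by (cases z) (simp add: b_def ln_mult dens_def)
    then show ?thesis using p by (simp add: ln_div ln_mult algebra_simps)
  qed simp
  have hi: "integrable \<pi> ?h" and hI: "(\<integral>z. ?h z \<partial>\<pi>) = dual r g" and ci: "integrable \<pi> c"
    if \<pi>: "\<pi> \<in> couplings r s" for \<pi>
  proof -
    have m: "map_pmf fst \<pi> = r" "map_pmf snd \<pi> = s" using \<pi> by (auto simp: couplings_def)
    have i: "integrable \<pi> (\<lambda>z. fpot g (fst z))" "integrable \<pi> (\<lambda>z. g (snd z))"
      "integrable \<pi> (\<lambda>z. CX (fst z))" "integrable \<pi> (\<lambda>z. CY (snd z))"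
      using fi gi r CY_int unfolding m[symmetric] by simp_all
    show "integrable \<pi> ?h" using i by simp
    have "(\<integral>z. ?h z \<partial>\<pi>) = (\<integral>x. fpot g x \<partial>map_pmf fst \<pi>) + (\<integral>y. g y \<partial>map_pmf snd \<pi>)"
      using i by simp
    then show "(\<integral>z. ?h z \<partial>\<pi>) = dual r g" by (simp add: m dual_def)
    show "integrable \<pi> c"
    proof (rule Bochner_Integration.integrable_bound)
      show "integrable \<pi> (\<lambda>z. CX (fst z) + CY (snd z))" using i by simp
      show "AE z in \<pi>. norm (c z) \<le> norm (CX (fst z) + CY (snd z))"
        using abs_c_le CX_ge(1) CY_ge(1) by (auto intro!: AE_I2 intro: order_trans[OF _ abs_ge_self])
    qed simp
  qed
  let ?C = "count_space (UNIV :: ('x \<times> 'y) set)"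
  have obj: "erot_objective lam c r s \<pi> =
      (if integrable ?C (?e \<pi>) then ereal (dual r g + lam * (\<integral>z. ?e \<pi> z \<partial>?C)) else \<infinity>)"
    if \<pi>: "\<pi> \<in> couplings r s" for \<pi>
  proof -
    let ?w = "\<lambda>z. pmf \<pi> z * ((?h z - c z) / lam)"
    have wi: "integrable ?C ?w"
      using hi[OF \<pi>] ci[OF \<pi>] by (simp add: integrable_pmf_count_space[symmetric])
    have wI: "lam * (\<integral>z. ?w z \<partial>?C) = dual r g - (\<integral>z. c z \<partial>\<pi>)"
      using hi[OF \<pi>] ci[OF \<pi>] hI[OF \<pi>] lam by (simp add: integral_pmf_count_space[symmetric])
    have ci': "integrable ?C (\<lambda>z. c z * pmf \<pi> z)"
      using ci[OF \<pi>] by (simp add: integrable_pmf_count_space mult.commute)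
    have t: "transport_cost c \<pi> = ereal (\<integral>z. c z \<partial>\<pi>)"
      unfolding transport_cost_def ext_sum_integrable[OF ci']
      by (simp add: integral_pmf_count_space mult.commute)
    have m: "mutual_info r s \<pi> = ext_sum (\<lambda>z. ?e \<pi> z + ?w z)"
      unfolding mutual_info_def m_eq[OF \<pi>, symmetric]
      by (rule arg_cong[of _ _ ext_sum]) (auto simp: fun_eq_iff)
    show ?thesis
    proof (cases "integrable ?C (?e \<pi>)")
      case True
      then have "integrable ?C (\<lambda>z. ?e \<pi> z + ?w z)" using wi by (rule Bochner_Integration.integrable_add)
      then have "mutual_info r s \<pi> = ereal ((\<integral>z. ?e \<pi> z \<partial>?C) + (\<integral>z. ?w z \<partial>?C))"
        unfolding m Bochner_Integration.integral_add[OF True wi, symmetric] by (rule ext_sum_integrable)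
      then show ?thesis using True wI by (simp add: erot_objective_def t distrib_left)
    next
      case False
      have ni: "\<not> integrable ?C (\<lambda>z. ?e \<pi> z + ?w z)"
      proof
        assume "integrable ?C (\<lambda>z. ?e \<pi> z + ?w z)"
        from Bochner_Integration.integrable_diff[OF this wi] False show False by simp
      qed
      \<comment> \<open>The negative part is dominated by \<open>b\<close> plus the integrable
        correction, so failure of integrability means the value plus infinity and never an undefined
        difference.\<close>
      have bi: "integrable ?C (\<lambda>z. b z + \<bar>?w z\<bar>)"
        unfolding G[symmetric] by (rule Bochner_Integration.integrable_add[OF integrable_pmf integrable_abs[OF wi]])
      have "(\<integral>\<^sup>+z. ennreal (- (?e \<pi> z + ?w z)) \<partial>?C) \<le> (\<integral>\<^sup>+z. ennreal (b z + \<bar>?w z\<bar>) \<partial>?C)"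
      proof (intro nn_integral_mono ennreal_leI)
        fix z show "- (?e \<pi> z + ?w z) \<le> b z + \<bar>?w z\<bar>"
          using e_ge[OF \<pi>, of z] pmf_nonneg[of \<pi> z] by linarith
      qed
      also have "\<dots> < \<infinity>"
        by (subst nn_integral_eq_integral[OF bi]) (auto simp: b0)
      finally have "mutual_info r s \<pi> = \<infinity>" unfolding m by (rule ext_sum_infinite[OF _ ni])
      then show ?thesis using False lam by (simp add: erot_objective_def t)
    qed
  qed
  have qb: "integrable ?C (\<lambda>z. pmf \<pi> z - b z)" "(\<integral>z. pmf \<pi> z - b z \<partial>?C) = 0" for \<pi>
    using integrable_pmf[of UNIV G] integrable_pmf[of UNIV \<pi>] integral_pmf[of UNIV G] integral_pmf[of UNIV \<pi>]
    by (simp_all add: G[symmetric])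
  have objG: "erot_objective lam c r s G = ereal (dual r g)"
  proof -
    have "?e G = (\<lambda>_. 0)" by (rule ext) (simp add: G)
    then show ?thesis unfolding obj[OF Gc] by simp
  qed
  have ge: "ereal (dual r g) \<le> erot_objective lam c r s \<pi>" if \<pi>: "\<pi> \<in> couplings r s" for \<pi>
  proof (cases "integrable ?C (?e \<pi>)")
    case True
    have "0 \<le> (\<integral>z. ?e \<pi> z \<partial>?C)"
      unfolding qb(2)[of \<pi>, symmetric] by (rule integral_mono[OF qb(1) True e_ge[OF \<pi>]])
    then show ?thesis using True lam by (simp add: obj[OF \<pi>])
  qed (simp add: obj[OF \<pi>])
  have uniq: "\<pi> = G" if \<pi>: "\<pi> \<in> couplings r s" and le: "erot_objective lam c r s \<pi> \<le> ereal (dual r g)" for \<pi>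
  proof -
    have i: "integrable ?C (?e \<pi>)" using le by (auto simp: obj[OF \<pi>] split: if_splits)
    then have "(\<integral>z. ?e \<pi> z \<partial>?C) \<le> 0"
      using le lam by (auto simp: obj[OF \<pi>] mult_le_0_iff)
    then have I: "(\<integral>z. ?e \<pi> z - (pmf \<pi> z - b z) \<partial>?C) \<le> 0"
      using qb[of \<pi>] i by (subst Bochner_Integration.integral_diff) auto
    have i': "integrable ?C (\<lambda>z. ?e \<pi> z - (pmf \<pi> z - b z))"
      by (rule Bochner_Integration.integrable_diff[OF i qb(1)])
    have nn: "0 \<le> ?e \<pi> z - (pmf \<pi> z - b z)" for z using e_ge[OF \<pi>, of z] by linarith
    then have "0 \<le> (\<integral>z. ?e \<pi> z - (pmf \<pi> z - b z) \<partial>?C)" by (intro integral_nonneg_AE AE_I2)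
    with I have "(\<integral>z. ?e \<pi> z - (pmf \<pi> z - b z) \<partial>?C) = 0" by linarith
    then have "AE z in ?C. ?e \<pi> z - (pmf \<pi> z - b z) = 0"
      using integral_nonneg_eq_0_iff_AE[OF i' AE_I2[OF nn]] by blast
    then have "?e \<pi> z - (pmf \<pi> z - b z) = 0" for z by (cases z) (simp add: AE_count_space)
    then have "pmf \<pi> z - b z = ?e \<pi> z" for z by (metis eq_iff_diff_eq_0)
    then have "pmf \<pi> z = b z" for z by (rule e_eq[OF \<pi>])
    then show ?thesis by (intro pmf_eqI) (simp add: G)
  qed
  have "(INF \<pi>\<in>couplings r s. erot_objective lam c r s \<pi>) = ereal (dual r g)"
    by (rule antisym, metis INF_lower[OF Gc] objG, rule INF_greatest, rule ge)
  then show "EROT lam c r s = dual r g" by (simp add: EROT_def)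
  have plan: "erot_plan lam c r s = G" unfolding erot_plan_def
  proof (rule the_equality)
    show "is_arg_min (erot_objective lam c r s) (\<lambda>\<pi>. \<pi> \<in> couplings r s) G"
      using Gc ge by (auto simp: is_arg_min_def objG not_less)
    fix \<pi> assume "is_arg_min (erot_objective lam c r s) (\<lambda>\<pi>. \<pi> \<in> couplings r s) \<pi>"
    then show "\<pi> = G" using Gc objG by (intro uniq) (auto simp: is_arg_min_def not_less)
  qed
  show "pmf (erot_plan lam c r s) (x, y) = pmf r x * pmf s y * dens g x y" by (simp add: plan G b_def)
  show "erot_plan lam c r s \<in> couplings r s" by (simp add: plan Gc)
qed

lemma erot_dual:
  assumes r: "integrable (measure_pmf r) CX" and N: "Nmin r \<le> N"
    and g: "g \<in> adm N" and max: "\<And>g'. g' \<in> adm N \<Longrightarrow> dual r g' \<le> dual r g"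
  shows "EROT lam c r s = dual r g"
    and "pmf (erot_plan lam c r s) (x, y) = pmf r x * pmf s y * dens g x y"
    and "erot_plan lam c r s \<in> couplings r s"
  using erot_primal[OF adm_regular[OF g] r maximizer_schroedinger[OF r N g max]] by auto

end

section \<open>First-order expansion of the transport cost\<close>

text \<open>The extended value spares summability conditions; finiteness is recovered wherever an
  explicit bound is available.\<close>

definition wnorm :: "('z \<Rightarrow> real) \<Rightarrow> ('z \<Rightarrow> real) \<Rightarrow> ennreal" where
  "wnorm W a = (\<integral>\<^sup>+z. ennreal (W z * \<bar>a z\<bar>) \<partial>count_space UNIV)"

abbreviation wdist :: "('z \<Rightarrow> real) \<Rightarrow> 'z pmf \<Rightarrow> 'z pmf \<Rightarrow> ennreal" where
  "wdist W p q \<equiv> wnorm W (\<lambda>z. pmf p z - pmf q z)"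

text \<open>\<open>D p2 p3 p4\<close> stands for the norm of \<open>\<Psi> p4 - \<Psi> p3 - (\<Psi> p2 - \<Psi> r)\<close>. The nonlinear error is measured with
  a weight \<open>W\<close> whose pairing with the standard deviations \<open>sqrt (pmf r x)\<close> is arbitrarily small.\<close>

definition four_point_approx ::
  "('x \<Rightarrow> real) \<Rightarrow> 'x pmf \<Rightarrow> ('x pmf \<Rightarrow> 'x pmf \<Rightarrow> 'x pmf \<Rightarrow> real) \<Rightarrow> bool" where
  "four_point_approx C r D \<longleftrightarrow>
    (\<exists>K\<ge>0. \<forall>\<epsilon>>0. \<exists>\<delta>>0. \<exists>W.
      (\<forall>x. 0 \<le> W x \<and> W x \<le> K * C x) \<and>
      (\<integral>\<^sup>+x. ennreal (W x * sqrt (pmf r x)) \<partial>count_space UNIV) \<le> ennreal \<epsilon> \<and>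
      (\<forall>p2 p3 p4. wdist C p2 r \<le> ennreal \<delta> \<longrightarrow> wdist C p3 r \<le> ennreal \<delta> \<longrightarrow> wdist C p4 r \<le> ennreal \<delta> \<longrightarrow>
        ennreal (D p2 p3 p4) \<le> ennreal K * wnorm C (\<lambda>x. pmf p4 x - pmf p3 x - (pmf p2 x - pmf r x))
          + (wdist W p2 r + wdist W p3 r + wdist W p4 r)))"

section \<open>Weighted distances between marginals\<close>

lemma wnorm_mono: "(\<And>z. W z * \<bar>a z\<bar> \<le> V z * \<bar>b z\<bar>) \<Longrightarrow> wnorm W a \<le> wnorm V b"
  unfolding wnorm_def by (intro nn_integral_mono ennreal_leI)

lemma wnorm_cmult: "0 \<le> K \<Longrightarrow> wnorm (\<lambda>z. K * W z) a = ennreal K * wnorm W a"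
  unfolding wnorm_def by (subst nn_integral_cmult[symmetric]) (auto simp: ennreal_mult'[symmetric] mult.assoc)

lemma wnorm_integral_le:
  assumes "\<And>z. \<bar>F z\<bar> \<le> W z"
  shows "ennreal \<bar>\<integral>z. a z * F z \<partial>count_space UNIV\<bar> \<le> wnorm W a"
proof (cases "integrable (count_space UNIV) (\<lambda>z. a z * F z)")
  case True
  then have "ennreal \<bar>\<integral>z. a z * F z \<partial>count_space UNIV\<bar> \<le> (\<integral>\<^sup>+z. ennreal \<bar>a z * F z\<bar> \<partial>count_space UNIV)"
    using integral_norm_bound_ennreal[OF True] by simp
  also have "\<dots> \<le> wnorm W a" unfolding wnorm_def
    by (intro nn_integral_mono ennreal_leI)
      (use assms in \<open>auto simp: abs_mult mult.commute intro!: mult_right_mono\<close>)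
  finally show ?thesis .
qed (simp add: not_integrable_integral_eq)

lemma expectation_diff:
  fixes F :: "'a \<Rightarrow> real"
  assumes "integrable (measure_pmf p) F" "integrable (measure_pmf q) F"
  shows "(\<integral>x. F x \<partial>p) - (\<integral>x. F x \<partial>q) = (\<integral>x. (pmf p x - pmf q x) * F x \<partial>count_space UNIV)"
  using assms by (simp add: integral_pmf_count_space integrable_pmf_count_space left_diff_distrib)

lemma expectation_diff_le:
  fixes F :: "'a \<Rightarrow> real"
  assumes "integrable (measure_pmf p) F" "integrable (measure_pmf q) F" "\<And>x. \<bar>F x\<bar> \<le> W x"
  shows "ennreal \<bar>(\<integral>x. F x \<partial>p) - (\<integral>x. F x \<partial>q)\<bar> \<le> wdist W p q"
  unfolding expectation_diff[OF assms(1,2)] by (rule wnorm_integral_le[OF assms(3)])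

lemma wdist_integrable:
  assumes q: "integrable (measure_pmf q) W" and W: "\<And>x. 0 \<le> W x" and d: "wdist W p q \<le> ennreal d"
  shows "integrable (measure_pmf p) W" and "0 \<le> d \<Longrightarrow> (\<integral>x. W x \<partial>p) \<le> (\<integral>x. W x \<partial>q) + d"
proof -
  let ?C = "count_space UNIV"
  have "wdist W p q < \<infinity>" using d by (simp add: le_less_trans)
  then have a: "integrable ?C (\<lambda>x. (pmf p x - pmf q x) * W x)"
    unfolding wnorm_def using W by (intro integrableI_bounded) (auto simp: abs_mult mult.commute)
  moreover have "integrable ?C (\<lambda>x. pmf q x * W x)" using q by (simp add: integrable_pmf_count_space)
  ultimately have "integrable ?C (\<lambda>x. (pmf p x - pmf q x) * W x + pmf q x * W x)"
    by (rule Bochner_Integration.integrable_add)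
  then show p: "integrable (measure_pmf p) W" by (simp add: integrable_pmf_count_space left_diff_distrib)
  assume "0 \<le> d"
  have "ennreal \<bar>(\<integral>x. W x \<partial>p) - (\<integral>x. W x \<partial>q)\<bar> \<le> ennreal d"
    using expectation_diff_le[OF p q, of W] W d by (auto intro: order_trans)
  then show "(\<integral>x. W x \<partial>p) \<le> (\<integral>x. W x \<partial>q) + d" using \<open>0 \<le> d\<close> by simp
qed

lemma nn_integral_tail:
  fixes h :: "'a::countable \<Rightarrow> ennreal"
  assumes "(\<integral>\<^sup>+x. h x \<partial>count_space UNIV) < \<infinity>" "0 < \<epsilon>"
  obtains F where "finite F" "(\<integral>\<^sup>+x. (if x \<in> F then 0 else h x) \<partial>count_space UNIV) \<le> ennreal \<epsilon>"
proof -
  let ?F = "\<lambda>k. {x::'a. to_nat x < k}"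
  have fin: "finite (?F k)" for k
    by (rule finite_imageD[where f=to_nat]) (auto intro: finite_subset[of _ "{..<k}"] inj_on_subset[OF inj_to_nat])
  have "(\<lambda>k. \<integral>\<^sup>+x. (if x \<in> ?F k then 0 else h x) \<partial>count_space UNIV) \<longlonglongrightarrow> nn_integral (count_space UNIV) (\<lambda>_::'a. 0)"
  proof (rule nn_integral_dominated_convergence[where w=h])
    show "AE x in count_space UNIV. (\<lambda>k. if x \<in> ?F k then 0 else h x) \<longlonglongrightarrow> 0"
    proof (rule AE_I2)
      fix x show "(\<lambda>k. if x \<in> ?F k then 0 else h x) \<longlonglongrightarrow> 0"
        by (rule tendsto_eventually) (auto simp: eventually_sequentially intro!: exI[of _ "Suc (to_nat x)"])
    qed
  qed (use assms in auto)
  then have "(\<lambda>k. \<integral>\<^sup>+x. (if x \<in> ?F k then 0 else h x) \<partial>count_space UNIV) \<longlonglongrightarrow> 0" by simp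
  then have "\<forall>\<^sub>F k in sequentially. (\<integral>\<^sup>+x. (if x \<in> ?F k then 0 else h x) \<partial>count_space UNIV) < ennreal \<epsilon>"
    by (rule order_tendstoD) (use assms in simp)
  then obtain k where "(\<integral>\<^sup>+x. (if x \<in> ?F k then 0 else h x) \<partial>count_space UNIV) < ennreal \<epsilon>"
    by (auto simp: eventually_sequentially)
  with that[OF fin[of k]] show ?thesis by (simp add: less_imp_le)
qed

section \<open>Stability of the potentials and expansion of the cost\<close>

context erot_cost begin

text \<open>Both maximizers describe the same optimal plan, so their densities agree. Comparing them
  along one point \<open>x0\<close> of the support of \<open>r\<close> shows that the second
  potentials differ by a constant on the support of \<open>s\<close>; the soft transform propagates
  this to every \<open>x\<close>, with or without mass.\<close>

lemma maximizer_unique: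
  assumes r: "integrable (measure_pmf r) CX" and N: "Nmin r \<le> N"
    and g: "g \<in> adm N" "\<And>g'. g' \<in> adm N \<Longrightarrow> dual r g' \<le> dual r g"
    and h: "h \<in> adm N" "\<And>g'. g' \<in> adm N \<Longrightarrow> dual r g' \<le> dual r h"
  obtains a where "\<And>x. fpot h x = fpot g x + a"
proof -
  obtain x0 where x0: "x0 \<in> set_pmf r" using set_pmf_not_empty[of r] by blast
  define b where "b = fpot g x0 - fpot h x0"
  have hg: "h y = g y + b" if y: "y \<in> set_pmf s" for y
  proof -
    have "pmf r x0 * pmf s y * dens g x0 y = pmf r x0 * pmf s y * dens h x0 y"
      by (rule trans[OF sym[OF erot_dual(2)[OF r N g]] erot_dual(2)[OF r N h]])
    then have "dens g x0 y = dens h x0 y" using x0 y by (simp add: set_pmf_iff)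
    then show ?thesis using lam by (simp add: dens_def b_def)
  qed
  have "fpot h x = fpot g x + (- b)" for x
  proof -
    have "Zp h x = Zp (\<lambda>y. g y + b) x" unfolding Zp_def
      by (rule integral_cong_AE) (auto intro!: AE_pmfI simp: hg)
    then have "fpot h x = fpot (\<lambda>y. g y + b) x" by (simp add: fpot_def)
    then show ?thesis by (simp add: fpot_shift[OF adm_regular[OF g(1)]])
  qed
  then show ?thesis by (rule that)
qed

text \<open>Compactness and contradiction: almost maximizers violating the bound would converge to a
  maximizer, whose first potential differs from that of \<open>g\<close> by a constant. The
  convergence is pointwise, hence the finite set \<open>F\<close>.\<close>

lemma fpot_stable:
  assumes r: "integrable (measure_pmf r) CX" and N: "Nmin r \<le> N"
    and g: "g \<in> adm N" and max: "\<And>g'. g' \<in> adm N \<Longrightarrow> dual r g' \<le> dual r g"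
    and F: "finite F" and e: "0 < \<epsilon>"
  obtains \<eta> where "0 < \<eta>"
    "\<And>h. h \<in> adm N \<Longrightarrow> dual r g - \<eta> \<le> dual r h \<Longrightarrow> \<exists>a. \<forall>x\<in>F. \<bar>fpot h x - fpot g x - a\<bar> \<le> \<epsilon>"
proof -
  have "\<exists>\<eta>>0. \<forall>h\<in>adm N. dual r g - \<eta> \<le> dual r h \<longrightarrow> (\<exists>a. \<forall>x\<in>F. \<bar>fpot h x - fpot g x - a\<bar> \<le> \<epsilon>)"
  proof (rule ccontr)
    assume "\<not> ?thesis"
    then have "\<exists>h\<in>adm N. dual r g - \<eta> \<le> dual r h \<and> (\<forall>a. \<exists>x\<in>F. \<epsilon> < \<bar>fpot h x - fpot g x - a\<bar>)" if "0 < \<eta>" for \<eta>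
      using that by (meson not_le)
    then have "\<exists>h\<in>adm N. dual r g - 1 / real (Suc k) \<le> dual r h \<and> (\<forall>a. \<exists>x\<in>F. \<epsilon> < \<bar>fpot h x - fpot g x - a\<bar>)" for k
      by simp
    then obtain h where h: "\<And>k. h k \<in> adm N" "\<And>k. dual r g - 1 / real (Suc k) \<le> dual r (h k)"
      "\<And>k a. \<exists>x\<in>F. \<epsilon> < \<bar>fpot (h k) x - fpot g x - a\<bar>" by metis
    have "(\<lambda>k. dual r (h k)) \<longlonglongrightarrow> dual r g"
    proof (rule tendsto_sandwich)
      show "(\<lambda>k. dual r g - 1 / real (Suc k)) \<longlonglongrightarrow> dual r g"
        using tendsto_diff[OF tendsto_const LIMSEQ_inverse_real_of_nat, of "dual r g"] by (simp add: inverse_eq_divide)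
      show "\<forall>\<^sub>F k in sequentially. dual r g - 1 / real (Suc k) \<le> dual r (h k)"
        by (intro always_eventually allI h(2))
      show "\<forall>\<^sub>F k in sequentially. dual r (h k) \<le> dual r g"
        by (intro always_eventually allI max h(1))
    qed auto
    note conv = this
    have "\<exists>\<sigma> l. strict_mono \<sigma> \<and> l \<in> adm N \<and> dual r l = dual r g \<and> (\<forall>x. (\<lambda>k. fpot (h (\<sigma> k)) x) \<longlonglongrightarrow> fpot l x)"
      by (rule maximizing_subseq[of h N r, OF h(1) conv max r]) blast+
    then obtain \<sigma> l where l: "strict_mono \<sigma>" "l \<in> adm N" "dual r l = dual r g"
      "\<And>x. (\<lambda>k. fpot (h (\<sigma> k)) x) \<longlonglongrightarrow> fpot l x" by blast
    obtain a where a: "\<And>x. fpot l x = fpot g x + a"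
      by (rule maximizer_unique[OF r N g max l(2)]) (use l(3) max in auto)
    have "\<forall>\<^sub>F k in sequentially. \<bar>fpot (h (\<sigma> k)) x - fpot g x - a\<bar> < \<epsilon>" for x
    proof -
      have "(\<lambda>k. \<bar>fpot (h (\<sigma> k)) x - fpot g x - a\<bar>) \<longlonglongrightarrow> \<bar>fpot l x - fpot g x - a\<bar>"
        by (intro tendsto_intros l)
      then show ?thesis using e by (intro order_tendstoD(2)) (auto simp: a)
    qed
    then have "\<forall>\<^sub>F k in sequentially. \<forall>x\<in>F. \<bar>fpot (h (\<sigma> k)) x - fpot g x - a\<bar> < \<epsilon>"
      using F by (simp add: eventually_ball_finite)
    then obtain k where "\<forall>x\<in>F. \<bar>fpot (h (\<sigma> k)) x - fpot g x - a\<bar> < \<epsilon>"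
      by (auto simp: eventually_sequentially)
    with h(3)[of "\<sigma> k" a] show False by (meson less_imp_le not_le)
  qed
  then show ?thesis using that by blast
qed

lemma Nmin_le:
  assumes "integrable (measure_pmf p) CX"
  shows "Nmin p \<le> (\<integral>y. cYp y - cYm y \<partial>s) + 2 * (\<integral>x. CX x \<partial>p)"
proof -
  have "(\<integral>x. cXp x - cXm x \<partial>p) \<le> (\<integral>x. 2 * CX x \<partial>p)"
    by (rule integral_mono) (use assms cX_int[OF assms] in \<open>auto simp: C_weight_def\<close>)
  then show ?thesis by (simp add: Nmin_def)
qed

text \<open>One deficit level for all marginals within distance 1 of \<open>r\<close>, so that their
  maximizers compete in the same class.\<close>

definition Nnear :: "'x pmf \<Rightarrow> real" where
  "Nnear r = (\<integral>y. cYp y - cYm y \<partial>s) + 2 * ((\<integral>x. CX x \<partial>r) + 1)"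

lemma near_adm:
  assumes r: "integrable (measure_pmf r) CX" and d: "wdist CX p r \<le> ennreal 1"
  shows "integrable (measure_pmf p) CX" and "Nmin p \<le> Nnear r"
proof -
  have CX0: "0 \<le> CX x" for x using CX_ge(1)[of x] by linarith
  note W = wdist_integrable[OF r CX0 d]
  show "integrable (measure_pmf p) CX" by (rule W)
  from Nmin_le[OF this] W(2) show "Nmin p \<le> Nnear r" by (simp add: Nnear_def)
qed

text \<open>An envelope argument: \<open>dual\<close> is affine in the marginal, so inserting each
  maximizer into the other problem traps the remainder between 0 and the change of
  \<open>\<integral> (fpot h - fpot g)\<close> from \<open>r\<close> to \<open>p\<close>. An
  additive constant cancels there, since both marginals have mass one.\<close>

lemma erot_expansion:
  assumes r: "integrable (measure_pmf r) CX"
  shows "\<exists>K f. 0 \<le> K \<and> (\<forall>x. \<bar>f x\<bar> \<le> K * CX x) \<and>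
    (\<forall>\<epsilon> F. 0 < \<epsilon> \<longrightarrow> \<epsilon> \<le> 1 \<longrightarrow> finite F \<longrightarrow> (\<exists>\<delta>>0. \<forall>p. wdist CX p r \<le> ennreal \<delta> \<longrightarrow>
       integrable (measure_pmf p) CX \<and>
       ennreal \<bar>EROT lam c p s - EROT lam c r s - ((\<integral>x. f x \<partial>p) - (\<integral>x. f x \<partial>r))\<bar>
         \<le> wdist (\<lambda>x. if x \<in> F then \<epsilon> * CX x else K * CX x) p r))"
proof -
  define N where "N = Nnear r"
  have CX0: "0 \<le> CX x" for x using CX_ge(1)[of x] by linarith
  note near = near_adm[OF r, folded N_def]
  have rN: "Nmin r \<le> N" by (rule near) (simp add: wnorm_def)
  obtain g where g: "g \<in> adm N" and max: "\<And>g'. g' \<in> adm N \<Longrightarrow> dual r g' \<le> dual r g"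
    by (rule dual_attained[OF r rN]) blast
  define K0 where "K0 = 1 + \<bar>lam * ln Phi\<bar> + \<bar>N\<bar>"
  have K0: "0 < K0" by (simp add: K0_def add_pos_nonneg)
  have fb: "\<bar>fpot h x\<bar> \<le> K0 * CX x" if "h \<in> adm N" for h x
  proof -
    have "\<bar>fpot h x\<bar> \<le> CX x + (\<bar>lam * ln Phi\<bar> + \<bar>N\<bar>)"
      using adm_fpot_le[OF that, of x] adm_fpot_ge[OF that, of x] CX_ge[of x] by linarith
    also have "\<bar>lam * ln Phi\<bar> + \<bar>N\<bar> \<le> (\<bar>lam * ln Phi\<bar> + \<bar>N\<bar>) * CX x"
      using mult_left_mono[OF CX_ge(1)[of x], of "\<bar>lam * ln Phi\<bar> + \<bar>N\<bar>"] by simp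
    finally show ?thesis by (simp add: K0_def algebra_simps)
  qed
  \<comment> \<open>A reference point added to \<open>F\<close>: closeness there bounds the constant
    \<open>a\<close> independently of \<open>F\<close>, so that \<open>K\<close> can be fixed in
    advance.\<close>
  obtain x1 :: 'x where True by simp
  define K where "K = 2 * K0 + (2 * K0 * CX x1 + 1)"
  have K: "0 \<le> K" "K0 \<le> K" using K0 CX0[of x1] by (simp_all add: K_def)
  show ?thesis
  proof (rule exI[of _ K], rule exI[of _ "fpot g"], intro conjI allI impI K(1))
    show "\<bar>fpot g x\<bar> \<le> K * CX x" for x
      using fb[OF g, of x] mult_right_mono[OF K(2) CX0[of x]] by linarith
    fix \<epsilon> :: real and F :: "'x set"
    assume e: "0 < \<epsilon>" "\<epsilon> \<le> 1" and F: "finite F"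
    obtain \<eta> where \<eta>: "0 < \<eta>" "\<And>h. h \<in> adm N \<Longrightarrow> dual r g - \<eta> \<le> dual r h \<Longrightarrow>
        \<exists>a. \<forall>x\<in>insert x1 F. \<bar>fpot h x - fpot g x - a\<bar> \<le> \<epsilon>"
      using fpot_stable[OF r rN g max, of "insert x1 F" \<epsilon>] F e by auto
    \<comment> \<open>The changes of marginal for \<open>g\<close> and for \<open>h\<close> cost at
      most \<open>K0 * \<delta> \<le> \<eta> / 2\<close> each, so \<open>h\<close> maximizes
      \<open>dual r\<close> up to \<open>\<eta>\<close>.\<close>
    define \<delta> where "\<delta> = min 1 (\<eta> / (2 * K0))"
    show "\<exists>\<delta>>0. \<forall>p. wdist CX p r \<le> ennreal \<delta> \<longrightarrow> integrable (measure_pmf p) CX \<and>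
       ennreal \<bar>EROT lam c p s - EROT lam c r s - ((\<integral>x. fpot g x \<partial>p) - (\<integral>x. fpot g x \<partial>r))\<bar>
         \<le> wdist (\<lambda>x. if x \<in> F then \<epsilon> * CX x else K * CX x) p r"
    proof (intro exI[of _ \<delta>] conjI allI impI)
      show "0 < \<delta>" using \<eta> K0 by (simp add: \<delta>_def)
      fix p assume d: "wdist CX p r \<le> ennreal \<delta>"
      have d1: "wdist CX p r \<le> ennreal 1"
        by (rule order_trans[OF d]) (simp add: \<delta>_def)
      note pi = near(1)[OF d1] note pN = near(2)[OF d1]
      show "integrable (measure_pmf p) CX" by (rule pi)
      obtain h where h: "h \<in> adm N" and hmax: "\<And>g'. g' \<in> adm N \<Longrightarrow> dual p g' \<le> dual p h"
        by (rule dual_attained[OF pi pN]) blast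
      have i: "integrable (measure_pmf q) (fpot u)" if "u \<in> adm N" "integrable (measure_pmf q) CX" for u q
        by (rule fpot_int[OF adm_regular[OF that(1)] that(2)])
      define D where "D u = (\<integral>x. fpot u x \<partial>p) - (\<integral>x. fpot u x \<partial>r)" for u
      have dual_D: "dual p u = dual r u + D u" for u by (simp add: dual_def D_def)
      have Db: "\<bar>D u\<bar> \<le> K0 * \<delta>" if u: "u \<in> adm N" for u
      proof -
        have "ennreal \<bar>D u\<bar> \<le> wdist (\<lambda>x. K0 * CX x) p r"
          unfolding D_def by (rule expectation_diff_le[OF i[OF u pi] i[OF u r] fb[OF u]])
        also have "\<dots> = ennreal K0 * wdist CX p r" by (rule wnorm_cmult) (use K0 in simp)
        also have "\<dots> \<le> ennreal K0 * ennreal \<delta>" by (rule mult_left_mono[OF d]) simp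
        finally show ?thesis using K0 \<open>0 < \<delta>\<close> by (simp add: ennreal_mult[symmetric])
      qed
      have "K0 * \<delta> \<le> \<eta> / 2" using K0 \<eta>(1) by (simp add: \<delta>_def min_def field_simps)
      then have "dual r g - \<eta> \<le> dual r h"
        using hmax[OF g] Db[OF g] Db[OF h] unfolding dual_D by linarith
      from \<eta>(2)[OF h this] obtain a where a: "\<And>x. x \<in> insert x1 F \<Longrightarrow> \<bar>fpot h x - fpot g x - a\<bar> \<le> \<epsilon>"
        by blast
      let ?u = "\<lambda>x. fpot h x - fpot g x - a"
      have ub: "\<bar>?u x\<bar> \<le> (if x \<in> F then \<epsilon> * CX x else K * CX x)" for x
      proof (cases "x \<in> F")
        case True
        have "\<bar>?u x\<bar> \<le> \<epsilon> * 1" using True a[of x] by simp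
        also have "\<dots> \<le> \<epsilon> * CX x" by (rule mult_left_mono[OF CX_ge(1)]) (use e in simp)
        finally show ?thesis using True by simp
      next
        case False
        have "\<bar>a\<bar> \<le> 2 * K0 * CX x1 + 1"
          using a[of x1] fb[OF h, of x1] fb[OF g, of x1] e by auto
        also have "\<dots> \<le> (2 * K0 * CX x1 + 1) * CX x"
          using mult_left_mono[OF CX_ge(1)[of x], of "2 * K0 * CX x1 + 1"] K0 CX0[of x1] by simp
        finally have "\<bar>?u x\<bar> \<le> K0 * CX x + K0 * CX x + (2 * K0 * CX x1 + 1) * CX x"
          using fb[OF h, of x] fb[OF g, of x] by linarith
        then show ?thesis using False by (simp add: K_def algebra_simps)
      qed
      have E: "EROT lam c p s = dual p h" "EROT lam c r s = dual r g"
        using erot_dual(1)[OF pi pN h hmax] erot_dual(1)[OF r rN g max] by auto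
      \<comment> \<open>Here \<open>dual p g \<le> dual p h\<close> makes the remainder nonnegative,
        and \<open>dual r h \<le> dual r g\<close> bounds it by \<open>D h - D g\<close>.\<close>
      have "\<bar>EROT lam c p s - EROT lam c r s - D g\<bar> \<le> \<bar>D h - D g\<bar>"
        using hmax[OF g] max[OF h] unfolding E dual_D by linarith
      also have "D h - D g = (\<integral>x. ?u x \<partial>p) - (\<integral>x. ?u x \<partial>r)"
        using i[OF h pi] i[OF g pi] i[OF h r] i[OF g r] by (simp add: D_def)
      finally have "ennreal \<bar>EROT lam c p s - EROT lam c r s - D g\<bar> \<le> ennreal \<bar>(\<integral>x. ?u x \<partial>p) - (\<integral>x. ?u x \<partial>r)\<bar>"
        by (rule ennreal_leI)
      also have "\<dots> \<le> wdist (\<lambda>x. if x \<in> F then \<epsilon> * CX x else K * CX x) p r"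
        by (rule expectation_diff_le[OF _ _ ub]) (use i[OF h pi] i[OF g pi] i[OF h r] i[OF g r] in auto)
      finally show "ennreal \<bar>EROT lam c p s - EROT lam c r s - ((\<integral>x. fpot g x \<partial>p) - (\<integral>x. fpot g x \<partial>r))\<bar>
         \<le> wdist (\<lambda>x. if x \<in> F then \<epsilon> * CX x else K * CX x) p r" by (simp add: D_def)
    qed
  qed
qed

lemma CX_int_of_sqrt:
  assumes r: "integrable (count_space UNIV) (\<lambda>x. CX x * sqrt (pmf r x))"
  shows "integrable (measure_pmf r) CX"
  unfolding integrable_pmf_count_space
  proof (rule Bochner_Integration.integrable_bound[OF r])
    have CX0: "0 \<le> CX x" for x using CX_ge(1)[of x] by linarith
    show "AE x in count_space UNIV. norm (pmf r x * CX x) \<le> norm (CX x * sqrt (pmf r x))"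
    proof (rule AE_I2)
      fix x
      have "pmf r x \<le> sqrt (pmf r x)"
        using pmf_le_1[of r x] pmf_nonneg[of r x] by (metis real_le_rsqrt power_le_one power2_eq_square mult_left_le)
      then show "norm (pmf r x * CX x) \<le> norm (CX x * sqrt (pmf r x))"
        using mult_left_mono[OF _ CX0[of x], of "pmf r x" "sqrt (pmf r x)"] CX0[of x]
        by (simp add: abs_mult mult.commute)
    qed
  qed simp

text \<open>The first-order term is linear, so its contributions combine into one pairing with the
  four-point difference. The three remainders carry the weight \<open>W\<close>, which is tiny on a
  finite set and has a small tail outside.\<close>

lemma erot_four_point:
  assumes r: "integrable (count_space UNIV) (\<lambda>x. CX x * sqrt (pmf r x))"
  shows "four_point_approx CX r (\<lambda>p2 p3 p4. norm (EROT lam c p4 s - EROT lam c p3 s - (EROT lam c p2 s - EROT lam c r s)))"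
proof -
  let ?E = "\<lambda>p. EROT lam c p s"
  have CX0: "0 \<le> CX x" for x using CX_ge(1)[of x] by linarith
  have ri: "integrable (measure_pmf r) CX" by (rule CX_int_of_sqrt[OF r])
  obtain K f where K: "0 \<le> K" and f: "\<And>x. \<bar>f x\<bar> \<le> K * CX x"
    and ex: "\<And>\<epsilon> F. 0 < \<epsilon> \<Longrightarrow> \<epsilon> \<le> 1 \<Longrightarrow> finite F \<Longrightarrow> \<exists>\<delta>>0. \<forall>p. wdist CX p r \<le> ennreal \<delta> \<longrightarrow>
       integrable (measure_pmf p) CX \<and>
       ennreal \<bar>?E p - ?E r - ((\<integral>x. f x \<partial>p) - (\<integral>x. f x \<partial>r))\<bar>
         \<le> wdist (\<lambda>x. if x \<in> F then \<epsilon> * CX x else K * CX x) p r"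
    using erot_expansion[OF ri] by blast
  show ?thesis unfolding four_point_approx_def
  proof (rule exI[of _ "K + 1"], intro conjI allI impI)
    fix \<epsilon> :: real assume e: "0 < \<epsilon>"
    let ?h = "\<lambda>x. ennreal (CX x * sqrt (pmf r x))"
    have hfin: "(\<integral>\<^sup>+x. ?h x \<partial>count_space UNIV) < \<infinity>"
      using r CX0 by (simp add: integrable_iff_bounded abs_mult)
    then obtain A where A: "0 \<le> A" "(\<integral>\<^sup>+x. ?h x \<partial>count_space UNIV) = ennreal A"
      by (metis ennreal_cases infinity_ennreal_def less_irrefl)
    define t where "t = \<epsilon> / (2 * (K + 1))"
    have t: "0 < t" "(K + 1) * t = \<epsilon> / 2" using e K by (auto simp: t_def field_simps)
    obtain F where F: "finite F" "(\<integral>\<^sup>+x. (if x \<in> F then 0 else ?h x) \<partial>count_space UNIV) \<le> ennreal t"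
      by (rule nn_integral_tail[OF hfin t(1)])
    \<comment> \<open>The tolerance is split evenly: the part on \<open>F\<close> costs at most
      \<open>\<gamma> * A\<close>, the tail at most \<open>(K + 1) * t\<close>.\<close>
    define \<gamma> where "\<gamma> = min 1 (\<epsilon> / (2 * (A + 1)))"
    have \<gamma>: "0 < \<gamma>" "\<gamma> \<le> 1" "\<gamma> * A \<le> \<epsilon> / 2"
    proof -
      show "0 < \<gamma>" "\<gamma> \<le> 1" using e A by (auto simp: \<gamma>_def)
      have "\<gamma> * A \<le> \<epsilon> / (2 * (A + 1)) * A" by (rule mult_right_mono) (use A in \<open>auto simp: \<gamma>_def\<close>)
      also have "\<dots> \<le> \<epsilon> / 2" using A e by (simp add: field_simps)
      finally show "\<gamma> * A \<le> \<epsilon> / 2" .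
    qed
    define W where "W = (\<lambda>x. if x \<in> F then \<gamma> * CX x else K * CX x)"
    from ex[OF \<gamma>(1,2) F(1)] obtain \<delta> where \<delta>: "0 < \<delta>"
      "\<And>p. wdist CX p r \<le> ennreal \<delta> \<Longrightarrow> integrable (measure_pmf p) CX \<and>
       ennreal \<bar>?E p - ?E r - ((\<integral>x. f x \<partial>p) - (\<integral>x. f x \<partial>r))\<bar> \<le> wdist W p r"
      unfolding W_def by blast
    show "\<exists>\<delta>>0. \<exists>W. (\<forall>x. 0 \<le> W x \<and> W x \<le> (K + 1) * CX x) \<and>
      (\<integral>\<^sup>+x. ennreal (W x * sqrt (pmf r x)) \<partial>count_space UNIV) \<le> ennreal \<epsilon> \<and>
      (\<forall>p2 p3 p4. wdist CX p2 r \<le> ennreal \<delta> \<longrightarrow> wdist CX p3 r \<le> ennreal \<delta> \<longrightarrow> wdist CX p4 r \<le> ennreal \<delta> \<longrightarrow>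
        ennreal (norm (?E p4 - ?E p3 - (?E p2 - ?E r)))
          \<le> ennreal (K + 1) * wnorm CX (\<lambda>x. pmf p4 x - pmf p3 x - (pmf p2 x - pmf r x))
          + (wdist W p2 r + wdist W p3 r + wdist W p4 r))"
    proof (intro exI[of _ \<delta>] exI[of _ W] conjI allI impI)
      show "0 < \<delta>" by (rule \<delta>)
      fix x
      show "0 \<le> W x" using \<gamma> K CX0[of x] by (simp add: W_def)
      show "W x \<le> (K + 1) * CX x"
      proof (cases "x \<in> F")
        case True
        have "\<gamma> * CX x \<le> (K + 1) * CX x" by (rule mult_right_mono) (use \<gamma> K CX0[of x] in auto)
        then show ?thesis using True by (simp add: W_def)
      qed (use CX0[of x] in \<open>simp add: W_def distrib_right\<close>)
    next
      have "(\<integral>\<^sup>+x. ennreal (W x * sqrt (pmf r x)) \<partial>count_space UNIV)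
        \<le> (\<integral>\<^sup>+x. ennreal \<gamma> * ?h x + ennreal (K + 1) * (if x \<in> F then 0 else ?h x) \<partial>count_space UNIV)"
      proof (rule nn_integral_mono)
        fix x show "ennreal (W x * sqrt (pmf r x)) \<le> ennreal \<gamma> * ?h x + ennreal (K + 1) * (if x \<in> F then 0 else ?h x)"
          using \<gamma> K CX0[of x] by (simp add: W_def ennreal_mult[symmetric] ennreal_plus[symmetric] mult.assoc distrib_right
              del: ennreal_plus)
      qed
      also have "\<dots> = ennreal \<gamma> * (\<integral>\<^sup>+x. ?h x \<partial>count_space UNIV)
          + ennreal (K + 1) * (\<integral>\<^sup>+x. (if x \<in> F then 0 else ?h x) \<partial>count_space UNIV)"
        by (simp add: nn_integral_add nn_integral_cmult)
      also have "\<dots> \<le> ennreal \<gamma> * ennreal A + ennreal (K + 1) * ennreal t"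
        unfolding A(2) by (intro add_left_mono mult_left_mono F(2)) simp
      also have "\<dots> = ennreal (\<gamma> * A + \<epsilon> / 2)"
        using \<gamma> K A e t by (simp add: ennreal_mult[symmetric] ennreal_plus[symmetric] t(2) del: ennreal_plus)
      also have "\<dots> \<le> ennreal \<epsilon>" using \<gamma>(3) by (intro ennreal_leI) simp
      finally show "(\<integral>\<^sup>+x. ennreal (W x * sqrt (pmf r x)) \<partial>count_space UNIV) \<le> ennreal \<epsilon>" .
    next
      fix p2 p3 p4
      assume d: "wdist CX p2 r \<le> ennreal \<delta>" "wdist CX p3 r \<le> ennreal \<delta>" "wdist CX p4 r \<le> ennreal \<delta>"
      have fi: "integrable (measure_pmf p) f" if "integrable (measure_pmf p) CX" for p
      proof (rule Bochner_Integration.integrable_bound)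
        show "integrable (measure_pmf p) (\<lambda>x. K * CX x)" using that by simp
        show "AE x in p. norm (f x) \<le> norm (K * CX x)" using f K CX0 by (auto intro!: AE_I2 simp: abs_mult)
      qed simp
      define R where "R p = ?E p - ?E r - ((\<integral>x. f x \<partial>p) - (\<integral>x. f x \<partial>r))" for p
      have R: "ennreal \<bar>R p2\<bar> \<le> wdist W p2 r" "ennreal \<bar>R p3\<bar> \<le> wdist W p3 r" "ennreal \<bar>R p4\<bar> \<le> wdist W p4 r"
        using \<delta>(2)[OF d(1)] \<delta>(2)[OF d(2)] \<delta>(2)[OF d(3)] by (auto simp: R_def)
      have i: "integrable (measure_pmf p2) f" "integrable (measure_pmf p3) f" "integrable (measure_pmf p4) f" "integrable (measure_pmf r) f"
        using \<delta>(2)[OF d(1)] \<delta>(2)[OF d(2)] \<delta>(2)[OF d(3)] ri fi by auto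
      let ?L = "(\<integral>x. f x \<partial>p4) - (\<integral>x. f x \<partial>p3) - ((\<integral>x. f x \<partial>p2) - (\<integral>x. f x \<partial>r))"
      have L: "?L = (\<integral>x. (pmf p4 x - pmf p3 x - (pmf p2 x - pmf r x)) * f x \<partial>count_space UNIV)"
        using i by (simp add: integral_pmf_count_space integrable_pmf_count_space left_diff_distrib)
      have "ennreal (norm (?E p4 - ?E p3 - (?E p2 - ?E r))) \<le> ennreal (\<bar>?L\<bar> + (\<bar>R p2\<bar> + \<bar>R p3\<bar> + \<bar>R p4\<bar>))"
        by (intro ennreal_leI) (simp add: R_def)
      also have "\<dots> = ennreal \<bar>?L\<bar> + (ennreal \<bar>R p2\<bar> + ennreal \<bar>R p3\<bar> + ennreal \<bar>R p4\<bar>)"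
        by simp
      also have "\<dots> \<le> wnorm (\<lambda>x. (K + 1) * CX x) (\<lambda>x. pmf p4 x - pmf p3 x - (pmf p2 x - pmf r x))
          + (wdist W p2 r + wdist W p3 r + wdist W p4 r)"
      proof (intro add_mono R)
        have "\<bar>f x\<bar> \<le> (K + 1) * CX x" for x using f[of x] CX0[of x] by (simp add: distrib_right)
        then show "ennreal \<bar>?L\<bar> \<le> wnorm (\<lambda>x. (K + 1) * CX x) (\<lambda>x. pmf p4 x - pmf p3 x - (pmf p2 x - pmf r x))"
          unfolding L by (rule wnorm_integral_le)
      qed
      finally show "ennreal (norm (?E p4 - ?E p3 - (?E p2 - ?E r)))
          \<le> ennreal (K + 1) * wnorm CX (\<lambda>x. pmf p4 x - pmf p3 x - (pmf p2 x - pmf r x))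
          + (wdist W p2 r + wdist W p3 r + wdist W p4 r)"
        using K by (simp add: wnorm_cmult)
    qed
  qed (use K in simp)
qed

end

section \<open>Moments of resampled empirical measures\<close>

lemma map_replicate_pmf: "map_pmf (map f) (replicate_pmf n q) = replicate_pmf n (map_pmf f q)"
proof (induction n)
  case (Suc n)
  show ?case by (simp add: map_bind_pmf bind_map_pmf Suc[symmetric])
qed simp

lemma replicate_pmf_Suc_pair: "replicate_pmf (Suc n) q = map_pmf (\<lambda>(x, xs). x # xs) (pair_pmf q (replicate_pmf n q))"
  by (simp add: pair_pmf_def map_bind_pmf)

lemma abs_sum_list_map_le:
  fixes \<psi> :: "'a \<Rightarrow> real"
  assumes "\<And>x. \<bar>\<psi> x\<bar> \<le> B"
  shows "\<bar>sum_list (map \<psi> l)\<bar> \<le> real (length l) * B"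
proof (induction l)
  case (Cons a l)
  then show ?case using assms[of a] by (simp add: algebra_simps)
qed simp

lemma replicate_sum_integrable:
  fixes \<psi> :: "'a \<Rightarrow> real"
  assumes "\<And>x. \<bar>\<psi> x\<bar> \<le> B"
  shows "integrable (measure_pmf (replicate_pmf n q)) (\<lambda>l. sum_list (map \<psi> l))"
    and "integrable (measure_pmf (replicate_pmf n q)) (\<lambda>l. (sum_list (map \<psi> l))\<^sup>2)"
proof -
  have b: "\<bar>sum_list (map \<psi> l)\<bar> \<le> real n * B" if "l \<in> set_pmf (replicate_pmf n q)" for l
    using abs_sum_list_map_le[of \<psi> B l, OF assms] that by (simp add: set_replicate_pmf)
  show "integrable (measure_pmf (replicate_pmf n q)) (\<lambda>l. sum_list (map \<psi> l))"
    by (rule measure_pmf.integrable_const_bound[where B="real n * B"]) (auto intro!: AE_pmfI b)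
  show "integrable (measure_pmf (replicate_pmf n q)) (\<lambda>l. (sum_list (map \<psi> l))\<^sup>2)"
  proof (rule measure_pmf.integrable_const_bound[where B="(real n * B)\<^sup>2"])
    show "AE l in replicate_pmf n q. norm ((sum_list (map \<psi> l))\<^sup>2) \<le> (real n * B)\<^sup>2"
    proof (rule AE_pmfI)
      fix l assume "l \<in> set_pmf (replicate_pmf n q)"
      from power_mono[OF b[OF this], of 2] show "norm ((sum_list (map \<psi> l))\<^sup>2) \<le> (real n * B)\<^sup>2" by simp
    qed
  qed simp
qed

text \<open>Induction on the sample size; centring kills the cross term, so second moments
  add.\<close>

lemma replicate_sum_moments:
  fixes \<psi> :: "'a \<Rightarrow> real" and q :: "'a pmf"
  assumes b: "\<And>x. \<bar>\<psi> x\<bar> \<le> B" and z: "(\<integral>x. \<psi> x \<partial>q) = 0"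
  shows "(\<integral>l. sum_list (map \<psi> l) \<partial>replicate_pmf n q) = 0 \<and>
    (\<integral>\<^sup>+l. ennreal ((sum_list (map \<psi> l))\<^sup>2) \<partial>replicate_pmf n q) = ennreal (real n * (\<integral>x. (\<psi> x)\<^sup>2 \<partial>q))"
proof (induction n)
  case (Suc n)
  let ?R = "replicate_pmf n q" and ?S = "\<lambda>l. sum_list (map \<psi> l)"
  note i = replicate_sum_integrable[of \<psi> B n q, OF b]
  have \<psi>i: "integrable (measure_pmf q) \<psi>"
    by (rule measure_pmf.integrable_const_bound[where B=B]) (use b in auto)
  have \<psi>2: "integrable (measure_pmf q) (\<lambda>x. (\<psi> x)\<^sup>2)"
    by (rule measure_pmf.integrable_const_bound[where B="B\<^sup>2"]) (use b in \<open>auto simp: abs_le_square_iff[symmetric] intro!: AE_I2 order_trans[OF b]\<close>)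
  have S2: "(\<integral>l. (?S l)\<^sup>2 \<partial>?R) = real n * (\<integral>x. (\<psi> x)\<^sup>2 \<partial>q)"
    using Suc nn_integral_eq_integral[OF i(2)] by (simp add: integral_nonneg_AE)
  have "(\<integral>l. ?S l \<partial>replicate_pmf (Suc n) q) = (\<integral>z. \<psi> (fst z) + ?S (snd z) \<partial>pair_pmf q ?R)"
    unfolding replicate_pmf_Suc_pair by (simp add: split_beta)
  also have "\<dots> = (\<integral>z. \<psi> (fst z) \<partial>pair_pmf q ?R) + (\<integral>z. ?S (snd z) \<partial>pair_pmf q ?R)"
  proof (rule Bochner_Integration.integral_add)
    show "integrable (measure_pmf (pair_pmf q ?R)) (\<lambda>z. \<psi> (fst z))"
      using \<psi>i integrable_map_pmf_eq[of fst "pair_pmf q ?R" \<psi>] by (simp add: map_fst_pair_pmf)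
    show "integrable (measure_pmf (pair_pmf q ?R)) (\<lambda>z. ?S (snd z))"
      using i(1) integrable_map_pmf_eq[of snd "pair_pmf q ?R" ?S] by (simp add: map_snd_pair_pmf)
  qed
  also have "\<dots> = 0"
    using Suc z expectation_pair_pmf_fst[of q ?R \<psi>] expectation_pair_pmf_snd[of q ?R ?S] by simp
  finally have 1: "(\<integral>l. ?S l \<partial>replicate_pmf (Suc n) q) = 0" .
  have "(\<integral>\<^sup>+l. ennreal ((?S l)\<^sup>2) \<partial>replicate_pmf (Suc n) q) = (\<integral>\<^sup>+x. \<integral>\<^sup>+l. ennreal ((\<psi> x + ?S l)\<^sup>2) \<partial>?R \<partial>q)"
    by simp
  also have "\<dots> = (\<integral>\<^sup>+x. ennreal ((\<psi> x)\<^sup>2 + real n * (\<integral>x. (\<psi> x)\<^sup>2 \<partial>q)) \<partial>q)"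
  proof (rule nn_integral_cong)
    fix x
    have e: "(\<lambda>l. (\<psi> x + ?S l)\<^sup>2) = (\<lambda>l. (\<psi> x)\<^sup>2 + 2 * \<psi> x * ?S l + (?S l)\<^sup>2)"
      by (rule ext) (simp add: power2_sum algebra_simps)
    have "(\<integral>\<^sup>+l. ennreal ((\<psi> x + ?S l)\<^sup>2) \<partial>?R) = ennreal (\<integral>l. (\<psi> x + ?S l)\<^sup>2 \<partial>?R)"
      by (rule nn_integral_eq_integral) (use i in \<open>auto simp: e\<close>)
    also have "(\<integral>l. (\<psi> x + ?S l)\<^sup>2 \<partial>?R) = (\<psi> x)\<^sup>2 + real n * (\<integral>x. (\<psi> x)\<^sup>2 \<partial>q)"
      unfolding e using i Suc S2 by simp
    finally show "(\<integral>\<^sup>+l. ennreal ((\<psi> x + ?S l)\<^sup>2) \<partial>?R) = ennreal ((\<psi> x)\<^sup>2 + real n * (\<integral>x. (\<psi> x)\<^sup>2 \<partial>q))" .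
  qed
  also have "\<dots> = ennreal (\<integral>x. (\<psi> x)\<^sup>2 + real n * (\<integral>x. (\<psi> x)\<^sup>2 \<partial>q) \<partial>q)"
    by (rule nn_integral_eq_integral) (use \<psi>2 in \<open>auto intro!: AE_I2 add_nonneg_nonneg mult_nonneg_nonneg integral_nonneg_AE\<close>)
  also have "\<dots> = ennreal (real (Suc n) * (\<integral>x. (\<psi> x)\<^sup>2 \<partial>q))"
    using \<psi>2 by (simp add: algebra_simps)
  finally show ?case using 1 by blast
qed simp

text \<open>The inequality \<open>sqrt u \<le> (u + e) / (2 * sqrt e)\<close> of arithmetic and
  geometric means, tuned to the level \<open>e\<close>, takes the place of Jensen's inequality for
  the concave root.\<close>

lemma nn_integral_sqrt_le:
  fixes p :: "'a pmf"
  assumes f: "\<And>x. 0 \<le> f x" and e: "(\<integral>\<^sup>+x. ennreal (f x) \<partial>p) \<le> ennreal e"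
  shows "(\<integral>\<^sup>+x. ennreal (sqrt (f x)) \<partial>p) \<le> ennreal (sqrt e)"
proof (cases "e \<le> 0")
  case True
  then have "(\<integral>\<^sup>+x. ennreal (f x) \<partial>p) = 0" using e by (simp add: ennreal_neg)
  then have "AE x in p. ennreal (f x) = 0" by (subst (asm) nn_integral_0_iff_AE) auto
  then have "(\<integral>\<^sup>+x. ennreal (sqrt (f x)) \<partial>p) = (\<integral>\<^sup>+x. 0 \<partial>p)"
    by (intro nn_integral_cong_AE) (use f in \<open>auto elim!: eventually_mono simp: ennreal_eq_0_iff\<close>)
  then show ?thesis by simp
next
  case False
  then have e0: "0 < e" by simp
  have "(\<integral>\<^sup>+x. ennreal (sqrt (f x)) \<partial>p) \<le> (\<integral>\<^sup>+x. ennreal (1 / (2 * sqrt e)) * ennreal (f x) + ennreal (sqrt e / 2) \<partial>p)"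
  proof (rule nn_integral_mono)
    fix x
    have "0 \<le> (sqrt (f x) - sqrt e)\<^sup>2" by simp
    then have "2 * sqrt (f x) * sqrt e \<le> f x + e"
      using f[of x] e0 by (simp add: power2_diff)
    then have "sqrt (f x) \<le> (f x + e) / (2 * sqrt e)" using e0 by (simp add: field_simps)
    also have "\<dots> = 1 / (2 * sqrt e) * f x + sqrt e / 2"
      using e0 by (simp add: field_simps power2_eq_square[symmetric])
    finally show "ennreal (sqrt (f x)) \<le> ennreal (1 / (2 * sqrt e)) * ennreal (f x) + ennreal (sqrt e / 2)"
      using f[of x] e0 by (simp add: ennreal_mult[symmetric] ennreal_plus[symmetric] del: ennreal_plus)
  qed
  also have "\<dots> = ennreal (1 / (2 * sqrt e)) * (\<integral>\<^sup>+x. ennreal (f x) \<partial>p) + ennreal (sqrt e / 2)"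
    by (simp add: nn_integral_add nn_integral_cmult)
  also have "\<dots> \<le> ennreal (1 / (2 * sqrt e)) * ennreal e + ennreal (sqrt e / 2)"
    by (intro add_right_mono mult_left_mono e) simp
  also have "\<dots> = ennreal (e / (2 * sqrt e) + sqrt e / 2)"
    using e0 by (simp add: ennreal_mult[symmetric] ennreal_plus[symmetric] del: ennreal_plus)
  also have "e / (2 * sqrt e) + sqrt e / 2 = sqrt e"
    using e0 by (simp add: field_simps power2_eq_square[symmetric])
  finally show ?thesis .
qed

text \<open>The variance is bounded by the uncentred second moment, which for an indicator is simply
  a probability.\<close>

lemma replicate_mean_deviation:
  fixes \<phi> :: "'a \<Rightarrow> real" and q :: "'a pmf"
  assumes b: "\<And>x. \<bar>\<phi> x\<bar> \<le> B" and n: "0 < n"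
  shows "(\<integral>\<^sup>+l. ennreal (sqrt n * \<bar>sum_list (map \<phi> l) / n - (\<integral>x. \<phi> x \<partial>q)\<bar>) \<partial>replicate_pmf n q)
    \<le> ennreal (sqrt (\<integral>x. (\<phi> x)\<^sup>2 \<partial>q))"
proof -
  define \<mu> where "\<mu> = (\<integral>x. \<phi> x \<partial>q)"
  let ?\<psi> = "\<lambda>x. \<phi> x - \<mu>"
  have \<phi>i: "integrable (measure_pmf q) \<phi>"
    by (rule measure_pmf.integrable_const_bound[where B=B]) (use b in auto)
  have \<phi>2: "integrable (measure_pmf q) (\<lambda>x. (\<phi> x)\<^sup>2)"
    by (rule measure_pmf.integrable_const_bound[where B="B\<^sup>2"]) (use b in \<open>auto simp: abs_le_square_iff[symmetric] intro!: AE_I2 order_trans[OF b]\<close>)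
  have \<psi>b: "\<bar>?\<psi> x\<bar> \<le> B + \<bar>\<mu>\<bar>" for x using b[of x] by linarith
  have \<psi>z: "(\<integral>x. ?\<psi> x \<partial>q) = 0" using \<phi>i by (simp add: \<mu>_def)
  have V: "(\<integral>x. (?\<psi> x)\<^sup>2 \<partial>q) \<le> (\<integral>x. (\<phi> x)\<^sup>2 \<partial>q)"
  proof -
    have "(\<lambda>x. (?\<psi> x)\<^sup>2) = (\<lambda>x. (\<phi> x)\<^sup>2 - 2 * \<mu> * \<phi> x + \<mu>\<^sup>2)"
      by (rule ext) (simp add: power2_diff algebra_simps)
    then have "(\<integral>x. (?\<psi> x)\<^sup>2 \<partial>q) = (\<integral>x. (\<phi> x)\<^sup>2 \<partial>q) - 2 * \<mu> * \<mu> + \<mu>\<^sup>2"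
      using \<phi>i \<phi>2 by (simp add: \<mu>_def)
    then show ?thesis by (simp add: power2_eq_square)
  qed
  have "(\<integral>\<^sup>+l. ennreal (sqrt n * \<bar>sum_list (map \<phi> l) / n - \<mu>\<bar>) \<partial>replicate_pmf n q)
     = (\<integral>\<^sup>+l. ennreal (sqrt ((sum_list (map ?\<psi> l))\<^sup>2 / n)) \<partial>replicate_pmf n q)"
  proof (rule nn_integral_cong_AE, rule AE_pmfI)
    fix l assume "l \<in> set_pmf (replicate_pmf n q)"
    then have l: "length l = n" by (simp add: set_replicate_pmf)
    have "sum_list (map ?\<psi> l) = sum_list (map \<phi> l) - length l * \<mu>"
      by (induction l) (simp_all add: algebra_simps)
    then have "sum_list (map \<phi> l) / n - \<mu> = sum_list (map ?\<psi> l) / n"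
      using n l by (simp add: field_simps)
    then have "sqrt n * \<bar>sum_list (map \<phi> l) / n - \<mu>\<bar> = sqrt n * (\<bar>sum_list (map ?\<psi> l)\<bar> / n)" by simp
    also have "\<dots> = \<bar>sum_list (map ?\<psi> l)\<bar> / sqrt n"
      using n by (simp add: field_simps)
    finally show "ennreal (sqrt n * \<bar>sum_list (map \<phi> l) / n - \<mu>\<bar>) = ennreal (sqrt ((sum_list (map ?\<psi> l))\<^sup>2 / n))"
      by (simp add: real_sqrt_divide)
  qed
  also have "\<dots> \<le> ennreal (sqrt (\<integral>x. (?\<psi> x)\<^sup>2 \<partial>q))"
  proof (rule nn_integral_sqrt_le)
    have "(\<integral>\<^sup>+l. ennreal ((sum_list (map ?\<psi> l))\<^sup>2 / n) \<partial>replicate_pmf n q)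
       = (\<integral>\<^sup>+l. ennreal (1 / real n) * ennreal ((sum_list (map ?\<psi> l))\<^sup>2) \<partial>replicate_pmf n q)"
      by (simp add: ennreal_mult[symmetric])
    also have "\<dots> = ennreal (1 / real n) * ennreal (real n * (\<integral>x. (?\<psi> x)\<^sup>2 \<partial>q))"
      using replicate_sum_moments[OF \<psi>b \<psi>z, of n] by (simp add: nn_integral_cmult)
    also have "\<dots> = ennreal (\<integral>x. (?\<psi> x)\<^sup>2 \<partial>q)"
      using n by (simp add: ennreal_mult[symmetric] integral_nonneg_AE)
    finally show "(\<integral>\<^sup>+l. ennreal ((sum_list (map ?\<psi> l))\<^sup>2 / n) \<partial>replicate_pmf n q) \<le> ennreal (\<integral>x. (?\<psi> x)\<^sup>2 \<partial>q)" by simp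
  qed simp
  also have "\<dots> \<le> ennreal (sqrt (\<integral>x. (\<phi> x)\<^sup>2 \<partial>q))" using V by (intro ennreal_leI) simp
  finally show ?thesis by (simp add: \<mu>_def)
qed

text \<open>Exchanging sum and expectation reduces the weighted norm to one coordinate at a time.
  This is the origin of all sums of weights against standard deviations.\<close>

lemma replicate_wnorm_deviation:
  fixes \<phi> :: "'x::countable \<Rightarrow> 'a \<Rightarrow> real" and q :: "'a pmf"
  assumes b: "\<And>x z. \<bar>\<phi> x z\<bar> \<le> B" and n: "0 < n" and W: "\<And>x. 0 \<le> W x"
  shows "(\<integral>\<^sup>+l. ennreal (sqrt n) * wnorm W (\<lambda>x. sum_list (map (\<phi> x) l) / n - (\<integral>z. \<phi> x z \<partial>q)) \<partial>replicate_pmf n q)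
    \<le> (\<integral>\<^sup>+x. ennreal (W x * sqrt (\<integral>z. (\<phi> x z)\<^sup>2 \<partial>q)) \<partial>count_space UNIV)"
proof -
  let ?d = "\<lambda>l x. sum_list (map (\<phi> x) l) / n - (\<integral>z. \<phi> x z \<partial>q)"
  have "(\<integral>\<^sup>+l. ennreal (sqrt n) * wnorm W (?d l) \<partial>replicate_pmf n q)
    = (\<integral>\<^sup>+l. \<integral>\<^sup>+x. ennreal (W x) * ennreal (sqrt n * \<bar>?d l x\<bar>) \<partial>count_space UNIV \<partial>replicate_pmf n q)"
    unfolding wnorm_def
    by (subst nn_integral_cmult[symmetric]) (auto intro!: nn_integral_cong simp: W ennreal_mult[symmetric] mult_ac)
  also have "\<dots> = (\<integral>\<^sup>+x. \<integral>\<^sup>+l. ennreal (W x) * ennreal (sqrt n * \<bar>?d l x\<bar>) \<partial>replicate_pmf n q \<partial>count_space UNIV)"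
    by (rule nn_integral_count_space_nn_integral) auto
  also have "\<dots> = (\<integral>\<^sup>+x. ennreal (W x) * (\<integral>\<^sup>+l. ennreal (sqrt n * \<bar>?d l x\<bar>) \<partial>replicate_pmf n q) \<partial>count_space UNIV)"
    by (simp add: nn_integral_cmult)
  also have "\<dots> \<le> (\<integral>\<^sup>+x. ennreal (W x) * ennreal (sqrt (\<integral>z. (\<phi> x z)\<^sup>2 \<partial>q)) \<partial>count_space UNIV)"
    by (intro nn_integral_mono mult_left_mono replicate_mean_deviation[OF b n]) simp
  also have "\<dots> = (\<integral>\<^sup>+x. ennreal (W x * sqrt (\<integral>z. (\<phi> x z)\<^sup>2 \<partial>q)) \<partial>count_space UNIV)"
    by (simp add: ennreal_mult[symmetric] W integral_nonneg_AE)
  finally show ?thesis .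
qed

lemma replicate_sum_nn:
  fixes q :: "'a pmf"
  shows "(\<And>x. 0 \<le> \<phi> x) \<Longrightarrow> (\<integral>\<^sup>+l. ennreal (sum_list (map \<phi> l)) \<partial>replicate_pmf n q) = of_nat n * (\<integral>\<^sup>+x. ennreal (\<phi> x) \<partial>q)"
proof (induction n)
  case (Suc n)
  have "(\<integral>\<^sup>+l. ennreal (sum_list (map \<phi> l)) \<partial>replicate_pmf (Suc n) q)
     = (\<integral>\<^sup>+x. \<integral>\<^sup>+l. ennreal (\<phi> x) + ennreal (sum_list (map \<phi> l)) \<partial>replicate_pmf n q \<partial>q)"
    using Suc.prems by (auto intro!: nn_integral_cong ennreal_plus sum_list_nonneg)
  then show ?case using Suc by (simp add: nn_integral_add algebra_simps)
qed simp

text \<open>Samples are kept as lists, whose law is \<open>replicate_pmf\<close>; statements about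
  random sequences become integrals against a discrete distribution.\<close>

definition emp :: "'a list \<Rightarrow> 'a pmf" where
  "emp l = empirical (length l) (\<lambda>i. l ! i)"

lemma pmf_emp:
  assumes "0 < length l"
  shows "pmf (emp l) a = sum_list (map (indicator {a}) l) / length l"
  using assms by (simp add: emp_def pmf_empirical sum_list_sum_nth lessThan_atLeast0)

section \<open>Coupling the bootstrap with fresh samples\<close>

text \<open>The common part \<open>min (pmf p x) (pmf q x)\<close> stays on the diagonal and the
  residuals are coupled independently. The residuals have disjoint supports, so exactly one
  coordinate equals \<open>x\<close> with probability
  \<open>\<bar>pmf p x - pmf q x\<bar>\<close>.\<close>

lemma maximal_coupling:
  fixes p q :: "'a pmf"
  shows "\<exists>\<kappa>. map_pmf fst \<kappa> = p \<and> map_pmf snd \<kappa> = q \<and>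
    (\<forall>x. (\<integral>z. (indicator {x} (snd z) - indicator {x} (fst z) :: real)\<^sup>2 \<partial>\<kappa>) = \<bar>pmf p x - pmf q x\<bar>)"
proof -
  let ?C = "count_space (UNIV :: 'a set)"
  define a where "a = (\<lambda>x. min (pmf p x) (pmf q x))"
  define u where "u = (\<lambda>x. pmf p x - a x)"
  define v where "v = (\<lambda>x. pmf q x - a x)"
  have a0: "0 \<le> a x" and u0: "0 \<le> u x" and v0: "0 \<le> v x" and uv: "u x * v x = 0" for x
    by (auto simp: a_def u_def v_def min_def)
  have ai: "integrable ?C a"
    by (rule Bochner_Integration.integrable_bound[OF integrable_pmf[of UNIV p]]) (auto simp: a_def)
  define T where "T = 1 - (\<integral>x. a x \<partial>?C)"
  have ui: "integrable ?C u" and vi: "integrable ?C v"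
    using ai integrable_pmf[of UNIV p] integrable_pmf[of UNIV q] by (simp_all add: u_def v_def)
  have uT: "(\<integral>x. u x \<partial>?C) = T" and vT: "(\<integral>x. v x \<partial>?C) = T"
    using ai integrable_pmf[of UNIV p] integrable_pmf[of UNIV q] integral_pmf[of UNIV p] integral_pmf[of UNIV q]
    by (simp_all add: u_def v_def T_def)
  have T0: "0 \<le> T" unfolding uT[symmetric] by (rule integral_nonneg_AE) (use u0 in auto)
  have nu: "(\<integral>\<^sup>+x. ennreal (u x) \<partial>?C) = ennreal T" and nv: "(\<integral>\<^sup>+x. ennreal (v x) \<partial>?C) = ennreal T"
    using nn_integral_eq_integral[OF ui] nn_integral_eq_integral[OF vi] u0 v0 uT vT by auto
  \<comment> \<open>For \<open>T = 0\<close> the quotient in \<open>b\<close> has the value 0, which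
    is correct because both residuals then vanish.\<close>
  have T_zero: "u x = 0" "v x = 0" if "T = 0" for x
    using nu nv that u0[of x] v0[of x] by (auto simp: nn_integral_0_iff_AE AE_count_space ennreal_eq_0_iff intro: antisym)
  define b where "b = (\<lambda>(x, y). (if x = y then a x else 0) + u x * v y / T)"
  have b0: "0 \<le> b z" for z using a0 u0 v0 T0 by (auto simp: b_def split: prod.split)
  have diag: "(\<integral>\<^sup>+y. ennreal (if x = y then a x else 0) \<partial>?C) = ennreal (a x)"
    "(\<integral>\<^sup>+y. ennreal (if y = x then a y else 0) \<partial>?C) = ennreal (a x)" for x
  proof -
    have "(\<lambda>y. ennreal (if x = y then a x else 0)) = (\<lambda>y. ennreal (a x) * indicator {x} y)"
      "(\<lambda>y. ennreal (if y = x then a y else 0)) = (\<lambda>y. ennreal (a x) * indicator {x} y)"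
      by (auto simp: fun_eq_iff)
    then show "(\<integral>\<^sup>+y. ennreal (if x = y then a x else 0) \<partial>?C) = ennreal (a x)"
      "(\<integral>\<^sup>+y. ennreal (if y = x then a y else 0) \<partial>?C) = ennreal (a x)" by simp_all
  qed
  have "\<exists>G\<in>couplings p q. \<forall>z. pmf G z = b z"
  proof (rule coupling_of_density[OF b0])
    fix x
    have "(\<integral>\<^sup>+y. ennreal (b (x, y)) \<partial>?C) = (\<integral>\<^sup>+y. ennreal (if x = y then a x else 0) + ennreal (u x / T) * ennreal (v y) \<partial>?C)"
      by (rule nn_integral_cong)
        (use a0 u0 v0 T0 in \<open>simp add: b_def ennreal_mult[symmetric] ennreal_plus[symmetric] del: ennreal_plus\<close>)
    also have "\<dots> = ennreal (a x) + ennreal (u x / T) * ennreal T"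
      by (simp add: nn_integral_add nn_integral_cmult diag nv)
    also have "\<dots> = ennreal (a x + u x)"
      using a0[of x] u0[of x] T0 T_zero by (cases "T = 0") (simp_all add: ennreal_mult[symmetric] ennreal_plus[symmetric] del: ennreal_plus)
    finally show "(\<integral>\<^sup>+y. ennreal (b (x, y)) \<partial>?C) = ennreal (pmf p x)" by (simp add: u_def)
  next
    fix y
    have "(\<integral>\<^sup>+x. ennreal (b (x, y)) \<partial>?C) = (\<integral>\<^sup>+x. ennreal (if x = y then a x else 0) + ennreal (v y / T) * ennreal (u x) \<partial>?C)"
      by (rule nn_integral_cong)
        (use a0 u0 v0 T0 in \<open>simp add: b_def ennreal_mult[symmetric] ennreal_plus[symmetric] mult.commute del: ennreal_plus\<close>)
    also have "\<dots> = ennreal (a y) + ennreal (v y / T) * ennreal T"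
      by (simp add: nn_integral_add nn_integral_cmult diag nu)
    also have "\<dots> = ennreal (a y + v y)"
      using a0[of y] v0[of y] T0 T_zero by (cases "T = 0") (simp_all add: ennreal_mult[symmetric] ennreal_plus[symmetric] del: ennreal_plus)
    finally show "(\<integral>\<^sup>+x. ennreal (b (x, y)) \<partial>?C) = ennreal (pmf q y)" by (simp add: v_def)
  qed
  then obtain G where G: "map_pmf fst G = p" "map_pmf snd G = q" "\<And>z. pmf G z = b z"
    by (auto simp: couplings_def)
  have "(\<integral>z. (indicator {x} (snd z) - indicator {x} (fst z) :: real)\<^sup>2 \<partial>G) = \<bar>pmf p x - pmf q x\<bar>" for x
  proof -
    have e: "(\<lambda>z. (indicator {x} (snd z) - indicator {x} (fst z) :: real)\<^sup>2)
      = (\<lambda>z. indicator {x} (fst z) + indicator {x} (snd z) - 2 * indicator {(x, x)} z)"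
      by (auto simp: fun_eq_iff indicator_def)
    have i: "integrable (measure_pmf G) (\<lambda>z. indicator {x} (fst z) :: real)"
      "integrable (measure_pmf G) (\<lambda>z. indicator {x} (snd z) :: real)"
      "integrable (measure_pmf G) (indicator {(x, x)} :: _ \<Rightarrow> real)"
      by (auto intro!: measure_pmf.integrable_const_bound[where B=1])
    have "(\<integral>z. (indicator {x} (fst z) :: real) \<partial>G) = (\<integral>z. indicator {x} z \<partial>map_pmf fst G)"
      "(\<integral>z. (indicator {x} (snd z) :: real) \<partial>G) = (\<integral>z. indicator {x} z \<partial>map_pmf snd G)"
      by (simp_all only: integral_map_pmf)
    then have "(\<integral>z. (indicator {x} (fst z) :: real) \<partial>G) = pmf p x" "(\<integral>z. (indicator {x} (snd z) :: real) \<partial>G) = pmf q x"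
      unfolding G(1,2) by (simp_all add: measure_pmf_single)
    moreover have "(\<integral>z. indicator {(x, x)} z \<partial>G) = a x"
      by (simp add: measure_pmf_single G(3) b_def uv)
    ultimately show ?thesis unfolding e using i by (simp add: a_def min_def)
  qed
  with G show ?thesis by blast
qed

definition mcoup :: "'a pmf \<Rightarrow> 'a pmf \<Rightarrow> ('a \<times> 'a) pmf" where
  "mcoup p q = (SOME \<kappa>. map_pmf fst \<kappa> = p \<and> map_pmf snd \<kappa> = q \<and>
    (\<forall>x. (\<integral>z. (indicator {x} (snd z) - indicator {x} (fst z) :: real)\<^sup>2 \<partial>\<kappa>) = \<bar>pmf p x - pmf q x\<bar>))"

lemma mcoup:
  "map_pmf fst (mcoup p q) = p" "map_pmf snd (mcoup p q) = q"
  "(\<integral>z. (indicator {x} (snd z) - indicator {x} (fst z) :: real)\<^sup>2 \<partial>mcoup p q) = \<bar>pmf p x - pmf q x\<bar>"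
  using someI_ex[OF maximal_coupling[of p q]] unfolding mcoup_def[symmetric] by blast+

lemma expectation_indicator_sing: "(\<integral>z. (indicator {x} z :: real) \<partial>measure_pmf q) = pmf q x"
  by (simp add: measure_pmf_single)

lemma emp_deviation:
  fixes q :: "'x::countable pmf"
  assumes n: "0 < n" and W: "\<And>x. 0 \<le> W x"
  shows "(\<integral>\<^sup>+l. ennreal (sqrt (real n)) * wdist W (emp l) q \<partial>replicate_pmf n q)
    \<le> (\<integral>\<^sup>+x. ennreal (W x * sqrt (pmf q x)) \<partial>count_space UNIV)"
proof -
  have "(\<integral>\<^sup>+l. ennreal (sqrt (real n)) * wdist W (emp l) q \<partial>replicate_pmf n q)
    = (\<integral>\<^sup>+l. ennreal (sqrt (real n)) * wnorm W (\<lambda>x. sum_list (map (indicator {x}) l) / real n - (\<integral>z. indicator {x} z \<partial>q)) \<partial>replicate_pmf n q)"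
    by (rule nn_integral_cong_AE, rule AE_pmfI)
      (use n in \<open>simp add: set_replicate_pmf pmf_emp measure_pmf_single\<close>)
  also have "\<dots> \<le> (\<integral>\<^sup>+x. ennreal (W x * sqrt (\<integral>z. (indicator {x} z)\<^sup>2 \<partial>q)) \<partial>count_space UNIV)"
    by (rule replicate_wnorm_deviation[where B=1, OF _ n W]) (auto simp: indicator_def)
  also have "(\<lambda>x. \<integral>z. (indicator {x} z :: real)\<^sup>2 \<partial>q) = pmf q"
  proof
    fix x :: 'x
    have "(\<lambda>z. (indicator {x} z :: real)\<^sup>2) = indicator {x}" by (auto simp: indicator_def)
    then show "(\<integral>z. (indicator {x} z :: real)\<^sup>2 \<partial>q) = pmf q x" by (simp add: measure_pmf_single)
  qed
  finally show ?thesis .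
qed

text \<open>In each coupled pair the first entry is a fresh draw from \<open>r\<close>, the second a
  bootstrap draw from \<open>p\<close>. The four-point difference at \<open>x\<close> is a centred
  mean of differences of indicators, whose second moment under the maximal coupling is only
  \<open>\<bar>pmf r x - pmf p x\<bar>\<close>.\<close>

lemma coupled_deviation:
  fixes r p :: "'x::countable pmf"
  assumes n: "0 < n" and W: "\<And>x. 0 \<le> W x"
  shows "(\<integral>\<^sup>+l. ennreal (sqrt (real n)) * wnorm W (\<lambda>x. pmf (emp (map snd l)) x - pmf p x - (pmf (emp (map fst l)) x - pmf r x))
        \<partial>replicate_pmf n (mcoup r p))
    \<le> (\<integral>\<^sup>+x. ennreal (W x * sqrt \<bar>pmf r x - pmf p x\<bar>) \<partial>count_space UNIV)"
proof -
  let ?\<phi> = "\<lambda>x z. indicator {x} (snd z) - indicator {x} (fst z) :: real"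
  have \<mu>: "(\<integral>z. ?\<phi> x z \<partial>mcoup r p) = pmf p x - pmf r x" for x
  proof -
    have i: "integrable (measure_pmf (mcoup r p)) (\<lambda>z. indicator {x} (fst z) :: real)"
      "integrable (measure_pmf (mcoup r p)) (\<lambda>z. indicator {x} (snd z) :: real)"
      by (auto intro!: measure_pmf.integrable_const_bound[where B=1])
    have "(\<integral>z. ?\<phi> x z \<partial>mcoup r p) = (\<integral>z. indicator {x} z \<partial>map_pmf snd (mcoup r p)) - (\<integral>z. indicator {x} z \<partial>map_pmf fst (mcoup r p))"
      using i by (simp only: integral_map_pmf Bochner_Integration.integral_diff)
    then show ?thesis unfolding mcoup by (simp only: expectation_indicator_sing)
  qed
  have "(\<integral>\<^sup>+l. ennreal (sqrt (real n)) * wnorm W (\<lambda>x. pmf (emp (map snd l)) x - pmf p x - (pmf (emp (map fst l)) x - pmf r x))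
        \<partial>replicate_pmf n (mcoup r p))
    = (\<integral>\<^sup>+l. ennreal (sqrt (real n)) * wnorm W (\<lambda>x. sum_list (map (?\<phi> x) l) / real n - (\<integral>z. ?\<phi> x z \<partial>mcoup r p)) \<partial>replicate_pmf n (mcoup r p))"
  proof (rule nn_integral_cong_AE, rule AE_pmfI)
    fix l assume "l \<in> set_pmf (replicate_pmf n (mcoup r p))"
    then have l: "length l = n" by (simp add: set_replicate_pmf)
    show "ennreal (sqrt (real n)) * wnorm W (\<lambda>x. pmf (emp (map snd l)) x - pmf p x - (pmf (emp (map fst l)) x - pmf r x))
      = ennreal (sqrt (real n)) * wnorm W (\<lambda>x. sum_list (map (?\<phi> x) l) / real n - (\<integral>z. ?\<phi> x z \<partial>mcoup r p))"
      unfolding \<mu> using n l by (simp add: pmf_emp sum_list_subtractf o_def diff_divide_distrib algebra_simps)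
  qed
  also have "\<dots> \<le> (\<integral>\<^sup>+x. ennreal (W x * sqrt (\<integral>z. (?\<phi> x z)\<^sup>2 \<partial>mcoup r p)) \<partial>count_space UNIV)"
    by (rule replicate_wnorm_deviation[where B=1, OF _ n W]) (auto simp: indicator_def)
  finally show ?thesis by (simp only: mcoup)
qed

text \<open>Dominated convergence over the points \<open>x\<close>: one bound of order
  \<open>sqrt (pmf r x)\<close> is summable against the weight, another tends to zero at each
  point.\<close>

lemma emp_sqrt_deviation:
  fixes r :: "'x::countable pmf"
  assumes C: "\<And>x. 0 \<le> C x" and fin: "(\<integral>\<^sup>+x. ennreal (C x * sqrt (pmf r x)) \<partial>count_space UNIV) < \<infinity>"
  shows "(\<lambda>n. \<integral>\<^sup>+l. \<integral>\<^sup>+x. ennreal (C x * sqrt \<bar>pmf r x - pmf (emp l) x\<bar>) \<partial>count_space UNIV \<partial>replicate_pmf (Suc n) r) \<longlonglongrightarrow> 0"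
proof -
  define d where "d n x = (\<integral>\<^sup>+l. ennreal (sqrt \<bar>pmf r x - pmf (emp l) x\<bar>) \<partial>replicate_pmf (Suc n) r)" for n x
  have len: "length l = Suc n" if "l \<in> set_pmf (replicate_pmf (Suc n) r)" for l n
    using that by (auto simp: set_replicate_pmf)
  \<comment> \<open>The bound vanishes as \<open>n\<close> grows, but it contains the fourth root of
    \<open>pmf r x\<close>, which need not be summable against the weight; hence the second
    bound.\<close>
  have 1: "d n x \<le> ennreal (sqrt (sqrt (pmf r x) / sqrt (real (Suc n))))" for n x
    unfolding d_def
  proof (rule nn_integral_sqrt_le)
    have "(\<integral>\<^sup>+l. ennreal \<bar>pmf r x - pmf (emp l) x\<bar> \<partial>replicate_pmf (Suc n) r)
      = (\<integral>\<^sup>+l. ennreal (1 / sqrt (real (Suc n))) * ennreal (sqrt (real (Suc n)) * \<bar>sum_list (map (indicator {x}) l) / real (Suc n) - (\<integral>z. indicator {x} z \<partial>r)\<bar>) \<partial>replicate_pmf (Suc n) r)"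
      by (rule nn_integral_cong_AE, rule AE_pmfI)
        (simp add: len pmf_emp measure_pmf_single ennreal_mult[symmetric] abs_minus_commute del: of_nat_Suc)
    also have "\<dots> = ennreal (1 / sqrt (real (Suc n))) * (\<integral>\<^sup>+l. ennreal (sqrt (real (Suc n)) * \<bar>sum_list (map (indicator {x}) l) / real (Suc n) - (\<integral>z. indicator {x} z \<partial>r)\<bar>) \<partial>replicate_pmf (Suc n) r)"
      by (rule nn_integral_cmult) simp
    also have "\<dots> \<le> ennreal (1 / sqrt (real (Suc n))) * ennreal (sqrt (\<integral>z. (indicator {x} z)\<^sup>2 \<partial>r))"
      by (intro mult_left_mono replicate_mean_deviation[where B=1]) (auto simp: indicator_def)
    also have "(\<lambda>z. (indicator {x} z :: real)\<^sup>2) = indicator {x}" by (auto simp: indicator_def)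
    finally show "(\<integral>\<^sup>+l. ennreal \<bar>pmf r x - pmf (emp l) x\<bar> \<partial>replicate_pmf (Suc n) r) \<le> ennreal (sqrt (pmf r x) / sqrt (real (Suc n)))"
      by (simp only: expectation_indicator_sing) (simp add: ennreal_mult[symmetric] del: of_nat_Suc)
  qed simp
  have 2: "d n x \<le> ennreal (sqrt (2 * pmf r x))" for n x
    unfolding d_def
  proof (rule nn_integral_sqrt_le)
    have "(\<integral>\<^sup>+l. ennreal \<bar>pmf r x - pmf (emp l) x\<bar> \<partial>replicate_pmf (Suc n) r)
      \<le> (\<integral>\<^sup>+l. ennreal (pmf r x) + ennreal (1 / real (Suc n)) * ennreal (sum_list (map (indicator {x}) l)) \<partial>replicate_pmf (Suc n) r)"
    proof (rule nn_integral_mono_AE, rule AE_pmfI)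
      fix l assume "l \<in> set_pmf (replicate_pmf (Suc n) r)"
      then have l: "length l = Suc n" by (rule len)
      have s: "0 \<le> sum_list (map (indicator {x} :: 'x \<Rightarrow> real) l)" by (rule sum_list_nonneg) auto
      have "pmf (emp l) x = (1 / real (Suc n)) * sum_list (map (indicator {x}) l)" by (simp add: pmf_emp l)
      then have "\<bar>pmf r x - pmf (emp l) x\<bar> \<le> pmf r x + (1 / real (Suc n)) * sum_list (map (indicator {x}) l)"
        using pmf_nonneg[of r x] pmf_nonneg[of "emp l" x] by linarith
      then show "ennreal \<bar>pmf r x - pmf (emp l) x\<bar> \<le> ennreal (pmf r x) + ennreal (1 / real (Suc n)) * ennreal (sum_list (map (indicator {x}) l))"
        using s by (simp add: ennreal_mult[symmetric] ennreal_plus[symmetric] del: ennreal_plus of_nat_Suc)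
    qed
    also have "\<dots> = ennreal (pmf r x) + ennreal (1 / real (Suc n)) * (of_nat (Suc n) * ennreal (pmf r x))"
      by (simp add: nn_integral_add nn_integral_cmult replicate_sum_nn emeasure_pmf_single ennreal_indicator
          del: of_nat_Suc replicate_pmf.simps)
    also have "\<dots> = ennreal (2 * pmf r x)"
      by (simp add: ennreal_of_nat_eq_real_of_nat ennreal_mult[symmetric] ennreal_plus[symmetric] del: ennreal_plus of_nat_Suc)
    finally show "(\<integral>\<^sup>+l. ennreal \<bar>pmf r x - pmf (emp l) x\<bar> \<partial>replicate_pmf (Suc n) r) \<le> ennreal (2 * pmf r x)" .
  qed simp
  have eq: "(\<integral>\<^sup>+l. \<integral>\<^sup>+x. ennreal (C x * sqrt \<bar>pmf r x - pmf (emp l) x\<bar>) \<partial>count_space UNIV \<partial>replicate_pmf (Suc n) r)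
     = (\<integral>\<^sup>+x. ennreal (C x) * d n x \<partial>count_space UNIV)" for n
    unfolding d_def
    by (subst nn_integral_count_space_nn_integral)
      (auto simp: nn_integral_cmult[symmetric] ennreal_mult[symmetric] C simp del: replicate_pmf.simps)
  have "(\<lambda>n. \<integral>\<^sup>+x. ennreal (C x) * d n x \<partial>count_space UNIV) \<longlonglongrightarrow> nn_integral (count_space UNIV) (\<lambda>_::'x. 0)"
  proof (rule nn_integral_dominated_convergence[where w="\<lambda>x. ennreal (sqrt 2) * ennreal (C x * sqrt (pmf r x))"])
    show "AE x in count_space UNIV. ennreal (C x) * d n x \<le> ennreal (sqrt 2) * ennreal (C x * sqrt (pmf r x))" for n
    proof (rule AE_I2)
      fix x
      have "ennreal (C x) * d n x \<le> ennreal (C x) * ennreal (sqrt (2 * pmf r x))" by (intro mult_left_mono 2) simp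
      also have "\<dots> = ennreal (sqrt 2) * ennreal (C x * sqrt (pmf r x))"
        by (simp add: ennreal_mult[symmetric] C real_sqrt_mult mult_ac)
      finally show "ennreal (C x) * d n x \<le> ennreal (sqrt 2) * ennreal (C x * sqrt (pmf r x))" .
    qed
    show "(\<integral>\<^sup>+x. ennreal (sqrt 2) * ennreal (C x * sqrt (pmf r x)) \<partial>count_space UNIV) < \<infinity>"
      using fin by (simp add: nn_integral_cmult ennreal_mult_less_top)
    show "AE x in count_space UNIV. (\<lambda>n. ennreal (C x) * d n x) \<longlonglongrightarrow> 0"
    proof (rule AE_I2)
      fix x
      have "(\<lambda>n. sqrt (sqrt (pmf r x) / sqrt (real (Suc n)))) \<longlonglongrightarrow> sqrt 0"
        by (intro tendsto_real_sqrt real_tendsto_divide_at_top[OF tendsto_const]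
            filterlim_compose[OF sqrt_at_top] filterlim_compose[OF filterlim_real_sequentially] filterlim_Suc)
      then have "(\<lambda>n. ennreal (C x) * ennreal (sqrt (sqrt (pmf r x) / sqrt (real (Suc n))))) \<longlonglongrightarrow> ennreal (C x) * ennreal (sqrt 0)"
        by (intro ennreal_tendsto_cmult tendsto_ennrealI) simp_all
      then show "(\<lambda>n. ennreal (C x) * d n x) \<longlonglongrightarrow> 0"
        by (intro tendsto_sandwich[OF _ _ tendsto_const, of _ "\<lambda>n. ennreal (C x) * d n x" _ "\<lambda>n. ennreal (C x) * ennreal (sqrt (sqrt (pmf r x) / sqrt (real (Suc n))))"])
          (auto intro!: always_eventually mult_left_mono 1 simp del: of_nat_Suc)
    qed
  qed auto
  then show ?thesis unfolding eq by simp
qed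

lemma wnorm_triangle:
  assumes "\<And>x. 0 \<le> W x"
  shows "wnorm W (\<lambda>x. a x + b x) \<le> wnorm W a + wnorm W b"
proof -
  have "wnorm W (\<lambda>x. a x + b x) \<le> (\<integral>\<^sup>+x. ennreal (W x * \<bar>a x\<bar>) + ennreal (W x * \<bar>b x\<bar>) \<partial>count_space UNIV)"
    unfolding wnorm_def
  proof (rule nn_integral_mono)
    fix x
    have "W x * \<bar>a x + b x\<bar> \<le> W x * \<bar>a x\<bar> + W x * \<bar>b x\<bar>"
      unfolding distrib_left[symmetric] by (rule mult_left_mono[OF abs_triangle_ineq assms])
    then show "ennreal (W x * \<bar>a x + b x\<bar>) \<le> ennreal (W x * \<bar>a x\<bar>) + ennreal (W x * \<bar>b x\<bar>)"
      using assms by (simp add: ennreal_plus[symmetric] ennreal_leI del: ennreal_plus)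
  qed
  also have "\<dots> = wnorm W a + wnorm W b" unfolding wnorm_def by (rule nn_integral_add) auto
  finally show ?thesis .
qed

text \<open>Expresses the distance of the bootstrap measure \<open>p4\<close> from \<open>r\<close>
  through the four-point difference, so that its own fluctuation never needs a separate
  estimate.\<close>

lemma wdist_four_point:
  assumes "\<And>x. 0 \<le> W x"
  shows "wdist W p4 r \<le> wnorm W (\<lambda>x. pmf p4 x - pmf p3 x - (pmf p2 x - pmf r x)) + wdist W p2 r + wdist W p3 r"
proof -
  let ?\<Delta> = "\<lambda>x. pmf p4 x - pmf p3 x - (pmf p2 x - pmf r x)"
  have "wdist W p4 r = wnorm W (\<lambda>x. (?\<Delta> x + (pmf p2 x - pmf r x)) + (pmf p3 x - pmf r x))"
    by (rule arg_cong[where f="wnorm W"]) (simp add: fun_eq_iff)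
  also have "\<dots> \<le> wnorm W (\<lambda>x. ?\<Delta> x + (pmf p2 x - pmf r x)) + wdist W p3 r"
    by (rule wnorm_triangle[OF assms])
  also have "\<dots> \<le> (wnorm W ?\<Delta> + wdist W p2 r) + wdist W p3 r"
    by (intro add_right_mono wnorm_triangle assms)
  finally show ?thesis .
qed

text \<open>The data \<open>l\<close> are fixed and the coupled resample is averaged out. Truncation
  at 2 is legitimate because test functions are bounded by 1, and it makes the event of large
  distances harmless.\<close>

definition coupled_error :: "('x pmf \<Rightarrow> 'x pmf \<Rightarrow> 'x pmf \<Rightarrow> real) \<Rightarrow> 'x pmf \<Rightarrow> nat \<Rightarrow> 'x list \<Rightarrow> ennreal" where
  "coupled_error D r n l = (\<integral>\<^sup>+p. ennreal (min 2 (sqrt (real n) * D (emp (map fst p)) (emp l) (emp (map snd p))))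
     \<partial>replicate_pmf n (mcoup r (emp l)))"

text \<open>Where all three distances are at most \<open>\<delta>\<close> the approximation applies;
  elsewhere the truncation value 2 is at most \<open>2 / \<delta>\<close> times the sum of the
  distances, as in Markov's inequality. What remains are means of weighted deviations that are
  already bounded.\<close>

lemma coupled_error_tendsto:
  fixes r :: "'x::countable pmf"
  assumes C: "\<And>x. 0 \<le> C x" and fin: "(\<integral>\<^sup>+x. ennreal (C x * sqrt (pmf r x)) \<partial>count_space UNIV) < \<infinity>"
    and approx: "four_point_approx C r D"
  shows "(\<lambda>n. \<integral>\<^sup>+l. coupled_error D r (Suc n) l \<partial>replicate_pmf (Suc n) r) \<longlonglongrightarrow> 0"
proof -
  define I where "I n = (\<integral>\<^sup>+l. coupled_error D r (Suc n) l \<partial>replicate_pmf (Suc n) r)" for n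
  define e where "e n = (\<integral>\<^sup>+l. \<integral>\<^sup>+x. ennreal (C x * sqrt \<bar>pmf r x - pmf (emp l) x\<bar>) \<partial>count_space UNIV \<partial>replicate_pmf (Suc n) r)" for n
  define Q where "Q = (\<integral>\<^sup>+x. ennreal (C x * sqrt (pmf r x)) \<partial>count_space UNIV)"
  have e0: "e \<longlonglongrightarrow> 0" unfolding e_def by (rule emp_sqrt_deviation[OF C fin])
  from approx obtain K where K: "0 \<le> K" and ap: "\<And>\<epsilon>. 0 < \<epsilon> \<Longrightarrow> \<exists>\<delta>>0. \<exists>W.
      (\<forall>x. 0 \<le> W x \<and> W x \<le> K * C x) \<and>
      (\<integral>\<^sup>+x. ennreal (W x * sqrt (pmf r x)) \<partial>count_space UNIV) \<le> ennreal \<epsilon> \<and>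
      (\<forall>p2 p3 p4. wdist C p2 r \<le> ennreal \<delta> \<longrightarrow> wdist C p3 r \<le> ennreal \<delta> \<longrightarrow> wdist C p4 r \<le> ennreal \<delta> \<longrightarrow>
        ennreal (D p2 p3 p4) \<le> ennreal K * wnorm C (\<lambda>x. pmf p4 x - pmf p3 x - (pmf p2 x - pmf r x))
          + (wdist W p2 r + wdist W p3 r + wdist W p4 r))"
    unfolding four_point_approx_def by blast
  have bound: "\<exists>\<delta>>0. \<forall>n. I n \<le> (ennreal (2 * K) + ennreal (2 / (\<delta> * sqrt (real (Suc n))))) * e n
      + ennreal (4 * \<epsilon>) + ennreal (2 / (\<delta> * sqrt (real (Suc n)))) * (4 * Q)" if \<epsilon>: "0 < \<epsilon>" for \<epsilon>
  proof -
    from ap[OF \<epsilon>] obtain \<delta> W where \<delta>: "0 < \<delta>" and W: "\<And>x. 0 \<le> W x" "\<And>x. W x \<le> K * C x"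
      and We: "(\<integral>\<^sup>+x. ennreal (W x * sqrt (pmf r x)) \<partial>count_space UNIV) \<le> ennreal \<epsilon>"
      and D: "\<And>p2 p3 p4. wdist C p2 r \<le> ennreal \<delta> \<Longrightarrow> wdist C p3 r \<le> ennreal \<delta> \<Longrightarrow> wdist C p4 r \<le> ennreal \<delta> \<Longrightarrow>
        ennreal (D p2 p3 p4) \<le> ennreal K * wnorm C (\<lambda>x. pmf p4 x - pmf p3 x - (pmf p2 x - pmf r x))
          + (wdist W p2 r + wdist W p3 r + wdist W p4 r)" by blast
    have "I n \<le> (ennreal (2 * K) + ennreal (2 / (\<delta> * sqrt (real (Suc n))))) * e n
      + ennreal (4 * \<epsilon>) + ennreal (2 / (\<delta> * sqrt (real (Suc n)))) * (4 * Q)" for n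
    proof -
      define s where "s = ennreal (sqrt (real (Suc n)))"
      define k where "k = ennreal (2 / (\<delta> * sqrt (real (Suc n))))"
      let ?E = "\<lambda>V p2 p3 p4. wnorm V (\<lambda>x. pmf p4 x - pmf p3 x - (pmf p2 x - pmf r x))"
      have ks: "k * s = ennreal (2 / \<delta>)"
        using \<delta> by (simp add: k_def s_def ennreal_mult[symmetric] del: of_nat_Suc)
      have pw: "ennreal (min 2 (sqrt (real (Suc n)) * D p2 p3 p4))
        \<le> (ennreal (2 * K) + k) * (s * ?E C p2 p3 p4) + (2 * (s * wdist W p2 r) + 2 * (s * wdist W p3 r))
          + k * (2 * (s * wdist C p2 r) + 2 * (s * wdist C p3 r))" (is "_ \<le> ?R") for p2 p3 p4
      proof (cases "wdist C p2 r \<le> ennreal \<delta> \<and> wdist C p3 r \<le> ennreal \<delta> \<and> wdist C p4 r \<le> ennreal \<delta>")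
        case True
        have EW: "?E W p2 p3 p4 \<le> ennreal K * ?E C p2 p3 p4"
          unfolding wnorm_cmult[OF K, symmetric] by (rule wnorm_mono) (use W in \<open>auto intro: mult_right_mono\<close>)
        have "ennreal (min 2 (sqrt (real (Suc n)) * D p2 p3 p4)) \<le> s * ennreal (D p2 p3 p4)"
        proof (cases "0 \<le> D p2 p3 p4")
          case True
          then show ?thesis unfolding s_def by (subst ennreal_mult[symmetric]) (auto intro!: ennreal_leI)
        next
          case False
          then have "min 2 (sqrt (real (Suc n)) * D p2 p3 p4) \<le> 0"
            using mult_nonneg_nonpos[of "sqrt (real (Suc n))" "D p2 p3 p4"] by simp
          then show ?thesis by (simp add: ennreal_neg)
        qed
        also have "\<dots> \<le> s * (ennreal K * ?E C p2 p3 p4 + (wdist W p2 r + wdist W p3 r + (?E W p2 p3 p4 + wdist W p2 r + wdist W p3 r)))"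
          by (rule mult_left_mono[OF order_trans[OF D]]; (intro add_left_mono wdist_four_point W(1))?)
            (use True in auto)
        also have "\<dots> \<le> s * (ennreal K * ?E C p2 p3 p4 + (wdist W p2 r + wdist W p3 r + (ennreal K * ?E C p2 p3 p4 + wdist W p2 r + wdist W p3 r)))"
          by (intro mult_left_mono add_left_mono add_right_mono EW) simp
        also have "\<dots> = ennreal (2 * K) * (s * ?E C p2 p3 p4) + (2 * (s * wdist W p2 r) + 2 * (s * wdist W p3 r))"
          using K by (simp add: ennreal_mult distrib_left distrib_right mult_ac mult_2 add_ac)
        also have "\<dots> \<le> ?R"
          by (intro order_trans[OF _ add_increasing2[OF _ order_refl]] add_right_mono mult_right_mono) auto
        finally show ?thesis .
      next
        case False
        have "wdist C p2 r \<le> wdist C p2 r + wdist C p3 r + wdist C p4 r"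
          "wdist C p3 r \<le> wdist C p2 r + wdist C p3 r + wdist C p4 r"
          "wdist C p4 r \<le> wdist C p2 r + wdist C p3 r + wdist C p4 r"
          by (intro add_increasing add_increasing2 order_refl zero_le)+
        then have "ennreal \<delta> \<le> wdist C p2 r + wdist C p3 r + wdist C p4 r"
          using False by (meson linear order_trans)
        also have "\<dots> \<le> wdist C p2 r + wdist C p3 r + (?E C p2 p3 p4 + wdist C p2 r + wdist C p3 r)"
          by (intro add_left_mono wdist_four_point C)
        also have "\<dots> = ?E C p2 p3 p4 + (2 * wdist C p2 r + 2 * wdist C p3 r)" by (simp add: mult_2 add_ac)
        finally have "ennreal (2 / \<delta>) * ennreal \<delta> \<le> ennreal (2 / \<delta>) * (?E C p2 p3 p4 + (2 * wdist C p2 r + 2 * wdist C p3 r))"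
          by (rule mult_left_mono) simp
        also have "ennreal (2 / \<delta>) * ennreal \<delta> = 2" using \<delta> by (simp add: ennreal_mult[symmetric])
        also have "ennreal (2 / \<delta>) * (?E C p2 p3 p4 + (2 * wdist C p2 r + 2 * wdist C p3 r))
          = k * (s * ?E C p2 p3 p4) + k * (2 * (s * wdist C p2 r) + 2 * (s * wdist C p3 r))"
          unfolding ks[symmetric] by (simp add: distrib_left mult_ac)
        also have "\<dots> \<le> ?R"
        proof -
          have "k * (s * ?E C p2 p3 p4) \<le> (ennreal (2 * K) + k) * (s * ?E C p2 p3 p4)"
            by (intro mult_right_mono add_increasing) auto
          then show ?thesis by (intro add_right_mono add_increasing2) auto
        qed
        finally have "2 \<le> ?R" .
        moreover have "ennreal (min 2 (sqrt (real (Suc n)) * D p2 p3 p4)) \<le> ennreal 2" by (intro ennreal_leI) simp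
        ultimately show ?thesis by (simp add: order_trans)
      qed
      let ?M = "\<lambda>l. replicate_pmf (Suc n) (mcoup r (emp l))"
      \<comment> \<open>The fresh sample has the law of a sample from \<open>r\<close> whatever the
        data are, so the mean of its deviation does not depend on \<open>l\<close>.\<close>
      have fst_law: "(\<integral>\<^sup>+p. F (map fst p) \<partial>?M l) = (\<integral>\<^sup>+l'. F l' \<partial>replicate_pmf (Suc n) r)" for F l
        by (subst (2) mcoup(1)[of r "emp l", symmetric], subst map_replicate_pmf[symmetric]) simp
      have dev: "(\<integral>\<^sup>+l. s * wdist V (emp l) r \<partial>replicate_pmf (Suc n) r) \<le> (\<integral>\<^sup>+x. ennreal (V x * sqrt (pmf r x)) \<partial>count_space UNIV)"
        if "\<And>x. 0 \<le> V x" for V unfolding s_def by (rule emp_deviation[OF _ that]) simp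
      have inner: "coupled_error D r (Suc n) l \<le>
          (ennreal (2 * K) + k) * (\<integral>\<^sup>+x. ennreal (C x * sqrt \<bar>pmf r x - pmf (emp l) x\<bar>) \<partial>count_space UNIV)
          + (2 * ennreal \<epsilon> + 2 * (s * wdist W (emp l) r)) + k * (2 * Q + 2 * (s * wdist C (emp l) r))" for l
      proof -
        have "coupled_error D r (Suc n) l \<le> (\<integral>\<^sup>+p. (ennreal (2 * K) + k) * (s * ?E C (emp (map fst p)) (emp l) (emp (map snd p)))
          + (2 * (s * wdist W (emp (map fst p)) r) + 2 * (s * wdist W (emp l) r))
          + k * (2 * (s * wdist C (emp (map fst p)) r) + 2 * (s * wdist C (emp l) r)) \<partial>?M l)"
          unfolding coupled_error_def by (intro nn_integral_mono pw)
        also have "\<dots> = (ennreal (2 * K) + k) * (\<integral>\<^sup>+p. s * ?E C (emp (map fst p)) (emp l) (emp (map snd p)) \<partial>?M l)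
          + (2 * (\<integral>\<^sup>+p. s * wdist W (emp (map fst p)) r \<partial>?M l) + 2 * (s * wdist W (emp l) r))
          + k * (2 * (\<integral>\<^sup>+p. s * wdist C (emp (map fst p)) r \<partial>?M l) + 2 * (s * wdist C (emp l) r))"
          by (simp add: nn_integral_add nn_integral_cmult del: replicate_pmf.simps)
        also have "\<dots> \<le> (ennreal (2 * K) + k) * (\<integral>\<^sup>+x. ennreal (C x * sqrt \<bar>pmf r x - pmf (emp l) x\<bar>) \<partial>count_space UNIV)
          + (2 * ennreal \<epsilon> + 2 * (s * wdist W (emp l) r)) + k * (2 * Q + 2 * (s * wdist C (emp l) r))"
          unfolding fst_law[where F="\<lambda>l'. s * wdist W (emp l') r"] fst_law[where F="\<lambda>l'. s * wdist C (emp l') r"]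
        proof (intro add_mono mult_left_mono order_refl)
          show "(\<integral>\<^sup>+p. s * ?E C (emp (map fst p)) (emp l) (emp (map snd p)) \<partial>?M l)
            \<le> (\<integral>\<^sup>+x. ennreal (C x * sqrt \<bar>pmf r x - pmf (emp l) x\<bar>) \<partial>count_space UNIV)"
            unfolding s_def by (rule coupled_deviation[OF _ C]) simp
          show "(\<integral>\<^sup>+l. s * wdist W (emp l) r \<partial>replicate_pmf (Suc n) r) \<le> ennreal \<epsilon>"
            by (rule order_trans[OF dev[OF W(1)] We])
          show "(\<integral>\<^sup>+l. s * wdist C (emp l) r \<partial>replicate_pmf (Suc n) r) \<le> Q"
            unfolding Q_def by (rule dev[OF C])
        qed auto
        finally show ?thesis .
      qed
      have "I n \<le> (\<integral>\<^sup>+l. (ennreal (2 * K) + k) * (\<integral>\<^sup>+x. ennreal (C x * sqrt \<bar>pmf r x - pmf (emp l) x\<bar>) \<partial>count_space UNIV)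
          + (2 * ennreal \<epsilon> + 2 * (s * wdist W (emp l) r)) + k * (2 * Q + 2 * (s * wdist C (emp l) r)) \<partial>replicate_pmf (Suc n) r)"
        unfolding I_def by (intro nn_integral_mono inner)
      also have "\<dots> = (ennreal (2 * K) + k) * e n
          + (2 * ennreal \<epsilon> + 2 * (\<integral>\<^sup>+l. s * wdist W (emp l) r \<partial>replicate_pmf (Suc n) r))
          + k * (2 * Q + 2 * (\<integral>\<^sup>+l. s * wdist C (emp l) r \<partial>replicate_pmf (Suc n) r))"
        unfolding e_def by (simp add: nn_integral_add nn_integral_cmult del: replicate_pmf.simps)
      also have "\<dots> \<le> (ennreal (2 * K) + k) * e n + (2 * ennreal \<epsilon> + 2 * ennreal \<epsilon>) + k * (2 * Q + 2 * Q)"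
      proof (intro add_mono mult_left_mono order_refl)
        show "(\<integral>\<^sup>+l. s * wdist W (emp l) r \<partial>replicate_pmf (Suc n) r) \<le> ennreal \<epsilon>"
          by (rule order_trans[OF dev[OF W(1)] We])
        show "(\<integral>\<^sup>+l. s * wdist C (emp l) r \<partial>replicate_pmf (Suc n) r) \<le> Q"
          unfolding Q_def by (rule dev[OF C])
      qed auto
      also have "2 * ennreal \<epsilon> + 2 * ennreal \<epsilon> = ennreal (4 * \<epsilon>)"
        using \<epsilon> by (simp add: ennreal_mult'' distrib_right[symmetric])
      also have "2 * Q + 2 * Q = 4 * Q" by (simp add: distrib_right[symmetric])
      finally show ?thesis by (simp only: k_def)
    qed
    with \<delta> show ?thesis by blast
  qed
  have Qfin: "Q < \<infinity>" using fin by (simp add: Q_def)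
  have "I \<longlonglongrightarrow> 0"
  proof (rule order_tendstoI)
    fix a :: ennreal assume "0 < a"
    then obtain b where b: "0 < b" "ennreal b < a"
      by (metis ennreal_cases ennreal_less_zero_iff dense less_top top_neq_ennreal order_less_trans)
    \<comment> \<open>The terms with \<open>e n\<close> and \<open>Q\<close> vanish in the limit,
      and what is left is \<open>4 * (b / 8) = b / 2\<close>, strictly below
      \<open>a\<close>.\<close>
    from bound[of "b / 8"] b obtain \<delta> where \<delta>: "0 < \<delta>"
      "\<And>n. I n \<le> (ennreal (2 * K) + ennreal (2 / (\<delta> * sqrt (real (Suc n))))) * e n
      + ennreal (4 * (b / 8)) + ennreal (2 / (\<delta> * sqrt (real (Suc n)))) * (4 * Q)" by auto
    have k0: "(\<lambda>n. ennreal (2 / (\<delta> * sqrt (real (Suc n))))) \<longlonglongrightarrow> ennreal 0"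
      by (intro tendsto_ennrealI real_tendsto_divide_at_top[OF tendsto_const] filterlim_tendsto_pos_mult_at_top[OF tendsto_const \<delta>(1)]
            filterlim_compose[OF sqrt_at_top] filterlim_compose[OF filterlim_real_sequentially] filterlim_Suc)
    have "(\<lambda>n. (ennreal (2 * K) + ennreal (2 / (\<delta> * sqrt (real (Suc n))))) * e n
      + ennreal (4 * (b / 8)) + ennreal (2 / (\<delta> * sqrt (real (Suc n)))) * (4 * Q))
      \<longlonglongrightarrow> (ennreal (2 * K) + ennreal 0) * 0 + ennreal (4 * (b / 8)) + ennreal 0 * (4 * Q)"
      by (intro tendsto_add tendsto_mult_ennreal k0 e0 tendsto_const)
        (use Qfin in \<open>auto simp: ennreal_mult_eq_top_iff\<close>)
    then have lim: "(\<lambda>n. (ennreal (2 * K) + ennreal (2 / (\<delta> * sqrt (real (Suc n))))) * e n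
      + ennreal (4 * (b / 8)) + ennreal (2 / (\<delta> * sqrt (real (Suc n)))) * (4 * Q)) \<longlonglongrightarrow> ennreal (b / 2)"
      by (simp del: of_nat_Suc)
    have "ennreal (b / 2) < a" using b by (intro le_less_trans[OF _ b(2)] ennreal_leI) simp
    from order_tendstoD(2)[OF lim this] show "\<forall>\<^sub>F n in sequentially. I n < a"
      by (rule eventually_mono) (rule le_less_trans[OF \<delta>(2)])
  qed simp
  then show ?thesis unfolding I_def .
qed

section \<open>Conditional expectations given a discrete sample\<close>

lemma pmf_replicate_pmf:
  "pmf (replicate_pmf n q) l = (if length l = n then \<Prod>i<n. pmf q (l ! i) else 0)"
proof (induction n arbitrary: l)
  case (Suc n)
  have inj: "inj (\<lambda>(x, xs). x # xs)" by (auto simp: inj_def)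
  show ?case
  proof (cases l)
    case Nil
    have "l \<notin> set_pmf (replicate_pmf (Suc n) q)" using Nil by (simp add: set_replicate_pmf del: replicate_pmf.simps)
    then show ?thesis using Nil by (simp add: set_pmf_iff del: replicate_pmf.simps)
  next
    case (Cons x xs)
    have "pmf (replicate_pmf (Suc n) q) l = pmf (pair_pmf q (replicate_pmf n q)) (x, xs)"
      unfolding replicate_pmf_Suc_pair using pmf_map_inj'[OF inj, of _ "(x, xs)"] Cons by simp
    then show ?thesis using Cons by (simp add: pmf_pair Suc prod.lessThan_Suc_shift del: prod.lessThan_Suc)
  qed
qed (simp add: indicator_def)

lemma empirical_emp: "0 < n \<Longrightarrow> empirical n x = emp (map x [0..<n])"
proof -
  assume "0 < n"
  then have s: "set_pmf (pmf_of_set {..<n}) = {..<n}" by (intro set_pmf_of_set) auto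
  show ?thesis unfolding emp_def empirical_def length_map length_upt diff_zero
  proof (rule map_pmf_cong[OF refl])
    fix i assume "i \<in> set_pmf (pmf_of_set {..<n})"
    then show "x i = map x [0..<n] ! i" unfolding s by simp
  qed
qed

lemma map_upt_eq_iff: "map f [0..<n] = l \<longleftrightarrow> length l = n \<and> (\<forall>i<n. f i = l ! i)"
proof
  assume "length l = n \<and> (\<forall>i<n. f i = l ! i)"
  then show "map f [0..<n] = l" by (intro nth_equalityI) auto
qed auto

lemma measurable_sample_list:
  fixes Y :: "nat \<Rightarrow> 'w \<Rightarrow> 'x::countable"
  assumes "\<And>i. i < n \<Longrightarrow> Y i \<in> M \<rightarrow>\<^sub>M count_space UNIV"
  shows "(\<lambda>\<omega>. map (\<lambda>i. Y i \<omega>) [0..<n]) \<in> M \<rightarrow>\<^sub>M count_space UNIV"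
proof (rule measurable_count_space_eq2_countable[THEN iffD2], intro conjI ballI)
  fix l :: "'x list"
  have e: "(\<lambda>\<omega>. map (\<lambda>i. Y i \<omega>) [0..<n]) -` {l} \<inter> space M
      = (if length l = n then {\<omega>\<in>space M. \<forall>i\<in>{..<n}. Y i \<omega> = l ! i} else {})"
    by (auto simp: map_upt_eq_iff)
  have "{\<omega>\<in>space M. Y i \<omega> = a} \<in> sets M" if "i < n" for i a
    using measurable_sets[OF assms[OF that], of "{a}"] by (simp add: vimage_def Int_def conj_commute)
  then have "{\<omega>\<in>space M. \<forall>i\<in>{..<n}. Y i \<omega> = l ! i} \<in> sets M"
    by (intro sets.sets_Collect_finite_All) auto
  then show "(\<lambda>\<omega>. map (\<lambda>i. Y i \<omega>) [0..<n]) -` {l} \<inter> space M \<in> sets M" unfolding e by simp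
qed auto

text \<open>One sample size with one bootstrap sample; the limit in \<open>n\<close> is taken
  outside, by interpreting the locale anew for each size.\<close>

locale bootstrap_sampling = prob_space M
  for M :: "'w measure" and X :: "nat \<Rightarrow> 'w \<Rightarrow> 'x::countable" and Z :: "nat \<Rightarrow> 'w \<Rightarrow> 'x"
    and r :: "'x pmf" and n :: nat +
  assumes iid: "iid_sample M X r" and boot: "bootstrap_sample M X n Z" and n_pos: "0 < n"
begin

definition Lx :: "'w \<Rightarrow> 'x list" where "Lx \<omega> = map (\<lambda>i. X i \<omega>) [0..<n]"
definition Lz :: "'w \<Rightarrow> 'x list" where "Lz \<omega> = map (\<lambda>i. Z i \<omega>) [0..<n]"
abbreviation "F \<equiv> sample_algebra M X n"

lemma X_meas [measurable]: "X i \<in> M \<rightarrow>\<^sub>M count_space UNIV"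
  using iid by (auto simp: iid_sample_def indep_vars_def)

lemma Lx_meas [measurable]: "Lx \<in> M \<rightarrow>\<^sub>M count_space UNIV"
  unfolding Lx_def by (rule measurable_sample_list) simp

lemma Lz_meas [measurable]: "Lz \<in> M \<rightarrow>\<^sub>M count_space UNIV"
  unfolding Lz_def by (rule measurable_sample_list) (use boot in \<open>simp add: bootstrap_sample_def\<close>)

lemma atom_sets [measurable]: "{\<omega>\<in>space M. Lx \<omega> = l} \<in> sets M" "{\<omega>\<in>space M. Lz \<omega> = l} \<in> sets M"
  using measurable_sets[OF Lx_meas, of "{l}"] measurable_sets[OF Lz_meas, of "{l}"]
  by (simp_all add: vimage_def Int_def conj_commute)

lemma prob_Lx: "prob {\<omega>\<in>space M. Lx \<omega> = l} = pmf (replicate_pmf n r) l"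
proof (cases "length l = n")
  case True
  have "{\<omega>\<in>space M. Lx \<omega> = l} = (\<Inter>i\<in>{..<n}. X i -` {l ! i} \<inter> space M)"
    using n_pos True by (auto simp: Lx_def map_upt_eq_iff)
  also have "prob \<dots> = (\<Prod>i<n. prob (X i -` {l ! i} \<inter> space M))"
    using iid n_pos by (intro indep_varsD[where I=UNIV and M'="\<lambda>_. count_space UNIV"]) (auto simp: iid_sample_def)
  also have "\<dots> = (\<Prod>i<n. pmf r (l ! i))"
  proof (rule prod.cong[OF refl])
    fix i
    have "prob (X i -` {l ! i} \<inter> space M) = measure (distr M (count_space UNIV) (X i)) {l ! i}"
      by (simp add: measure_distr)
    then show "prob (X i -` {l ! i} \<inter> space M) = pmf r (l ! i)"
      using iid by (simp add: iid_sample_def measure_pmf_single)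
  qed
  finally show ?thesis using True by (simp add: pmf_replicate_pmf)
next
  case False
  then have e: "{\<omega>\<in>space M. Lx \<omega> = l} = {}" by (auto simp: Lx_def)
  show ?thesis unfolding e using False by (simp add: pmf_replicate_pmf)
qed

lemma distr_Lx: "distr M (count_space UNIV) Lx = measure_pmf (replicate_pmf n r)"
proof (rule measure_eqI_countable[of _ UNIV])
  fix l
  have "emeasure (distr M (count_space UNIV) Lx) {l} = emeasure M {\<omega>\<in>space M. Lx \<omega> = l}"
    by (simp add: emeasure_distr vimage_def Int_def conj_commute)
  also have "\<dots> = emeasure (measure_pmf (replicate_pmf n r)) {l}"
    by (simp add: emeasure_eq_measure prob_Lx emeasure_pmf_single)
  finally show "emeasure (distr M (count_space UNIV) Lx) {l} = emeasure (measure_pmf (replicate_pmf n r)) {l}" .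
qed auto

section \<open>The sample sigma-algebra and its atoms\<close>

definition Tx :: "'w \<Rightarrow> nat \<Rightarrow> 'x" where "Tx \<omega> = (\<lambda>i\<in>{..<n}. X i \<omega>)"
abbreviation "P \<equiv> \<Pi>\<^sub>M i\<in>{..<n}. count_space (UNIV :: 'x set)"

lemma Tx_meas: "Tx \<in> M \<rightarrow>\<^sub>M P"
  unfolding Tx_def by (rule measurable_restrict) simp

lemma F_eq: "F = vimage_algebra (space M) Tx P"
  by (simp add: sample_algebra_def Tx_def[abs_def])

lemma sets_F: "sets F = {Tx -` A \<inter> space M | A. A \<in> sets P}"
  unfolding F_eq by (rule sets_vimage_algebra2) (auto simp: Tx_def space_PiM)

lemma space_F: "space F = space M" by (simp add: F_eq)

lemma subalgebra_F: "subalgebra M F"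
  unfolding subalgebra_def space_F sets_F using measurable_sets[OF Tx_meas] by auto

sublocale finite_measure_subalgebra M F
  by unfold_locales (rule subalgebra_F)

lemma Tx_eq_iff: "Tx \<omega> = Tx \<omega>' \<longleftrightarrow> Lx \<omega> = Lx \<omega>'"
  by (simp add: Tx_def Lx_def fun_eq_iff restrict_def map_upt_eq_iff) auto

lemma atom_F: "{\<omega>\<in>space M. Lx \<omega> = Lx \<omega>0} \<in> sets F"
proof -
  have "{Tx \<omega>0} = PiE {..<n} (\<lambda>i. {Tx \<omega>0 i})"
    by (rule PiE_singleton[symmetric]) (simp add: Tx_def)
  also have "\<dots> \<in> sets P" by (rule sets_PiM_I_finite) auto
  finally have "Tx -` {Tx \<omega>0} \<inter> space M \<in> sets F" unfolding sets_F by blast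
  also have "Tx -` {Tx \<omega>0} \<inter> space M = {\<omega>\<in>space M. Lx \<omega> = Lx \<omega>0}"
    using Tx_eq_iff by auto
  finally show ?thesis .
qed

text \<open>Sets of the sample sigma-algebra are preimages under \<open>Tx\<close>, and
  \<open>Tx\<close> and the list \<open>Lx\<close> separate the same points.\<close>

lemma F_measurable_const:
  fixes u :: "'w \<Rightarrow> real"
  assumes u: "u \<in> borel_measurable F" and w: "\<omega> \<in> space M" "\<omega>' \<in> space M" "Lx \<omega> = Lx \<omega>'"
  shows "u \<omega> = u \<omega>'"
proof -
  have "u -` {u \<omega>} \<inter> space F \<in> sets F" by (rule measurable_sets[OF u]) simp
  then obtain A where "u -` {u \<omega>} \<inter> space M = Tx -` A \<inter> space M" unfolding space_F sets_F by blast
  moreover have "Tx \<omega> = Tx \<omega>'" using w(3) by (simp add: Tx_eq_iff)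
  ultimately have "\<omega>' \<in> u -` {u \<omega>} \<inter> space M" using w by (metis IntD1 IntI vimageE vimageI singletonI)
  then show ?thesis by simp
qed

text \<open>Integration over an atom, on which the conditional expectation is constant.\<close>

lemma cond_exp_atom:
  fixes g :: "'w \<Rightarrow> real"
  assumes g: "integrable M g" and w: "\<omega> \<in> space M"
  shows "(\<integral>\<omega>'. indicator {\<omega>'\<in>space M. Lx \<omega>' = Lx \<omega>} \<omega>' * g \<omega>' \<partial>M)
    = prob {\<omega>'\<in>space M. Lx \<omega>' = Lx \<omega>} * real_cond_exp M F g \<omega>"
proof -
  let ?A = "{\<omega>'\<in>space M. Lx \<omega>' = Lx \<omega>}"
  have "(\<integral>\<omega>'. indicator ?A \<omega>' * g \<omega>' \<partial>M) = (\<integral>\<omega>'. indicator ?A \<omega>' * real_cond_exp M F g \<omega>' \<partial>M)"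
    using real_cond_exp_intA[OF g atom_F[of \<omega>]] by (simp add: set_lebesgue_integral_def)
  also have "\<dots> = (\<integral>\<omega>'. indicator ?A \<omega>' * real_cond_exp M F g \<omega> \<partial>M)"
    by (rule Bochner_Integration.integral_cong)
      (use F_measurable_const[where u="real_cond_exp M F g", OF borel_measurable_cond_exp w] in \<open>auto simp: indicator_def\<close>)
  also have "\<dots> = prob ?A * real_cond_exp M F g \<omega>" by simp
  finally show ?thesis .
qed

text \<open>The almost sure description of the bootstrap probabilities is integrated over one atom,
  where the product of empirical masses is constant; exceptional null sets disappear in the
  integral.\<close>

lemma prob_Lx_Lz:
  assumes w: "\<omega> \<in> space M"
  shows "prob {\<omega>'\<in>space M. Lx \<omega>' = Lx \<omega> \<and> Lz \<omega>' = z}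
    = prob {\<omega>'\<in>space M. Lx \<omega>' = Lx \<omega>} * pmf (replicate_pmf n (emp (Lx \<omega>))) z"
proof (cases "length z = n")
  case True
  define A where "A = {\<omega>'\<in>space M. Lx \<omega>' = Lx \<omega>}"
  define E where "E = {\<omega>'\<in>space M. \<forall>i<n. Z i \<omega>' = z ! i}"
  have E: "E = {\<omega>'\<in>space M. Lz \<omega>' = z}" unfolding E_def Lz_def map_upt_eq_iff using True by simp
  have Es [measurable]: "E \<in> sets M" unfolding E by (rule atom_sets)
  have AF: "A \<in> sets F" unfolding A_def by (rule atom_F)
  have As [measurable]: "A \<in> sets M" unfolding A_def by (rule atom_sets)
  have sub: "A \<inter> space M = A" by (auto simp: A_def)
  have Ei: "integrable M (indicator E :: _ \<Rightarrow> real)" by (rule integrable_const_bound[where B=1]) auto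
  have "prob {\<omega>'\<in>space M. Lx \<omega>' = Lx \<omega> \<and> Lz \<omega>' = z} = prob ((A \<inter> E) \<inter> space M)"
    unfolding E A_def by (rule arg_cong[of _ _ prob]) blast
  also have "\<dots> = (\<integral>\<omega>'. indicator (A \<inter> E) \<omega>' \<partial>M)"
    by (rule Bochner_Integration.integral_indicator[symmetric])
  also have "\<dots> = (\<integral>\<omega>'\<in>A. indicator E \<omega>' \<partial>M)"
    unfolding set_lebesgue_integral_def by (rule Bochner_Integration.integral_cong) (auto simp: indicator_def)
  also have "\<dots> = (\<integral>\<omega>'\<in>A. real_cond_exp M F (indicator E) \<omega>' \<partial>M)"
    by (rule real_cond_exp_intA[OF Ei AF])
  also have "\<dots> = (\<integral>\<omega>'. indicator A \<omega>' * (\<Prod>i<n. pmf (emp (Lx \<omega>)) (z ! i)) \<partial>M)"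
    unfolding set_lebesgue_integral_def real_scaleR_def
  proof (rule integral_cong_AE)
    have "AE \<omega>' in M. real_cond_exp M F (indicator E) \<omega>' = (\<Prod>i<n. pmf (empirical n (\<lambda>i. X i \<omega>')) (z ! i))"
      using boot unfolding bootstrap_sample_def E_def by blast
    then show "AE \<omega>' in M. indicator A \<omega>' * real_cond_exp M F (indicator E) \<omega>'
      = indicator A \<omega>' * (\<Prod>i<n. pmf (emp (Lx \<omega>)) (z ! i))"
    proof eventually_elim
      case (elim \<omega>')
      have "empirical n (\<lambda>i. X i \<omega>') = emp (Lx \<omega>')" using n_pos by (simp add: empirical_emp Lx_def)
      with elim show ?case by (auto simp: indicator_def A_def)
    qed
  qed measurable
  also have "\<dots> = prob A * (\<Prod>i<n. pmf (emp (Lx \<omega>)) (z ! i))" by (simp add: sub)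
  also have "A = {\<omega>'\<in>space M. Lx \<omega>' = Lx \<omega>}" by (rule A_def)
  finally show ?thesis using True by (simp add: pmf_replicate_pmf)
next
  case False
  then have e: "{\<omega>'\<in>space M. Lx \<omega>' = Lx \<omega> \<and> Lz \<omega>' = z} = {}" unfolding Lz_def map_upt_eq_iff by simp
  show ?thesis unfolding e using False by (simp add: pmf_replicate_pmf)
qed

text \<open>The sample takes countably many values, so a version of the conditional expectation is determined
  on the atoms of positive probability: one null set serves all test functions at once.\<close>

lemma cond_exp_eq:
  fixes G :: "'x list \<Rightarrow> 'x list \<Rightarrow> real"
  assumes b: "\<And>l z. length l = n \<Longrightarrow> length z = n \<Longrightarrow> \<bar>G l z\<bar> \<le> 1"
    and w: "\<omega> \<in> space M" and pos: "0 < pmf (replicate_pmf n r) (Lx \<omega>)"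
  shows "real_cond_exp M F (\<lambda>\<omega>'. G (Lx \<omega>') (Lz \<omega>')) \<omega> = (\<integral>z. G (Lx \<omega>) z \<partial>replicate_pmf n (emp (Lx \<omega>)))"
proof -
  let ?A = "{\<omega>'\<in>space M. Lx \<omega>' = Lx \<omega>}"
  let ?p = "prob ?A"
  have p: "0 < ?p" using pos by (simp add: prob_Lx)
  have len: "length (Lx \<omega>') = n" "length (Lz \<omega>') = n" for \<omega>' by (simp_all add: Lx_def Lz_def)
  have pair: "(\<lambda>\<omega>'. (Lx \<omega>', Lz \<omega>')) \<in> M \<rightarrow>\<^sub>M count_space UNIV"
    by (rule measurable_count_space_eq2_countable[THEN iffD2])
      (auto intro!: countableI_type simp: vimage_def Int_def conj_commute[of _ "_ \<in> space M"])
  have "(\<lambda>\<omega>'. (\<lambda>(l, z). G l z) (Lx \<omega>', Lz \<omega>')) \<in> borel_measurable M"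
    by (rule measurable_compose[OF pair]) simp
  then have gm [measurable]: "(\<lambda>\<omega>'. G (Lx \<omega>') (Lz \<omega>')) \<in> borel_measurable M" by simp
  have gi: "integrable M (\<lambda>\<omega>'. G (Lx \<omega>') (Lz \<omega>'))"
    by (rule integrable_const_bound[where B=1]) (use b len in auto)
  have Gm [measurable]: "(\<lambda>\<omega>'. G (Lx \<omega>) (Lz \<omega>')) \<in> borel_measurable M"
    by (rule measurable_compose[OF Lz_meas]) simp
  \<comment> \<open>The conditional probability given the atom. Its image under \<open>Lz\<close> is
    identified on singletons, and integrals of \<open>G\<close> follow by change of
    variables.\<close>
  define U where "U = density M (\<lambda>\<omega>'. ennreal (indicator ?A \<omega>' / ?p))"
  have LzU: "Lz \<in> U \<rightarrow>\<^sub>M count_space UNIV" unfolding U_def by simp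
  have "distr U (count_space UNIV) Lz = measure_pmf (replicate_pmf n (emp (Lx \<omega>)))"
  proof (rule measure_eqI_countable[of _ UNIV])
    fix z
    have "emeasure (distr U (count_space UNIV) Lz) {z} = emeasure U {\<omega>'\<in>space M. Lz \<omega>' = z}"
      using LzU by (simp add: emeasure_distr vimage_def Int_def conj_commute U_def)
    also have "\<dots> = (\<integral>\<^sup>+\<omega>'. ennreal (indicator ?A \<omega>' / ?p) * indicator {\<omega>'\<in>space M. Lz \<omega>' = z} \<omega>' \<partial>M)"
      unfolding U_def by (rule emeasure_density) measurable
    also have "\<dots> = (\<integral>\<^sup>+\<omega>'. ennreal (1 / ?p) * indicator {\<omega>'\<in>space M. Lx \<omega>' = Lx \<omega> \<and> Lz \<omega>' = z} \<omega>' \<partial>M)"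
      by (rule nn_integral_cong) (auto simp: indicator_def)
    also have "\<dots> = ennreal (1 / ?p) * emeasure M {\<omega>'\<in>space M. Lx \<omega>' = Lx \<omega> \<and> Lz \<omega>' = z}"
    proof (rule nn_integral_cmult_indicator)
      have "{\<omega>'\<in>space M. Lx \<omega>' = Lx \<omega> \<and> Lz \<omega>' = z} = ?A \<inter> {\<omega>'\<in>space M. Lz \<omega>' = z}" by auto
      then show "{\<omega>'\<in>space M. Lx \<omega>' = Lx \<omega> \<and> Lz \<omega>' = z} \<in> sets M" by simp
    qed
    also have "\<dots> = ennreal (pmf (replicate_pmf n (emp (Lx \<omega>))) z)"
      using p by (simp add: emeasure_eq_measure prob_Lx_Lz[OF w] ennreal_mult[symmetric])
    finally show "emeasure (distr U (count_space UNIV) Lz) {z} = emeasure (measure_pmf (replicate_pmf n (emp (Lx \<omega>)))) {z}"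
      by (simp add: emeasure_pmf_single)
  qed auto
  then have "(\<integral>z. G (Lx \<omega>) z \<partial>replicate_pmf n (emp (Lx \<omega>))) = (\<integral>z. G (Lx \<omega>) z \<partial>distr U (count_space UNIV) Lz)" by simp
  also have "\<dots> = (\<integral>\<omega>'. G (Lx \<omega>) (Lz \<omega>') \<partial>U)" by (rule integral_distr[OF LzU]) simp
  also have "\<dots> = (\<integral>\<omega>'. (indicator ?A \<omega>' / ?p) * G (Lx \<omega>) (Lz \<omega>') \<partial>M)"
    unfolding U_def by (subst integral_density) auto
  also have "\<dots> = (\<integral>\<omega>'. (1 / ?p) * (indicator ?A \<omega>' * G (Lx \<omega>') (Lz \<omega>')) \<partial>M)"
    by (rule Bochner_Integration.integral_cong) (auto simp: indicator_def)
  also have "\<dots> = (1 / ?p) * (?p * real_cond_exp M F (\<lambda>\<omega>'. G (Lx \<omega>') (Lz \<omega>')) \<omega>)"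
    unfolding cond_exp_atom[OF gi w, symmetric] by (rule integral_mult_right_zero)
  also have "\<dots> = real_cond_exp M F (\<lambda>\<omega>'. G (Lx \<omega>') (Lz \<omega>')) \<omega>" using p by simp
  finally show ?thesis by simp
qed

text \<open>Both expectations become integrals over the same coupled resample, where the Lipschitz
  and boundedness conditions apply pair by pair. The resulting bound is free of \<open>h\<close> and
  survives the supremum.\<close>

lemma cond_BL_dist_le:
  fixes v :: "'x list \<Rightarrow> 'x list \<Rightarrow> 'b::minus" and u :: "'x list \<Rightarrow> 'b"
  assumes B: "\<And>l z. length l = n \<Longrightarrow> length z = n \<Longrightarrow> v l z \<in> B" "\<And>l. length l = n \<Longrightarrow> u l \<in> B"
    and D: "\<And>l z l'. length l = n \<Longrightarrow> length z = n \<Longrightarrow> length l' = n \<Longrightarrow>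
       nrm (v l z - u l') \<le> sqrt (real n) * D (emp l') (emp l) (emp z)"
    and w: "\<omega> \<in> space M" and pos: "0 < pmf (replicate_pmf n r) (Lx \<omega>)"
  shows "cond_BL_dist M X n B nrm (\<lambda>\<omega>. v (Lx \<omega>) (Lz \<omega>)) (\<lambda>\<omega>. u (Lx \<omega>)) \<omega> \<le> coupled_error D r n (Lx \<omega>)"
  unfolding cond_BL_dist_def
proof (rule SUP_least)
  fix h assume h: "h \<in> BL1 B nrm"
  let ?l = "Lx \<omega>"
  have ll: "length ?l = n" by (simp add: Lx_def)
  have hb: "\<bar>h b\<bar> \<le> 1" if "b \<in> B" for b using h that by (auto simp: BL1_def)
  let ?Q = "replicate_pmf n (mcoup r (emp ?l))"
  have Qlen: "length p = n" if "p \<in> set_pmf ?Q" for p using that by (simp add: set_replicate_pmf)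
  have "real_cond_exp M F (\<lambda>\<omega>'. h (v (Lx \<omega>') (Lz \<omega>'))) \<omega> = (\<integral>z. h (v ?l z) \<partial>replicate_pmf n (emp ?l))"
    by (rule cond_exp_eq[of "\<lambda>l z. h (v l z)", OF _ w pos]) (use hb B in auto)
  also have "replicate_pmf n (emp ?l) = map_pmf (map snd) ?Q" by (simp add: map_replicate_pmf mcoup)
  finally have 1: "real_cond_exp M F (\<lambda>\<omega>'. h (v (Lx \<omega>') (Lz \<omega>'))) \<omega> = (\<integral>p. h (v ?l (map snd p)) \<partial>?Q)" by simp
  have "(\<integral>\<omega>'. h (u (Lx \<omega>')) \<partial>M) = (\<integral>l. h (u l) \<partial>replicate_pmf n r)"
    unfolding distr_Lx[symmetric] by (rule integral_distr[symmetric]) auto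
  also have "replicate_pmf n r = map_pmf (map fst) ?Q" by (simp add: map_replicate_pmf mcoup)
  finally have 2: "(\<integral>\<omega>'. h (u (Lx \<omega>')) \<partial>M) = (\<integral>p. h (u (map fst p)) \<partial>?Q)" by simp
  have i: "integrable (measure_pmf ?Q) (\<lambda>p. h (v ?l (map snd p)))" "integrable (measure_pmf ?Q) (\<lambda>p. h (u (map fst p)))"
    by (rule measure_pmf.integrable_const_bound[where B=1]; auto intro!: AE_pmfI hb B ll simp: Qlen)+
  have "ennreal \<bar>(\<integral>p. h (v ?l (map snd p)) \<partial>?Q) - (\<integral>p. h (u (map fst p)) \<partial>?Q)\<bar>
    = ennreal \<bar>\<integral>p. h (v ?l (map snd p)) - h (u (map fst p)) \<partial>?Q\<bar>" using i by simp
  also have "\<dots> \<le> (\<integral>\<^sup>+p. ennreal \<bar>h (v ?l (map snd p)) - h (u (map fst p))\<bar> \<partial>?Q)"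
    using integral_norm_bound_ennreal[of ?Q "\<lambda>p. h (v ?l (map snd p)) - h (u (map fst p))"] i by simp
  also have "\<dots> \<le> coupled_error D r n ?l" unfolding coupled_error_def
  proof (rule nn_integral_mono_AE, rule AE_pmfI, rule ennreal_leI)
    fix p assume "p \<in> set_pmf ?Q"
    then have p: "length p = n" by (rule Qlen)
    have m: "v ?l (map snd p) \<in> B" "u (map fst p) \<in> B" using B ll p by auto
    have "\<bar>h (v ?l (map snd p)) - h (u (map fst p))\<bar> \<le> nrm (v ?l (map snd p) - u (map fst p))"
      using h m by (auto simp: BL1_def)
    also have "\<dots> \<le> sqrt (real n) * D (emp (map fst p)) (emp ?l) (emp (map snd p))"
      by (rule D) (use ll p in auto)
    finally show "\<bar>h (v ?l (map snd p)) - h (u (map fst p))\<bar> \<le> min 2 (sqrt (real n) * D (emp (map fst p)) (emp ?l) (emp (map snd p)))"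
      using hb[OF m(1)] hb[OF m(2)] by simp
  qed
  finally show "ennreal \<bar>real_cond_exp M F (\<lambda>\<omega>'. h (v (Lx \<omega>') (Lz \<omega>'))) \<omega> - (\<integral>\<omega>'. h (u (Lx \<omega>')) \<partial>M)\<bar> \<le> coupled_error D r n ?l"
    unfolding 1 2 .
qed

text \<open>The event may be nonmeasurable, so it is enclosed in the preimage of a set of samples,
  to which Markov's inequality applies. Samples of probability zero are put into that set, since no
  bound is available on them.\<close>

lemma outer_measure_le:
  assumes D: "\<And>\<omega>. \<omega> \<in> space M \<Longrightarrow> 0 < pmf (replicate_pmf n r) (Lx \<omega>) \<Longrightarrow> d \<omega> \<le> E (Lx \<omega>)" and e: "0 < \<epsilon>"
  shows "outer_measure_of M {\<omega>\<in>space M. ennreal \<epsilon> < d \<omega>} \<le> ennreal (1 / \<epsilon>) * (\<integral>\<^sup>+l. E l \<partial>replicate_pmf n r)"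
proof -
  let ?S = "{l. 0 < pmf (replicate_pmf n r) l \<longrightarrow> ennreal \<epsilon> \<le> E l}"
  have "{\<omega>\<in>space M. ennreal \<epsilon> < d \<omega>} \<subseteq> Lx -` ?S \<inter> space M"
    using D by (auto intro: less_imp_le order_less_le_trans)
  then have "outer_measure_of M {\<omega>\<in>space M. ennreal \<epsilon> < d \<omega>} \<le> outer_measure_of M (Lx -` ?S \<inter> space M)"
    by (rule outer_measure_of_mono)
  also have "\<dots> = emeasure M (Lx -` ?S \<inter> space M)"
    by (rule outer_measure_of_eq) (rule measurable_sets[OF Lx_meas], simp)
  also have "\<dots> = emeasure (distr M (count_space UNIV) Lx) ?S"
    by (rule emeasure_distr[symmetric]) auto
  also have "\<dots> = emeasure (measure_pmf (replicate_pmf n r)) ?S" by (simp only: distr_Lx)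
  also have "\<dots> = emeasure (measure_pmf (replicate_pmf n r)) {l\<in>UNIV. 1 \<le> ennreal (1 / \<epsilon>) * E l}"
  proof (rule emeasure_eq_AE)
    have *: "ennreal \<epsilon> \<le> a \<longleftrightarrow> 1 \<le> ennreal (1 / \<epsilon>) * a" for a
    proof
      assume "ennreal \<epsilon> \<le> a"
      from mult_left_mono[OF this, of "ennreal (1 / \<epsilon>)"] e show "1 \<le> ennreal (1 / \<epsilon>) * a" by (simp add: ennreal_mult[symmetric])
    next
      assume "1 \<le> ennreal (1 / \<epsilon>) * a"
      from mult_left_mono[OF this, of "ennreal \<epsilon>"] e show "ennreal \<epsilon> \<le> a" by (simp add: ennreal_mult[symmetric] mult.assoc[symmetric])
    qed
    show "AE l in replicate_pmf n r. (l \<in> ?S) = (l \<in> {l\<in>UNIV. 1 \<le> ennreal (1 / \<epsilon>) * E l})"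
      by (rule AE_pmfI) (simp add: * pmf_positive)
  qed auto
  also have "\<dots> \<le> ennreal (1 / \<epsilon>) * (\<integral>\<^sup>+l. E l * indicator UNIV l \<partial>replicate_pmf n r)"
    by (rule nn_integral_Markov_inequality) auto
  finally show ?thesis by simp
qed

end

text \<open>Nothing about transport enters: \<open>u\<close> and \<open>v\<close> are statistics of
  empirical measures whose difference is controlled by \<open>D\<close>. The estimates are made at
  \<open>Suc n\<close>, because an empirical measure needs a nonempty sample.\<close>

theorem bootstrap_consistency:
  fixes X :: "nat \<Rightarrow> 'w \<Rightarrow> 'x::countable" and v :: "nat \<Rightarrow> 'x pmf \<Rightarrow> 'x pmf \<Rightarrow> 'b::minus" and u :: "nat \<Rightarrow> 'x pmf \<Rightarrow> 'b"
  assumes M: "prob_space M" and X: "iid_sample M X r"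
    and Xs: "\<And>n. n > 0 \<Longrightarrow> bootstrap_sample M X n (Xs n)"
    and C: "\<And>x. 0 \<le> C x" and fin: "(\<integral>\<^sup>+x. ennreal (C x * sqrt (pmf r x)) \<partial>count_space UNIV) < \<infinity>"
    and approx: "four_point_approx C r D"
    and B: "\<And>n l z. 0 < length l \<Longrightarrow> 0 < length z \<Longrightarrow> v n (emp l) (emp z) \<in> B" "\<And>n l. 0 < length l \<Longrightarrow> u n (emp l) \<in> B"
    and D: "\<And>n l z l'. 0 < length l \<Longrightarrow> 0 < length z \<Longrightarrow> 0 < length l' \<Longrightarrow>
       nrm (v n (emp l) (emp z) - u n (emp l')) \<le> sqrt (real n) * D (emp l') (emp l) (emp z)"
  shows "tendsto_zero_outer_prob M (\<lambda>n. cond_BL_dist M X n B nrm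
    (\<lambda>\<omega>. v n (empirical n (\<lambda>i. X i \<omega>)) (empirical n (\<lambda>i. Xs n i \<omega>))) (\<lambda>\<omega>. u n (empirical n (\<lambda>i. X i \<omega>))))"
  unfolding tendsto_zero_outer_prob_def
proof (intro allI impI)
  fix \<epsilon> :: real assume e: "0 < \<epsilon>"
  let ?d = "\<lambda>n. cond_BL_dist M X n B nrm
    (\<lambda>\<omega>. v n (empirical n (\<lambda>i. X i \<omega>)) (empirical n (\<lambda>i. Xs n i \<omega>))) (\<lambda>\<omega>. u n (empirical n (\<lambda>i. X i \<omega>)))"
  let ?I = "\<lambda>n. \<integral>\<^sup>+l. coupled_error D r (Suc n) l \<partial>replicate_pmf (Suc n) r"
  have le: "outer_measure_of M {\<omega>\<in>space M. ennreal \<epsilon> < ?d (Suc n) \<omega>} \<le> ennreal (1 / \<epsilon>) * ?I n" for n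
  proof -
    interpret bootstrap_sampling M X "Xs (Suc n)" r "Suc n"
      by (intro bootstrap_sampling.intro bootstrap_sampling_axioms.intro M X Xs) auto
    have e: "empirical (Suc n) (\<lambda>i. X i \<omega>) = emp (Lx \<omega>)" "empirical (Suc n) (\<lambda>i. Xs (Suc n) i \<omega>) = emp (Lz \<omega>)" for \<omega>
      by (simp_all only: empirical_emp Lx_def Lz_def zero_less_Suc)
    show ?thesis
      unfolding e
    proof (rule outer_measure_le[OF _ \<open>0 < \<epsilon>\<close>])
      fix \<omega> assume w: "\<omega> \<in> space M" "0 < pmf (replicate_pmf (Suc n) r) (Lx \<omega>)"
      show "cond_BL_dist M X (Suc n) B nrm (\<lambda>\<omega>. v (Suc n) (emp (Lx \<omega>)) (emp (Lz \<omega>))) (\<lambda>\<omega>. u (Suc n) (emp (Lx \<omega>))) \<omega>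
        \<le> coupled_error D r (Suc n) (Lx \<omega>)"
        by (rule cond_BL_dist_le[where v="\<lambda>l z. v (Suc n) (emp l) (emp z)" and u="\<lambda>l. u (Suc n) (emp l)", OF _ _ _ w])
          (auto intro!: B D simp del: of_nat_Suc)
    qed
  qed
  have "(\<lambda>n. ennreal (1 / \<epsilon>) * ?I n) \<longlonglongrightarrow> ennreal (1 / \<epsilon>) * 0"
    by (intro ennreal_tendsto_cmult coupled_error_tendsto[OF C fin approx]) simp
  then have "(\<lambda>n. outer_measure_of M {\<omega>\<in>space M. ennreal \<epsilon> < ?d (Suc n) \<omega>}) \<longlonglongrightarrow> 0"
    by (intro tendsto_sandwich[OF _ _ tendsto_const, of _ "\<lambda>n. outer_measure_of M {\<omega>\<in>space M. ennreal \<epsilon> < ?d (Suc n) \<omega>}" _ "\<lambda>n. ennreal (1 / \<epsilon>) * ?I n"])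
      (auto intro!: always_eventually le simp del: of_nat_Suc replicate_pmf.simps)
  then show "(\<lambda>n. outer_measure_of M {\<omega>\<in>space M. ennreal \<epsilon> < ?d n \<omega>}) \<longlonglongrightarrow> 0"
    by (rule LIMSEQ_imp_Suc)
qed

section \<open>Perturbation of the Schroedinger system\<close>

text \<open>Replacing \<open>exp t - 1\<close> by \<open>slope t * t\<close> turns the differences of two Schroedinger systems into
  an exact linear system with a positive kernel.\<close>

definition slope :: "real \<Rightarrow> real" where
  "slope t = (if t = 0 then 1 else (exp t - 1) / t)"

lemma slope_mult: "slope t * t = exp t - 1"
  by (simp add: slope_def)

text \<open>\<open>slope t\<close> is the mean of the exponential between 0 and \<open>t\<close>,
  hence lies between its end values; both bounds come from \<open>1 + u \<le> exp u\<close> at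
  \<open>u = t\<close> and \<open>u = - t\<close>.\<close>

lemma slope_bounds: "min 1 (exp t) \<le> slope t" "slope t \<le> max 1 (exp t)"
proof -
  have e1: "t \<le> exp t - 1" using exp_ge_add_one_self[of t] by linarith
  have "exp t * (1 - t) \<le> exp t * exp (- t)"
    using exp_ge_add_one_self[of "- t"] by (intro mult_left_mono) auto
  then have e2: "exp t - 1 \<le> exp t * t" by (simp add: exp_minus right_diff_distrib)
  consider "t = 0" | "0 < t" | "t < 0" by linarith
  then have "min 1 (exp t) \<le> slope t \<and> slope t \<le> max 1 (exp t)"
  proof cases
    case 2
    then show ?thesis using e1 e2 by (auto simp: slope_def field_simps)
  next
    case 3
    then show ?thesis using e1 e2 by (auto simp: slope_def field_simps)
  qed (simp add: slope_def)
  then show "min 1 (exp t) \<le> slope t" "slope t \<le> max 1 (exp t)" by auto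
qed

lemma abs_exp_minus_one_le: "\<bar>exp t - 1\<bar> \<le> \<bar>t\<bar> * max 1 (exp (t::real))"
proof -
  have "\<bar>exp t - 1\<bar> = \<bar>slope t\<bar> * \<bar>t\<bar>" by (simp add: slope_mult[symmetric] abs_mult)
  also have "\<dots> \<le> max 1 (exp t) * \<bar>t\<bar>"
  proof (rule mult_right_mono)
    have "0 < min 1 (exp t)" by simp
    with slope_bounds[of t] show "\<bar>slope t\<bar> \<le> max 1 (exp t)" by linarith
  qed simp
  finally show ?thesis by (simp add: mult.commute)
qed

lemma abs_exp_taylor2_le: "\<bar>exp t - 1 - t\<bar> \<le> t\<^sup>2 * max 1 (exp (t::real))"
proof -
  have "exp t - 1 - t = t * (slope t - 1)" by (simp add: right_diff_distrib slope_mult mult.commute[of t])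
  then have "\<bar>exp t - 1 - t\<bar> = \<bar>t\<bar> * \<bar>slope t - 1\<bar>" by (simp add: abs_mult)
  also have "\<dots> \<le> \<bar>t\<bar> * \<bar>exp t - 1\<bar>"
    using slope_bounds[of t] by (intro mult_left_mono) (auto simp: min_def max_def split: if_splits)
  also have "\<dots> \<le> \<bar>t\<bar> * (\<bar>t\<bar> * max 1 (exp t))" by (intro mult_left_mono abs_exp_minus_one_le) simp
  finally show ?thesis by (simp add: power2_eq_square mult.assoc[symmetric])
qed

section \<open>Integrals of bounded functions against close marginals\<close>

lemma pmf_integrable_bounded:
  fixes F :: "'a \<Rightarrow> real"
  assumes "\<And>x. \<bar>F x\<bar> \<le> B"
  shows "integrable (measure_pmf p) F"
  by (rule measure_pmf.integrable_const_bound[where B=B]) (use assms in auto)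

lemma pmf_integral_bounded:
  fixes F :: "'a \<Rightarrow> real"
  assumes "\<And>x. \<bar>F x\<bar> \<le> B"
  shows "\<bar>\<integral>x. F x \<partial>measure_pmf p\<bar> \<le> B"
proof -
  have "\<bar>\<integral>x. F x \<partial>p\<bar> \<le> (\<integral>x. \<bar>F x\<bar> \<partial>p)" by (rule integral_abs_bound)
  also have "\<dots> \<le> (\<integral>x. B \<partial>p)"
    by (rule integral_mono) (use assms pmf_integrable_bounded[of F B p] in auto)
  finally show ?thesis by simp
qed

lemma expectation_diff_bounded:
  fixes F :: "'a \<Rightarrow> real"
  assumes d: "wdist (\<lambda>_. 1) p q \<le> ennreal d" and d0: "0 \<le> d" and F: "\<And>x. \<bar>F x\<bar> \<le> B"
  shows "\<bar>(\<integral>x. F x \<partial>p) - (\<integral>x. F x \<partial>q)\<bar> \<le> B * d"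
proof -
  have B: "0 \<le> B" using F[of undefined] by linarith
  have "ennreal \<bar>(\<integral>x. F x \<partial>p) - (\<integral>x. F x \<partial>q)\<bar> \<le> wdist (\<lambda>_. B * 1) p q"
    by (rule expectation_diff_le) (use F pmf_integrable_bounded[of F B] in auto)
  also have "\<dots> = ennreal B * wdist (\<lambda>_. 1) p q" by (rule wnorm_cmult[OF B])
  also have "\<dots> \<le> ennreal B * ennreal d" by (rule mult_left_mono[OF d]) simp
  finally show ?thesis using B d0 by (simp add: ennreal_mult[symmetric])
qed

text \<open>Abstracts plan densities from transport. The fourth power is what the errors require:
  second-order errors in the column equations grow like the cube of \<open>\<phi>\<close>, and
  pairing with a density adds one more factor.\<close>

locale kernel_bounds =
  fixes s :: "'y pmf" and \<phi> :: "'y \<Rightarrow> real" and K :: real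
  assumes \<phi>_ge: "\<And>y. 1 \<le> \<phi> y" and K_ge: "1 \<le> K" and \<phi>4: "integrable (measure_pmf s) (\<lambda>y. \<phi> y ^ 4)"
begin

definition Phi4 :: real where "Phi4 = (\<integral>y. \<phi> y ^ 4 \<partial>s)"
text \<open>Total mass of the minorizing measure of density \<open>1 / \<phi>\<close> in the Doeblin
  condition.\<close>

definition iota :: real where "iota = (\<integral>y. 1 / \<phi> y \<partial>s)"

text \<open>Density of a coupling of \<open>p\<close> and \<open>s\<close>. Rows are normalised at
  every \<open>x\<close>, columns on the support of \<open>s\<close> only, matching what the
  Schroedinger system provides; \<open>K\<close> does not depend on \<open>p\<close>.\<close>

definition good :: "'x pmf \<Rightarrow> ('x \<Rightarrow> 'y \<Rightarrow> real) \<Rightarrow> bool" where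
  "good p \<xi> \<longleftrightarrow> (\<forall>x. (\<integral>y. \<xi> x y \<partial>s) = 1) \<and> (\<forall>y\<in>set_pmf s. (\<integral>x. \<xi> x y \<partial>p) = 1) \<and>
     (\<forall>x. \<forall>y\<in>set_pmf s. 1 / (K * \<phi> y) \<le> \<xi> x y \<and> \<xi> x y \<le> K * \<phi> y)"

lemma \<phi>_pos: "0 < \<phi> y" using \<phi>_ge[of y] by linarith
lemma K_pos: "0 < K" using K_ge by linarith

lemma \<phi>_power_mono: "i \<le> j \<Longrightarrow> \<phi> y ^ i \<le> \<phi> y ^ j"
  by (rule power_increasing) (use \<phi>_ge in auto)

lemma \<phi>_le_power: "0 < j \<Longrightarrow> \<phi> y \<le> \<phi> y ^ j" and one_le_\<phi>_power: "1 \<le> \<phi> y ^ j"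
  using \<phi>_power_mono[of 1 j y] \<phi>_power_mono[of 0 j y] by auto

lemma int_s:
  assumes "\<And>y. y \<in> set_pmf s \<Longrightarrow> \<bar>h y\<bar> \<le> B * \<phi> y ^ 4"
  shows "integrable (measure_pmf s) h" and "\<bar>\<integral>y. h y \<partial>s\<bar> \<le> B * Phi4"
proof -
  have i: "integrable (measure_pmf s) (\<lambda>y. B * \<phi> y ^ 4)" using \<phi>4 by simp
  show h: "integrable (measure_pmf s) h"
    by (rule Bochner_Integration.integrable_bound[OF i])
      (use assms in \<open>auto intro!: AE_pmfI intro: order_trans[OF _ abs_ge_self]\<close>)
  have "\<bar>\<integral>y. h y \<partial>s\<bar> \<le> (\<integral>y. \<bar>h y\<bar> \<partial>s)" by (rule integral_abs_bound)
  also have "\<dots> \<le> (\<integral>y. B * \<phi> y ^ 4 \<partial>s)"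
    by (rule integral_mono_AE) (use h i assms in \<open>auto intro!: AE_pmfI\<close>)
  finally show "\<bar>\<integral>y. h y \<partial>s\<bar> \<le> B * Phi4" by (simp add: Phi4_def)
qed

lemma Phi4_ge: "1 \<le> Phi4"
proof -
  have "(\<integral>y. 1 \<partial>s) \<le> Phi4" unfolding Phi4_def
    by (rule integral_mono) (use \<phi>4 one_le_\<phi>_power in auto)
  then show ?thesis by simp
qed

lemma iota_int: "integrable (measure_pmf s) (\<lambda>y. 1 / \<phi> y)"
  by (rule pmf_integrable_bounded[where B=1]) (use \<phi>_ge \<phi>_pos in \<open>auto simp: less_imp_le\<close>)

lemma iota_pos: "0 < iota"
proof -
  have nz: "1 / \<phi> y \<noteq> 0" for y using \<phi>_pos[of y] by simp
  have nn: "0 \<le> 1 / \<phi> y" for y using \<phi>_pos[of y] by simp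
  have "0 \<le> iota" unfolding iota_def by (rule integral_nonneg_AE) (use nn in auto)
  moreover have "iota \<noteq> 0"
  proof
    assume "iota = 0"
    then have "AE y in s. 1 / \<phi> y = 0"
      unfolding iota_def using integral_nonneg_eq_0_iff_AE[OF iota_int] nn by auto
    then show False using nz set_pmf_not_empty[of s] by (auto simp: AE_measure_pmf_iff)
  qed
  ultimately show ?thesis by linarith
qed

text \<open>Splitting \<open>c0 / \<phi>\<close> off every row leaves mass
  \<open>1 - c0 * iota\<close>. Two averages of \<open>\<gamma>\<close> share the contribution
  \<open>?G\<close>, so they differ by at most that fraction of the oscillation of
  \<open>\<alpha>\<close>. The a priori bound \<open>A\<close> makes the oscillation finite, which
  permits absorbing it.\<close>

lemma doeblin_osc:
  fixes k :: "'x \<Rightarrow> 'y \<Rightarrow> real" and \<alpha> :: "'x \<Rightarrow> real" and \<gamma> :: "'y \<Rightarrow> real"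
  assumes c0: "0 < c0" and k: "\<And>x y. y \<in> set_pmf s \<Longrightarrow> c0 / \<phi> y \<le> k x y"
    and ki: "\<And>x. integrable (measure_pmf s) (k x)" and k1: "\<And>x. (\<integral>y. k x y \<partial>s) = 1"
    and bdd: "\<And>x. \<bar>\<alpha> x\<bar> \<le> A"
    and \<gamma>: "\<And>m S y. (\<And>x. m \<le> \<alpha> x) \<Longrightarrow> (\<And>x. \<alpha> x \<le> S) \<Longrightarrow> y \<in> set_pmf s \<Longrightarrow> m \<le> \<gamma> y \<and> \<gamma> y \<le> S"
    and err: "\<And>x. \<bar>\<alpha> x - (\<integral>y. k x y * \<gamma> y \<partial>s)\<bar> \<le> \<kappa>"
  shows "\<alpha> x - \<alpha> x' \<le> 2 * \<kappa> / (c0 * iota)"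
proof -
  define S where "S = (SUP x. \<alpha> x)"
  define m where "m = (INF x. \<alpha> x)"
  have bd: "\<alpha> x \<le> A" "- A \<le> \<alpha> x" for x using bdd[of x] by linarith+
  have ba: "bdd_above (range \<alpha>)" "bdd_below (range \<alpha>)"
    using bd by (auto simp: bdd_above_def bdd_below_def)
  have S: "\<alpha> x \<le> S" and m: "m \<le> \<alpha> x" for x
    unfolding S_def m_def using ba by (auto intro: cSUP_upper cINF_lower)
  have g: "m \<le> \<gamma> y" "\<gamma> y \<le> S" if "y \<in> set_pmf s" for y using \<gamma>[OF m S that] by auto
  have gA: "\<bar>\<gamma> y\<bar> \<le> A" if "y \<in> set_pmf s" for y
    using \<gamma>[OF bd(2) bd(1) that] by linarith
  have A: "0 \<le> A" using bdd[of undefined] by linarith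
  have kpos: "0 \<le> k x y" if "y \<in> set_pmf s" for x y
    using k[OF that, of x] c0 \<phi>_pos[of y] by (meson divide_pos_pos less_imp_le order_trans)
  have kgi: "integrable (measure_pmf s) (\<lambda>y. k x y * \<gamma> y)" for x
  proof (rule Bochner_Integration.integrable_bound)
    show "integrable (measure_pmf s) (\<lambda>y. A * k x y)" using ki by simp
    show "AE y in s. norm (k x y * \<gamma> y) \<le> norm (A * k x y)"
      by (rule AE_pmfI) (use gA kpos A in \<open>auto simp: abs_mult mult.commute intro!: mult_right_mono\<close>)
  qed simp
  define w where "w y = 1 / \<phi> y" for y
  have wi: "integrable (measure_pmf s) w" and wI: "(\<integral>y. w y \<partial>s) = iota"
    using iota_int by (simp_all add: w_def[abs_def] iota_def)
  have kw: "c0 * w y \<le> k x y" if "y \<in> set_pmf s" for x y using k[OF that, of x] by (simp add: w_def)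
  have gfi: "integrable (measure_pmf s) (\<lambda>y. \<gamma> y * w y)"
  proof (rule Bochner_Integration.integrable_bound)
    show "integrable (measure_pmf s) (\<lambda>y. A * w y)" using wi by simp
    show "AE y in s. norm (\<gamma> y * w y) \<le> norm (A * w y)"
      by (rule AE_pmfI) (use gA A in \<open>auto simp: abs_mult intro!: mult_right_mono\<close>)
  qed simp
  let ?G = "c0 * (\<integral>y. \<gamma> y * w y \<partial>s)" and ?\<tau> = "c0 * iota"
  have up: "(\<integral>y. k x y * \<gamma> y \<partial>s) \<le> (1 - ?\<tau>) * S + ?G" for x
  proof -
    have "0 \<le> (\<integral>y. S * k x y - k x y * \<gamma> y - c0 * S * w y + c0 * (\<gamma> y * w y) \<partial>s)"
    proof (rule integral_nonneg_AE, rule AE_pmfI)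
      fix y assume y: "y \<in> set_pmf s"
      have "0 \<le> (k x y - c0 * w y) * (S - \<gamma> y)"
        by (rule mult_nonneg_nonneg) (use kw[OF y, of x] g(2)[OF y] in auto)
      then show "0 \<le> S * k x y - k x y * \<gamma> y - c0 * S * w y + c0 * (\<gamma> y * w y)"
        by (simp add: algebra_simps)
    qed
    also have "\<dots> = S - (\<integral>y. k x y * \<gamma> y \<partial>s) - c0 * S * iota + ?G"
      using ki kgi wi gfi k1[of x] wI by simp
    finally show ?thesis by (simp add: algebra_simps)
  qed
  have low: "(1 - ?\<tau>) * m + ?G \<le> (\<integral>y. k x y * \<gamma> y \<partial>s)" for x
  proof -
    have "0 \<le> (\<integral>y. k x y * \<gamma> y - m * k x y - c0 * (\<gamma> y * w y) + c0 * m * w y \<partial>s)"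
    proof (rule integral_nonneg_AE, rule AE_pmfI)
      fix y assume y: "y \<in> set_pmf s"
      have "0 \<le> (k x y - c0 * w y) * (\<gamma> y - m)"
        by (rule mult_nonneg_nonneg) (use kw[OF y, of x] g(1)[OF y] in auto)
      then show "0 \<le> k x y * \<gamma> y - m * k x y - c0 * (\<gamma> y * w y) + c0 * m * w y"
        by (simp add: algebra_simps)
    qed
    also have "\<dots> = (\<integral>y. k x y * \<gamma> y \<partial>s) - m - ?G + c0 * m * iota"
      using ki kgi wi gfi k1[of x] wI by simp
    finally show ?thesis by (simp add: algebra_simps)
  qed
  let ?R = "(1 - ?\<tau>) * (S - m) + 2 * \<kappa>"
  have le: "\<alpha> x \<le> \<alpha> x' + ?R" for x x'
    using err[of x] err[of x'] up[of x] low[of x'] by (simp add: algebra_simps abs_le_iff)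
  have "S \<le> \<alpha> x' + ?R" for x' unfolding S_def by (rule cSUP_least) (use le in \<open>auto simp: S_def[symmetric]\<close>)
  then have "S - ?R \<le> \<alpha> x'" for x' by (simp add: algebra_simps)
  then have "S - ?R \<le> m" unfolding m_def by (intro cINF_greatest) (auto simp: m_def[symmetric])
  \<comment> \<open>The oscillation satisfies
    \<open>S - m \<le> (1 - ?\<tau>) * (S - m) + 2 * \<kappa>\<close>; its multiple on the right is
    absorbed.\<close>
  then have "?\<tau> * (S - m) \<le> 2 * \<kappa>" by (simp add: algebra_simps)
  then have "S - m \<le> 2 * \<kappa> / ?\<tau>" using c0 iota_pos by (simp add: field_simps)
  then show ?thesis using S[of x] m[of x'] by linarith
qed

text \<open>The bound of \<open>doeblin_osc\<close> for an error \<open>K ^ 4 / iota * Phi4\<close>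
  per unit of distance and the minorization constant \<open>1 / (K\<^sup>2 * Phi4)\<close> of the
  normalised slope kernel.\<close>

definition KA :: real where "KA = 2 * (K ^ 4 / iota * Phi4) / (1 / (K\<^sup>2 * Phi4) * iota)"

lemma good_int:
  assumes "good p \<xi>"
  shows "integrable (measure_pmf s) (\<xi> x)"
  using assms not_integrable_integral_eq[of s "\<xi> x"] unfolding good_def by force

text \<open>The increments are not yet known to be small, so a Taylor expansion would be useless;
  the slope identity gives an exact linear system instead. Eliminating \<open>\<beta>\<close> leaves
  \<open>\<alpha>\<close> equal to a double average of itself up to an error of size
  \<open>d\<close>. Only oscillations can be bounded, as constants may move between
  \<open>\<alpha>\<close> and \<open>\<beta>\<close>.\<close>

lemma alpha_osc:
  fixes \<xi> \<xi>' :: "'x \<Rightarrow> 'y \<Rightarrow> real"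
  assumes g: "good r \<xi>" and g': "good p \<xi>'" and d: "wdist (\<lambda>_. 1) p r \<le> ennreal d" and d0: "0 \<le> d"
    and rel: "\<And>x y. y \<in> set_pmf s \<Longrightarrow> \<xi>' x y = \<xi> x y * exp (\<alpha> x + \<beta> y)"
    and bdd: "\<And>x. \<bar>\<alpha> x\<bar> \<le> A"
  shows "\<alpha> x - \<alpha> x' \<le> KA * d"
proof -
  \<comment> \<open>On the support of \<open>s\<close> this kernel lies between \<open>\<xi>\<close>
    and \<open>\<xi>'\<close> and inherits their two-sided bounds.\<close>
  define k where "k x y = \<xi> x y * slope (\<alpha> x + \<beta> y)" for x y
  have b: "1 / (K * \<phi> y) \<le> \<xi> x y" "\<xi> x y \<le> K * \<phi> y" "1 / (K * \<phi> y) \<le> \<xi>' x y" "\<xi>' x y \<le> K * \<phi> y"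
    if "y \<in> set_pmf s" for x y using g g' that by (auto simp: good_def)
  have lpos: "0 < 1 / (K * \<phi> y)" for y using K_pos \<phi>_pos by simp
  have \<xi>pos: "0 < \<xi> x y" if "y \<in> set_pmf s" for x y using b(1)[OF that] lpos[of y] by (rule less_le_trans[rotated])
  have kb: "1 / (K * \<phi> y) \<le> k x y" "k x y \<le> K * \<phi> y" if y: "y \<in> set_pmf s" for x y
  proof -
    have "1 / (K * \<phi> y) \<le> \<xi> x y * min 1 (exp (\<alpha> x + \<beta> y))"
      using b(1)[OF y, of x] b(3)[OF y, of x] rel[OF y, of x] by (simp add: min_def)
    also have "\<dots> \<le> k x y" unfolding k_def
      by (rule mult_left_mono[OF slope_bounds(1)]) (use \<xi>pos[OF y] in \<open>simp add: less_imp_le\<close>)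
    finally show "1 / (K * \<phi> y) \<le> k x y" .
    have "k x y \<le> \<xi> x y * max 1 (exp (\<alpha> x + \<beta> y))" unfolding k_def
      by (rule mult_left_mono[OF slope_bounds(2)]) (use \<xi>pos[OF y] in \<open>simp add: less_imp_le\<close>)
    also have "\<dots> \<le> K * \<phi> y"
      using b(2)[OF y, of x] b(4)[OF y, of x] rel[OF y, of x] by (simp add: max_def)
    finally show "k x y \<le> K * \<phi> y" .
  qed
  have kpos: "0 < k x y" if "y \<in> set_pmf s" for x y using kb(1)[OF that] lpos[of y] by (rule less_le_trans[rotated])
  have kt: "k x y * (\<alpha> x + \<beta> y) = \<xi>' x y - \<xi> x y" if "y \<in> set_pmf s" for x y
    using rel[OF that, of x] by (simp add: k_def mult.assoc slope_mult right_diff_distrib)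
  have k4: "K * \<phi> y \<le> K * \<phi> y ^ 4" for y
    using K_pos \<phi>_le_power[of 4 y] by simp
  have ki: "integrable (measure_pmf s) (k x)" and Kint: "(\<integral>y. k x y \<partial>s) \<le> K * Phi4" for x
  proof -
    have *: "\<bar>k x y\<bar> \<le> K * \<phi> y ^ 4" if "y \<in> set_pmf s" for y
      using kpos[OF that, of x] kb(2)[OF that, of x] k4[of y] by linarith
    show "integrable (measure_pmf s) (k x)" "(\<integral>y. k x y \<partial>s) \<le> K * Phi4"
      using int_s[of "k x" K, OF *] by auto
  qed
  define Ax where "Ax x = (\<integral>y. k x y \<partial>s)" for x
  have Alow: "iota / K \<le> Ax x" for x
  proof -
    have "(\<integral>y. (1 / K) * (1 / \<phi> y) \<partial>s) \<le> Ax x" unfolding Ax_def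
      by (rule integral_mono_AE[OF integrable_mult_right[OF iota_int] ki], rule AE_pmfI) (use kb(1) in simp)
    then show ?thesis unfolding integral_mult_right_zero iota_def[symmetric] by simp
  qed
  have Apos: "0 < Ax x" for x using Alow[of x] iota_pos K_pos by (meson divide_pos_pos less_le_trans)
  have kri: "integrable (measure_pmf r) (\<lambda>x. k x y)" "integrable (measure_pmf r) (\<lambda>x. k x y * \<alpha> x)"
    if y: "y \<in> set_pmf s" for y
  proof -
    show "integrable (measure_pmf r) (\<lambda>x. k x y)"
      by (rule pmf_integrable_bounded[where B="K * \<phi> y"]) (use kpos[OF y] kb(2)[OF y] in \<open>auto simp: less_imp_le\<close>)
    have "\<bar>k x y * \<alpha> x\<bar> \<le> K * \<phi> y * A" for x
      unfolding abs_mult by (rule mult_mono) (use kpos[OF y, of x] kb(2)[OF y, of x] bdd[of x] in auto)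
    then show "integrable (measure_pmf r) (\<lambda>x. k x y * \<alpha> x)" by (rule pmf_integrable_bounded)
  qed
  define Bv where "Bv y = (\<integral>x. k x y \<partial>r)" for y
  have Bpos: "1 / (K * \<phi> y) \<le> Bv y" if y: "y \<in> set_pmf s" for y
  proof -
    have "(\<integral>x. 1 / (K * \<phi> y) \<partial>r) \<le> Bv y" unfolding Bv_def
      by (rule integral_mono) (use kri[OF y] kb(1)[OF y] in auto)
    then show ?thesis by simp
  qed
  have Bpos': "0 < Bv y" if "y \<in> set_pmf s" for y using Bpos[OF that] lpos[of y] by linarith
  \<comment> \<open>The average of \<open>\<alpha>\<close> over the column of \<open>y\<close>,
    which equals \<open>- \<beta> y\<close> up to the error computed below.\<close>
  define \<gamma> where "\<gamma> y = (\<integral>x. k x y * \<alpha> x \<partial>r) / Bv y" for y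
  have \<gamma>: "m \<le> \<gamma> y \<and> \<gamma> y \<le> S" if m: "\<And>x. m \<le> \<alpha> x" and S: "\<And>x. \<alpha> x \<le> S" and y: "y \<in> set_pmf s" for m S y
  proof -
    have "(\<integral>x. m * k x y \<partial>r) \<le> (\<integral>x. k x y * \<alpha> x \<partial>r)" "(\<integral>x. k x y * \<alpha> x \<partial>r) \<le> (\<integral>x. S * k x y \<partial>r)"
      by (rule integral_mono; use kri[OF y] m S kpos[OF y] in \<open>auto simp: mult.commute intro!: mult_right_mono less_imp_le\<close>)+
    then show ?thesis using Bpos'[OF y] by (simp add: \<gamma>_def Bv_def[symmetric] field_simps)
  qed
  \<comment> \<open>The only source term: columns of \<open>\<xi>'\<close> are normalised under
    \<open>p\<close>, whereas the system is written under \<open>r\<close>.\<close>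
  define \<eta> where "\<eta> y = (\<integral>x. \<xi>' x y \<partial>p) - (\<integral>x. \<xi>' x y \<partial>r)" for y
  have \<xi>b: "\<bar>\<xi> x y\<bar> \<le> K * \<phi> y" "\<bar>\<xi>' x y\<bar> \<le> K * \<phi> y" if y: "y \<in> set_pmf s" for x y
    using b[OF y, of x] lpos[of y] by linarith+
  have \<eta>b: "\<bar>\<eta> y\<bar> \<le> K * \<phi> y * d" if y: "y \<in> set_pmf s" for y
    unfolding \<eta>_def by (rule expectation_diff_bounded[OF d d0 \<xi>b(2)[OF y]])
  have \<beta>: "- \<beta> y - \<gamma> y = \<eta> y / Bv y" if y: "y \<in> set_pmf s" for y
  proof -
    note i = pmf_integrable_bounded[of "\<lambda>x. \<xi> x y", OF \<xi>b(1)[OF y]] pmf_integrable_bounded[of "\<lambda>x. \<xi>' x y", OF \<xi>b(2)[OF y]]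
    have "(\<integral>x. k x y * \<alpha> x \<partial>r) + \<beta> y * Bv y = (\<integral>x. k x y * (\<alpha> x + \<beta> y) \<partial>r)"
      unfolding Bv_def using kri[OF y] by (simp add: distrib_left mult.commute[of "\<beta> y"])
    also have "\<dots> = (\<integral>x. \<xi>' x y \<partial>r) - (\<integral>x. \<xi> x y \<partial>r)"
      unfolding kt[OF y] by (rule Bochner_Integration.integral_diff[OF i(2) i(1)])
    also have "\<dots> = - \<eta> y" using g g' y by (simp add: good_def \<eta>_def)
    finally have "- \<beta> y * Bv y - (\<integral>x. k x y * \<alpha> x \<partial>r) = \<eta> y" by simp
    moreover have "(\<integral>x. k x y * \<alpha> x \<partial>r) = \<gamma> y * Bv y" using Bpos'[OF y] by (simp add: \<gamma>_def)
    ultimately have "(- \<beta> y - \<gamma> y) * Bv y = \<eta> y" by (simp add: left_diff_distrib)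
    then show ?thesis using Bpos'[OF y] by (simp add: field_simps)
  qed
  have knorm: "k x y / Ax x \<le> K\<^sup>2 / iota * \<phi> y" "0 \<le> k x y / Ax x" if y: "y \<in> set_pmf s" for x y
  proof -
    have "k x y / Ax x \<le> (K * \<phi> y) / (iota / K)"
      by (rule frac_le) (use kb(2)[OF y] Alow iota_pos K_pos \<phi>_pos in \<open>auto simp: less_imp_le\<close>)
    then show "k x y / Ax x \<le> K\<^sup>2 / iota * \<phi> y" by (simp add: power2_eq_square mult_ac)
    show "0 \<le> k x y / Ax x" using kpos[OF y, of x] Apos[of x] by simp
  qed
  define \<kappa> where "\<kappa> = K ^ 4 / iota * d * Phi4"
  have "\<alpha> x - \<alpha> x' \<le> 2 * \<kappa> / (1 / (K\<^sup>2 * Phi4) * iota)"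
  proof (rule doeblin_osc[where k="\<lambda>x y. k x y / Ax x" and \<gamma>=\<gamma> and A=A])
    show "0 < 1 / (K\<^sup>2 * Phi4)" using K_pos Phi4_ge by simp
    show "1 / (K\<^sup>2 * Phi4) / \<phi> y \<le> k x y / Ax x" if y: "y \<in> set_pmf s" for x y
    proof -
      have "(1 / (K * \<phi> y)) / (K * Phi4) \<le> k x y / Ax x"
        by (rule frac_le) (use kb(1)[OF y, of x] kpos[OF y, of x] Kint[of x] Apos[of x] in \<open>auto simp: Ax_def less_imp_le\<close>)
      then show ?thesis by (simp add: power2_eq_square mult_ac)
    qed
    show "integrable (measure_pmf s) (\<lambda>y. k x y / Ax x)" for x using ki by simp
    show "(\<integral>y. k x y / Ax x \<partial>s) = 1" for x using Apos[of x] by (simp add: Ax_def[symmetric])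
    show "\<bar>\<alpha> x\<bar> \<le> A" for x by (rule bdd)
    show "m \<le> \<gamma> y \<and> \<gamma> y \<le> S" if "\<And>x. m \<le> \<alpha> x" "\<And>x. \<alpha> x \<le> S" "y \<in> set_pmf s" for m S y
      by (rule \<gamma>[OF that])
    show "\<bar>\<alpha> x - (\<integral>y. k x y / Ax x * \<gamma> y \<partial>s)\<bar> \<le> \<kappa>" for x
    proof -
      let ?k = "\<lambda>y. k x y / Ax x"
      have \<gamma>A: "\<bar>\<gamma> y\<bar> \<le> A" if "y \<in> set_pmf s" for y
      proof -
        have "- A \<le> \<alpha> x" "\<alpha> x \<le> A" for x using bdd[of x] by linarith+
        from \<gamma>[OF this that] show ?thesis by linarith
      qed
      have A0: "0 \<le> A" using bdd[of x] by linarith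
      have gi: "integrable (measure_pmf s) (\<lambda>y. ?k y * \<gamma> y)"
      proof (rule Bochner_Integration.integrable_bound)
        show "integrable (measure_pmf s) (\<lambda>y. A * ?k y)" using ki by simp
        show "AE y in s. norm (?k y * \<gamma> y) \<le> norm (A * ?k y)"
          by (rule AE_pmfI) (use \<gamma>A A0 Apos[of x] kpos in \<open>auto simp: abs_mult mult.commute less_imp_le intro!: divide_right_mono mult_left_mono\<close>)
      qed simp
      \<comment> \<open>The inserted quotient integrates to zero, because the rows of
        \<open>\<xi>\<close> and \<open>\<xi>'\<close> both have mass one.\<close>
      have "\<alpha> x - (\<integral>y. ?k y * \<gamma> y \<partial>s) = (\<integral>y. \<alpha> x * ?k y - ?k y * \<gamma> y - (\<xi>' x y - \<xi> x y) / Ax x \<partial>s)"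
        using ki gi good_int[OF g] good_int[OF g'] g g' Apos[of x] by (simp add: Ax_def[symmetric] good_def)
      also have "\<dots> = (\<integral>y. ?k y * (\<eta> y / Bv y) \<partial>s)"
      proof (rule integral_cong_AE)
        show "AE y in s. \<alpha> x * ?k y - ?k y * \<gamma> y - (\<xi>' x y - \<xi> x y) / Ax x = ?k y * (\<eta> y / Bv y)"
        proof (rule AE_pmfI)
          fix y assume y: "y \<in> set_pmf s"
          show "\<alpha> x * ?k y - ?k y * \<gamma> y - (\<xi>' x y - \<xi> x y) / Ax x = ?k y * (\<eta> y / Bv y)"
            unfolding \<beta>[OF y, symmetric] kt[OF y, symmetric] using Apos[of x] by (simp add: field_simps)
        qed
      qed auto
      also have "\<bar>\<dots>\<bar> \<le> (K ^ 4 / iota * d) * Phi4"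
      proof (rule int_s(2))
        fix y assume y: "y \<in> set_pmf s"
        have "\<bar>\<eta> y / Bv y\<bar> \<le> (K * \<phi> y * d) / (1 / (K * \<phi> y))"
          unfolding abs_divide by (rule frac_le) (use \<eta>b[OF y] Bpos[OF y] Bpos'[OF y] lpos in auto)
        also have "\<dots> = K\<^sup>2 * \<phi> y ^ 2 * d" by (simp add: power2_eq_square mult_ac)
        finally have e: "\<bar>\<eta> y / Bv y\<bar> \<le> K\<^sup>2 * \<phi> y ^ 2 * d" .
        have "\<bar>?k y * (\<eta> y / Bv y)\<bar> \<le> (K\<^sup>2 / iota * \<phi> y) * (K\<^sup>2 * \<phi> y ^ 2 * d)"
          unfolding abs_mult by (rule mult_mono[OF _ e]) (use knorm[OF y, of x] iota_pos K_pos \<phi>_pos[of y] in auto)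
        also have "\<dots> = (K ^ 4 / iota * d) * \<phi> y ^ 3" by (simp add: power2_eq_square power3_eq_cube power4_eq_xxxx mult_ac)
        also have "\<dots> \<le> (K ^ 4 / iota * d) * \<phi> y ^ 4"
          by (rule mult_left_mono[OF \<phi>_power_mono]) (use iota_pos K_pos d0 in auto)
        finally show "\<bar>?k y * (\<eta> y / Bv y)\<bar> \<le> (K ^ 4 / iota * d) * \<phi> y ^ 4" .
      qed
      finally show ?thesis by (simp add: \<kappa>_def)
    qed
  qed
  also have "\<dots> = KA * d" by (simp add: KA_def \<kappa>_def)
  finally show ?thesis .
qed

end

section \<open>Linearisation with quadratic errors\<close>

context kernel_bounds begin

text \<open>These constants bound the increment \<open>\<beta>\<close>, the exponent
  \<open>\<alpha> + \<beta>\<close> and the second-order remainders, each up to powers of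
  \<open>\<phi>\<close> and \<open>d\<close>.\<close>

definition KB :: real where "KB = K * exp KA * (1 + KA)"
definition KT :: real where "KT = KA + KB"
definition KC :: real where "KC = K * KT\<^sup>2 + K * KT"

lemma KA_nonneg: "0 \<le> KA"
  using K_pos iota_pos Phi4_ge by (simp add: KA_def)

lemma KB_nonneg: "0 \<le> KB" and KT_nonneg: "0 \<le> KT" and KC_nonneg: "0 \<le> KC"
  using KA_nonneg K_pos by (simp_all add: KB_def KT_def KC_def)

end

text \<open>Compares the plan density of \<open>p\<close> with that of the base measure
  \<open>r\<close>. The condition at \<open>x0\<close> removes the freedom of an additive constant,
  and the same point is used for all marginals that are later combined.\<close>

locale kernel_pair = kernel_bounds s \<phi> K for s :: "'y pmf" and \<phi> K +
  fixes r p :: "'x pmf" and \<xi> \<xi>' :: "'x \<Rightarrow> 'y \<Rightarrow> real" and \<alpha> :: "'x \<Rightarrow> real" and \<beta> :: "'y \<Rightarrow> real"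
    and d :: real and x0 :: 'x
  assumes g: "good r \<xi>" and g': "good p \<xi>'" and d: "wdist (\<lambda>_. 1) p r \<le> ennreal d" and d0: "0 \<le> d" and d1: "d \<le> 1"
    and rel: "\<And>x y. y \<in> set_pmf s \<Longrightarrow> \<xi>' x y = \<xi> x y * exp (\<alpha> x + \<beta> y)"
    and bdd: "\<exists>A. \<forall>x. \<bar>\<alpha> x\<bar> \<le> A" and x0: "\<alpha> x0 = 0"
begin

lemma \<alpha>_le: "\<bar>\<alpha> x\<bar> \<le> KA * d"
proof -
  from bdd obtain A where A: "\<And>x. \<bar>\<alpha> x\<bar> \<le> A" by blast
  show ?thesis using alpha_osc[OF g g' d d0 rel A, of x x0] alpha_osc[OF g g' d d0 rel A, of x0 x] x0 by auto
qed

lemma \<alpha>_le': "\<bar>\<alpha> x\<bar> \<le> KA"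
  using \<alpha>_le[of x] mult_left_mono[OF d1 KA_nonneg] by simp

lemma exp_\<alpha>: "exp (\<alpha> x) \<le> exp KA" "exp (- \<alpha> x) \<le> exp KA"
  using \<alpha>_le'[of x] by auto

lemma exp_\<alpha>_diff: "\<bar>exp (\<alpha> x) - 1\<bar> \<le> KA * d * exp KA" "\<bar>exp (- \<alpha> x) - 1\<bar> \<le> KA * d * exp KA"
proof -
  have m: "max 1 (exp (\<alpha> x)) \<le> exp KA" "max 1 (exp (- \<alpha> x)) \<le> exp KA"
    using exp_\<alpha>[of x] KA_nonneg by auto
  have "\<bar>exp (\<alpha> x) - 1\<bar> \<le> \<bar>\<alpha> x\<bar> * max 1 (exp (\<alpha> x))" by (rule abs_exp_minus_one_le)
  also have "\<dots> \<le> KA * d * exp KA" by (rule mult_mono[OF \<alpha>_le m(1)]) (use KA_nonneg d0 in auto)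
  finally show "\<bar>exp (\<alpha> x) - 1\<bar> \<le> KA * d * exp KA" .
  have "\<bar>exp (- \<alpha> x) - 1\<bar> \<le> \<bar>- \<alpha> x\<bar> * max 1 (exp (- \<alpha> x))" by (rule abs_exp_minus_one_le)
  also have "\<dots> \<le> KA * d * exp KA" by (rule mult_mono[OF _ m(2)]) (use \<alpha>_le KA_nonneg d0 in auto)
  finally show "\<bar>exp (- \<alpha> x) - 1\<bar> \<le> KA * d * exp KA" .
qed

lemma \<xi>_bounds:
  assumes "y \<in> set_pmf s"
  shows "0 < \<xi> x y" "0 < \<xi>' x y" "\<xi> x y \<le> K * \<phi> y" "\<xi>' x y \<le> K * \<phi> y" "\<bar>\<xi> x y\<bar> \<le> K * \<phi> y" "\<bar>\<xi>' x y\<bar> \<le> K * \<phi> y"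
proof -
  have "0 < 1 / (K * \<phi> y)" using K_pos \<phi>_pos by simp
  moreover have "1 / (K * \<phi> y) \<le> \<xi> x y" "\<xi> x y \<le> K * \<phi> y" "1 / (K * \<phi> y) \<le> \<xi>' x y" "\<xi>' x y \<le> K * \<phi> y"
    using g g' assms by (auto simp: good_def)
  ultimately show "0 < \<xi> x y" "0 < \<xi>' x y" "\<xi> x y \<le> K * \<phi> y" "\<xi>' x y \<le> K * \<phi> y" "\<bar>\<xi> x y\<bar> \<le> K * \<phi> y" "\<bar>\<xi>' x y\<bar> \<le> K * \<phi> y"
    by linarith+
qed

lemma K\<phi>_nonneg: "0 \<le> K * \<phi> y" using K_pos \<phi>_pos by (simp add: less_imp_le)

lemma column:
  assumes "y \<in> set_pmf s"
  shows "(\<integral>x. \<xi> x y \<partial>r) = 1" "(\<integral>x. \<xi>' x y \<partial>p) = 1"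
  using g g' assms by (auto simp: good_def)

text \<open>Two exact column identities express \<open>exp (- \<beta> y)\<close> as an integral of
  \<open>\<xi> * exp \<alpha>\<close> against \<open>p\<close>, and \<open>exp (\<beta> y)\<close>
  as one of \<open>\<xi>' * exp (- \<alpha>)\<close> against \<open>r\<close>. Each yields a
  one-sided bound through \<open>1 + t \<le> exp t\<close>, without any prior bound on
  \<open>\<beta>\<close>.\<close>

lemma \<beta>_le:
  assumes y: "y \<in> set_pmf s"
  shows "\<bar>\<beta> y\<bar> \<le> KB * \<phi> y * d"
proof -
  note b = \<xi>_bounds[OF y]
  have KBe: "K * \<phi> y * exp KA * d + K * \<phi> y * (KA * d * exp KA) = KB * \<phi> y * d"
    by (simp add: KB_def algebra_simps)
  have u: "\<bar>\<xi> x y * exp (\<alpha> x)\<bar> \<le> K * \<phi> y * exp KA" "\<bar>\<xi>' x y * exp (- \<alpha> x)\<bar> \<le> K * \<phi> y * exp KA" for x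
    unfolding abs_mult by (rule mult_mono; use b exp_\<alpha> K\<phi>_nonneg in auto)+
  have v: "\<bar>\<xi> x y * (exp (\<alpha> x) - 1)\<bar> \<le> K * \<phi> y * (KA * d * exp KA)"
    "\<bar>\<xi>' x y * (exp (- \<alpha> x) - 1)\<bar> \<le> K * \<phi> y * (KA * d * exp KA)" for x
    unfolding abs_mult by (rule mult_mono; use b exp_\<alpha>_diff K\<phi>_nonneg in auto)+
  note iu = pmf_integrable_bounded[of "\<lambda>x. \<xi> x y * exp (\<alpha> x)", OF u(1)] pmf_integrable_bounded[of "\<lambda>x. \<xi>' x y * exp (- \<alpha> x)", OF u(2)]
  note i = pmf_integrable_bounded[of "\<lambda>x. \<xi> x y", OF b(5)] pmf_integrable_bounded[of "\<lambda>x. \<xi>' x y", OF b(6)]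
  have "- \<beta> y \<le> exp (- \<beta> y) - 1" using exp_ge_add_one_self[of "- \<beta> y"] by linarith
  also have "exp (- \<beta> y) - 1 = ((\<integral>x. \<xi> x y * exp (\<alpha> x) \<partial>p) - (\<integral>x. \<xi> x y * exp (\<alpha> x) \<partial>r))
      + (\<integral>x. \<xi> x y * (exp (\<alpha> x) - 1) \<partial>r)"
  proof -
    have "(\<integral>x. \<xi> x y * exp (\<alpha> x) \<partial>p) = (\<integral>x. exp (- \<beta> y) * \<xi>' x y \<partial>p)"
      by (rule Bochner_Integration.integral_cong) (simp_all add: rel[OF y] exp_add exp_minus field_simps)
    also have "\<dots> = exp (- \<beta> y)" using column(2)[OF y] by simp
    finally show ?thesis using iu i column(1)[OF y] by (simp add: right_diff_distrib)
  qed
  also have "\<dots> \<le> K * \<phi> y * exp KA * d + K * \<phi> y * (KA * d * exp KA)"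
    using expectation_diff_bounded[where F="\<lambda>x. \<xi> x y * exp (\<alpha> x)", OF d d0 u(1)] pmf_integral_bounded[of "\<lambda>x. \<xi> x y * (exp (\<alpha> x) - 1)", OF v(1), of r] by linarith
  finally have 1: "- \<beta> y \<le> KB * \<phi> y * d" by (simp only: KBe)
  have "\<beta> y \<le> exp (\<beta> y) - 1" using exp_ge_add_one_self[of "\<beta> y"] by linarith
  also have "exp (\<beta> y) - 1 = - ((\<integral>x. \<xi>' x y * exp (- \<alpha> x) \<partial>p) - (\<integral>x. \<xi>' x y * exp (- \<alpha> x) \<partial>r))
      + (\<integral>x. \<xi>' x y * (exp (- \<alpha> x) - 1) \<partial>p)"
  proof -
    have "(\<integral>x. \<xi>' x y * exp (- \<alpha> x) \<partial>r) = (\<integral>x. exp (\<beta> y) * \<xi> x y \<partial>r)"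
      by (simp add: rel[OF y] exp_add exp_minus field_simps)
    also have "\<dots> = exp (\<beta> y)" using column(1)[OF y] by simp
    finally show ?thesis using iu i column(2)[OF y] by (simp add: right_diff_distrib)
  qed
  also have "\<dots> \<le> K * \<phi> y * exp KA * d + K * \<phi> y * (KA * d * exp KA)"
    using expectation_diff_bounded[where F="\<lambda>x. \<xi>' x y * exp (- \<alpha> x)", OF d d0 u(2)] pmf_integral_bounded[of "\<lambda>x. \<xi>' x y * (exp (- \<alpha> x) - 1)", OF v(2), of p] by linarith
  finally have 2: "\<beta> y \<le> KB * \<phi> y * d" by (simp only: KBe)
  from 1 2 show ?thesis by linarith
qed

lemma t_le:
  assumes y: "y \<in> set_pmf s"
  shows "\<bar>\<alpha> x + \<beta> y\<bar> \<le> KT * \<phi> y * d"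
proof -
  have "KA * d \<le> KA * \<phi> y * d"
    using mult_right_mono[OF mult_left_mono[OF \<phi>_ge KA_nonneg] d0] by simp
  then show ?thesis using \<alpha>_le[of x] \<beta>_le[OF y] by (simp add: KT_def algebra_simps)
qed

text \<open>The product is the larger of \<open>\<xi>\<close> and \<open>\<xi>'\<close>; exponential
  factors in Taylor remainders are thus absorbed by the a priori bounds.\<close>

lemma \<xi>_max:
  assumes y: "y \<in> set_pmf s"
  shows "\<xi> x y * max 1 (exp (\<alpha> x + \<beta> y)) \<le> K * \<phi> y"
  using \<xi>_bounds[OF y, of x] rel[OF y, of x] by (simp add: max_def)

lemma diff_le:
  assumes y: "y \<in> set_pmf s"
  shows "\<bar>\<xi>' x y - \<xi> x y\<bar> \<le> K * KT * \<phi> y ^ 2 * d"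
proof -
  let ?t = "\<alpha> x + \<beta> y"
  have "\<xi>' x y - \<xi> x y = \<xi> x y * (exp ?t - 1)" by (simp add: rel[OF y] right_diff_distrib)
  then have "\<bar>\<xi>' x y - \<xi> x y\<bar> = \<xi> x y * \<bar>exp ?t - 1\<bar>" using \<xi>_bounds(1)[OF y, of x] by (simp add: abs_mult)
  also have "\<dots> \<le> \<xi> x y * (\<bar>?t\<bar> * max 1 (exp ?t))"
    by (intro mult_left_mono abs_exp_minus_one_le less_imp_le \<xi>_bounds(1) y)
  also have "\<dots> = \<bar>?t\<bar> * (\<xi> x y * max 1 (exp ?t))" by simp
  also have "\<dots> \<le> (KT * \<phi> y * d) * (K * \<phi> y)"
    by (rule mult_mono[OF t_le[OF y] \<xi>_max[OF y]])
      (use KT_nonneg d0 \<phi>_pos[of y] \<xi>_bounds(1)[OF y, of x] in \<open>auto simp: less_imp_le max_def\<close>)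
  finally show ?thesis by (simp add: power2_eq_square mult_ac)
qed

lemma taylor_le:
  assumes y: "y \<in> set_pmf s"
  shows "\<bar>\<xi>' x y - \<xi> x y - \<xi> x y * (\<alpha> x + \<beta> y)\<bar> \<le> K * KT\<^sup>2 * \<phi> y ^ 3 * d\<^sup>2"
proof -
  let ?t = "\<alpha> x + \<beta> y"
  have "\<xi>' x y - \<xi> x y - \<xi> x y * ?t = \<xi> x y * (exp ?t - 1 - ?t)" by (simp add: rel[OF y] right_diff_distrib)
  then have "\<bar>\<xi>' x y - \<xi> x y - \<xi> x y * ?t\<bar> = \<xi> x y * \<bar>exp ?t - 1 - ?t\<bar>" using \<xi>_bounds(1)[OF y, of x] by (simp add: abs_mult)
  also have "\<dots> \<le> \<xi> x y * (?t\<^sup>2 * max 1 (exp ?t))"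
    by (intro mult_left_mono abs_exp_taylor2_le less_imp_le \<xi>_bounds(1) y)
  also have "\<dots> = \<bar>?t\<bar>\<^sup>2 * (\<xi> x y * max 1 (exp ?t))" by simp
  also have "\<dots> \<le> (KT * \<phi> y * d)\<^sup>2 * (K * \<phi> y)"
    by (rule mult_mono[OF power_mono[OF t_le[OF y]] \<xi>_max[OF y]])
      (use \<xi>_bounds(1)[OF y, of x] in \<open>auto simp: less_imp_le max_def\<close>)
  finally show ?thesis by (simp add: power2_eq_square power3_eq_cube mult_ac)
qed

text \<open>Rows of both densities have mass one, so the linear term is exactly minus a second-order
  Taylor remainder.\<close>

lemma row_linear: "\<bar>\<alpha> x + (\<integral>y. \<xi> x y * \<beta> y \<partial>s)\<bar> \<le> KC * d\<^sup>2 * Phi4"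
  and \<xi>\<beta>_int: "integrable (measure_pmf s) (\<lambda>y. \<xi> x y * \<beta> y)"
proof -
  show i: "integrable (measure_pmf s) (\<lambda>y. \<xi> x y * \<beta> y)"
  proof (rule int_s(1))
    fix y assume y: "y \<in> set_pmf s"
    have "\<bar>\<xi> x y * \<beta> y\<bar> \<le> (K * \<phi> y) * (KB * \<phi> y * d)"
      unfolding abs_mult by (rule mult_mono[OF \<xi>_bounds(5)[OF y] \<beta>_le[OF y]]) (use K\<phi>_nonneg in auto)
    also have "\<dots> = K * KB * d * \<phi> y ^ 2" by (simp add: power2_eq_square mult_ac)
    also have "\<dots> \<le> K * KB * d * \<phi> y ^ 4"
      by (rule mult_left_mono[OF \<phi>_power_mono]) (use K_pos KB_nonneg d0 in auto)
    finally show "\<bar>\<xi> x y * \<beta> y\<bar> \<le> K * KB * d * \<phi> y ^ 4" .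
  qed
  note gi = good_int[OF g, of x] good_int[OF g', of x]
  have "\<alpha> x + (\<integral>y. \<xi> x y * \<beta> y \<partial>s) = - (\<integral>y. \<xi>' x y - \<xi> x y - \<xi> x y * (\<alpha> x + \<beta> y) \<partial>s)"
    using gi i g g' by (simp add: distrib_left good_def)
  then have "\<bar>\<alpha> x + (\<integral>y. \<xi> x y * \<beta> y \<partial>s)\<bar> = \<bar>\<integral>y. \<xi>' x y - \<xi> x y - \<xi> x y * (\<alpha> x + \<beta> y) \<partial>s\<bar>" by simp
  also have "\<dots> \<le> (KC * d\<^sup>2) * Phi4"
  proof (rule int_s(2))
    fix y assume y: "y \<in> set_pmf s"
    have "\<bar>\<xi>' x y - \<xi> x y - \<xi> x y * (\<alpha> x + \<beta> y)\<bar> \<le> K * KT\<^sup>2 * d\<^sup>2 * \<phi> y ^ 3"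
      using taylor_le[OF y, of x] by (simp add: mult_ac)
    also have "\<dots> \<le> (KC * d\<^sup>2) * \<phi> y ^ 4"
      by (rule mult_mono[OF mult_right_mono \<phi>_power_mono])
        (use K_pos KT_nonneg KC_nonneg \<phi>_pos[of y] in \<open>auto simp: KC_def\<close>)
    finally show "\<bar>\<xi>' x y - \<xi> x y - \<xi> x y * (\<alpha> x + \<beta> y)\<bar> \<le> (KC * d\<^sup>2) * \<phi> y ^ 4" .
  qed
  finally show "\<bar>\<alpha> x + (\<integral>y. \<xi> x y * \<beta> y \<partial>s)\<bar> \<le> KC * d\<^sup>2 * Phi4" .
qed

lemma \<xi>\<alpha>_int:
  assumes y: "y \<in> set_pmf s"
  shows "integrable (measure_pmf q) (\<lambda>x. \<xi> x y * \<alpha> x)"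
proof (rule pmf_integrable_bounded)
  show "\<bar>\<xi> x y * \<alpha> x\<bar> \<le> (K * \<phi> y) * KA" for x
    unfolding abs_mult by (rule mult_mono[OF \<xi>_bounds(5)[OF y] \<alpha>_le']) (use K\<phi>_nonneg in auto)
qed

text \<open>The densities are normalised under different marginals, which produces the source term,
  the integral of \<open>\<xi>\<close> against \<open>p\<close> minus \<open>r\<close>. Having
  \<open>\<xi>\<close> there in place of \<open>\<xi>'\<close> costs a product of two first-order
  quantities.\<close>

lemma column_linear:
  assumes y: "y \<in> set_pmf s"
  shows "\<bar>\<beta> y + (\<integral>x. \<xi> x y * \<alpha> x \<partial>r) + ((\<integral>x. \<xi> x y \<partial>p) - (\<integral>x. \<xi> x y \<partial>r))\<bar> \<le> KC * \<phi> y ^ 3 * d\<^sup>2"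
proof -
  let ?D = "\<lambda>x. \<xi>' x y - \<xi> x y" and ?R = "\<lambda>x. \<xi>' x y - \<xi> x y - \<xi> x y * (\<alpha> x + \<beta> y)"
  note i = pmf_integrable_bounded[of "\<lambda>x. \<xi> x y", OF \<xi>_bounds(5)[OF y]] pmf_integrable_bounded[of "\<lambda>x. \<xi>' x y", OF \<xi>_bounds(6)[OF y]]
  have R: "(\<integral>x. ?R x \<partial>r) = (\<integral>x. \<xi>' x y \<partial>r) - 1 - (\<integral>x. \<xi> x y * \<alpha> x \<partial>r) - \<beta> y"
    using i \<xi>\<alpha>_int[OF y] column(1)[OF y] by (simp add: distrib_left)
  have D: "(\<integral>x. ?D x \<partial>p) - (\<integral>x. ?D x \<partial>r) = 1 - (\<integral>x. \<xi> x y \<partial>p) - (\<integral>x. \<xi>' x y \<partial>r) + (\<integral>x. \<xi> x y \<partial>r)"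
    using i column(2)[OF y] by simp
  have "\<beta> y + (\<integral>x. \<xi> x y * \<alpha> x \<partial>r) + ((\<integral>x. \<xi> x y \<partial>p) - (\<integral>x. \<xi> x y \<partial>r))
    = - (\<integral>x. ?R x \<partial>r) - ((\<integral>x. ?D x \<partial>p) - (\<integral>x. ?D x \<partial>r))" unfolding R D by simp
  moreover have "\<bar>\<integral>x. ?R x \<partial>r\<bar> \<le> K * KT\<^sup>2 * \<phi> y ^ 3 * d\<^sup>2"
    by (rule pmf_integral_bounded[OF taylor_le[OF y]])
  moreover have "\<bar>(\<integral>x. ?D x \<partial>p) - (\<integral>x. ?D x \<partial>r)\<bar> \<le> K * KT * \<phi> y ^ 2 * d * d"
    by (rule expectation_diff_bounded[OF d d0 diff_le[OF y]])
  ultimately have "\<bar>\<beta> y + (\<integral>x. \<xi> x y * \<alpha> x \<partial>r) + ((\<integral>x. \<xi> x y \<partial>p) - (\<integral>x. \<xi> x y \<partial>r))\<bar>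
    \<le> K * KT\<^sup>2 * \<phi> y ^ 3 * d\<^sup>2 + K * KT * \<phi> y ^ 2 * d * d"
    by linarith
  also have "\<dots> \<le> K * KT\<^sup>2 * \<phi> y ^ 3 * d\<^sup>2 + K * KT * \<phi> y ^ 3 * d\<^sup>2"
    unfolding power2_eq_square[of d] mult.assoc[symmetric]
    by (intro add_left_mono mult_right_mono mult_left_mono \<phi>_power_mono) (use K_pos KT_nonneg d0 in auto)
  also have "\<dots> = KC * \<phi> y ^ 3 * d\<^sup>2" by (simp add: KC_def distrib_right)
  finally show ?thesis .
qed

text \<open>The product rule: what remains is the product of the two increments plus the Taylor
  remainder of the density.\<close>

lemma plan_linear:
  assumes y: "y \<in> set_pmf s"
  shows "\<bar>pmf p x * \<xi>' x y - pmf r x * \<xi> x y - ((pmf p x - pmf r x) * \<xi> x y + pmf r x * (\<xi> x y * (\<alpha> x + \<beta> y)))\<bar>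
    \<le> KC * \<phi> y ^ 4 * (\<bar>pmf p x - pmf r x\<bar> * d + pmf r x * d\<^sup>2)"
proof -
  have c: "K * KT \<le> KC" "K * KT\<^sup>2 \<le> KC" using K_pos KT_nonneg by (simp_all add: KC_def)
  have e: "pmf p x * \<xi>' x y - pmf r x * \<xi> x y - ((pmf p x - pmf r x) * \<xi> x y + pmf r x * (\<xi> x y * (\<alpha> x + \<beta> y)))
    = (pmf p x - pmf r x) * (\<xi>' x y - \<xi> x y) + pmf r x * (\<xi>' x y - \<xi> x y - \<xi> x y * (\<alpha> x + \<beta> y))"
    by (simp add: algebra_simps)
  have "\<bar>\<dots>\<bar> \<le> \<bar>(pmf p x - pmf r x) * (\<xi>' x y - \<xi> x y)\<bar> + \<bar>pmf r x * (\<xi>' x y - \<xi> x y - \<xi> x y * (\<alpha> x + \<beta> y))\<bar>"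
    by (rule abs_triangle_ineq)
  also have "\<dots> \<le> \<bar>pmf p x - pmf r x\<bar> * (KC * \<phi> y ^ 4 * d) + pmf r x * (KC * \<phi> y ^ 4 * d\<^sup>2)"
    unfolding abs_mult abs_of_nonneg[OF pmf_nonneg]
  proof (intro add_mono mult_left_mono order_trans[OF diff_le[OF y]] order_trans[OF taylor_le[OF y]] mult_right_mono)
    show "K * KT * \<phi> y ^ 2 \<le> KC * \<phi> y ^ 4"
      by (rule mult_mono[OF c(1) \<phi>_power_mono]) (use KC_nonneg in auto)
    show "K * KT\<^sup>2 * \<phi> y ^ 3 \<le> KC * \<phi> y ^ 4"
      by (rule mult_mono[OF c(2) \<phi>_power_mono]) (use KC_nonneg \<phi>_pos[of y] in auto)
  qed (use d0 in auto)
  also have "\<dots> = KC * \<phi> y ^ 4 * (\<bar>pmf p x - pmf r x\<bar> * d + pmf r x * d\<^sup>2)" by (simp add: algebra_simps)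
  finally show ?thesis unfolding e .
qed

end

section \<open>Four-point differences of densities\<close>

context kernel_bounds begin

text \<open>\<open>KD\<close> bounds the error fed into \<open>doeblin_osc\<close>,
  \<open>KG\<close> is the resulting bound for the minorization constant \<open>1 / K\<close> of
  \<open>\<xi>\<close>; \<open>KH\<close> adds the second increment and \<open>KF\<close> collects
  all terms of the plan.\<close>

definition KD :: real where "KD = KC * Phi4 + K * (KC + K) * Phi4"
definition KG :: real where "KG = 2 * KD / (1 / K * iota)"
definition KH :: real where "KH = KG + K * KG + K + KC"
definition KF :: real where "KF = K + K * KH + KC"

lemma KG_nonneg: "0 \<le> KG" and KH_nonneg: "0 \<le> KH" and KF_nonneg: "0 \<le> KF"
proof -
  have "0 \<le> KD" using KC_nonneg K_pos Phi4_ge by (simp add: KD_def)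
  then show "0 \<le> KG" using iota_pos K_pos by (simp add: KG_def)
  then show "0 \<le> KH" using K_pos KC_nonneg by (simp add: KH_def)
  then show "0 \<le> KF" using K_pos KC_nonneg by (simp add: KF_def)
qed

text \<open>The linearised systems of the three marginals have the same kernel \<open>\<xi>\<close>,
  so the combinations \<open>\<alpha>\<close> and \<open>\<beta>\<close> solve it with the
  four-point difference as source, up to the quadratic error \<open>q\<close>. The Doeblin bound
  applies to them directly, and no derivative has to be identified.\<close>

lemma four_point_kernel:
  fixes r p2 p3 p4 :: "'x pmf"
  assumes P2: "kernel_pair s \<phi> K r p2 \<xi> \<xi>2 \<alpha>2 \<beta>2 d2 x0" and P3: "kernel_pair s \<phi> K r p3 \<xi> \<xi>3 \<alpha>3 \<beta>3 d3 x0"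
    and P4: "kernel_pair s \<phi> K r p4 \<xi> \<xi>4 \<alpha>4 \<beta>4 d4 x0"
    and e: "wnorm (\<lambda>_. 1) (\<lambda>x. pmf p4 x - pmf p3 x - (pmf p2 x - pmf r x)) \<le> ennreal e" and e0: "0 \<le> e"
    and y: "y \<in> set_pmf s"
  defines "q \<equiv> d2\<^sup>2 + d3\<^sup>2 + d4\<^sup>2"
  shows "\<bar>pmf p4 x * \<xi>4 x y - pmf p3 x * \<xi>3 x y - (pmf p2 x * \<xi>2 x y - pmf r x * \<xi> x y)\<bar>
    \<le> KF * \<phi> y ^ 4 * (\<bar>pmf p4 x - pmf p3 x - (pmf p2 x - pmf r x)\<bar> + pmf r x * (e + q)
        + (\<bar>pmf p2 x - pmf r x\<bar> * d2 + \<bar>pmf p3 x - pmf r x\<bar> * d3 + \<bar>pmf p4 x - pmf r x\<bar> * d4))"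
proof -
  interpret P2: kernel_pair s \<phi> K r p2 \<xi> \<xi>2 \<alpha>2 \<beta>2 d2 x0 by (rule P2)
  interpret P3: kernel_pair s \<phi> K r p3 \<xi> \<xi>3 \<alpha>3 \<beta>3 d3 x0 by (rule P3)
  interpret P4: kernel_pair s \<phi> K r p4 \<xi> \<xi>4 \<alpha>4 \<beta>4 d4 x0 by (rule P4)
  have q0: "0 \<le> q" by (simp add: q_def)
  have eq0: "0 \<le> e + q" using e0 q0 by simp
  let ?\<Delta> = "\<lambda>x. pmf p4 x - pmf p3 x - (pmf p2 x - pmf r x)"
  \<comment> \<open>The increment belonging to \<open>r\<close> itself is zero, so three terms
    express the four-point difference.\<close>
  define \<alpha> where "\<alpha> x = \<alpha>4 x - \<alpha>3 x - \<alpha>2 x" for x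
  define \<beta> where "\<beta> y = \<beta>4 y - \<beta>3 y - \<beta>2 y" for y
  define \<gamma> where "\<gamma> y = (\<integral>x. \<xi> x y * \<alpha> x \<partial>r)" for y
  define \<eta> where "\<eta> y = (\<integral>x. ?\<Delta> x * \<xi> x y \<partial>count_space UNIV)" for y
  have \<eta>_le: "\<bar>\<eta> y\<bar> \<le> K * \<phi> y * e" if y: "y \<in> set_pmf s" for y
  proof -
    have "ennreal \<bar>\<eta> y\<bar> \<le> wnorm (\<lambda>_. (K * \<phi> y) * 1) ?\<Delta>"
      unfolding \<eta>_def by (rule wnorm_integral_le) (use P2.\<xi>_bounds(5)[OF y] in simp)
    also have "\<dots> = ennreal (K * \<phi> y) * wnorm (\<lambda>_. 1) ?\<Delta>" by (rule wnorm_cmult[OF P2.K\<phi>_nonneg])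
    also have "\<dots> \<le> ennreal (K * \<phi> y) * ennreal e" by (rule mult_left_mono[OF e]) simp
    finally show ?thesis using P2.K\<phi>_nonneg[of y] e0 by (simp add: ennreal_mult[symmetric])
  qed
  have \<eta>_eq: "\<eta> y = ((\<integral>x. \<xi> x y \<partial>p4) - (\<integral>x. \<xi> x y \<partial>r)) - ((\<integral>x. \<xi> x y \<partial>p3) - (\<integral>x. \<xi> x y \<partial>r)) - ((\<integral>x. \<xi> x y \<partial>p2) - (\<integral>x. \<xi> x y \<partial>r))"
    if y: "y \<in> set_pmf s" for y
  proof -
    have i: "integrable (count_space UNIV) (\<lambda>x. pmf a x * \<xi> x y)" for a
      using pmf_integrable_bounded[of "\<lambda>x. \<xi> x y", OF P2.\<xi>_bounds(5)[OF y], of a] by (simp add: integrable_pmf_count_space)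
    show ?thesis using i unfolding \<eta>_def by (simp add: integral_pmf_count_space left_diff_distrib)
  qed
  have \<gamma>_eq: "\<gamma> y = (\<integral>x. \<xi> x y * \<alpha>4 x \<partial>r) - (\<integral>x. \<xi> x y * \<alpha>3 x \<partial>r) - (\<integral>x. \<xi> x y * \<alpha>2 x \<partial>r)"
    if y: "y \<in> set_pmf s" for y
    using P2.\<xi>\<alpha>_int[OF y] P3.\<xi>\<alpha>_int[OF y] P4.\<xi>\<alpha>_int[OF y] by (simp add: \<gamma>_def \<alpha>_def right_diff_distrib)
  have col: "\<bar>\<beta> y + \<gamma> y + \<eta> y\<bar> \<le> KC * \<phi> y ^ 3 * q" if y: "y \<in> set_pmf s" for y
    using P2.column_linear[OF y] P3.column_linear[OF y] P4.column_linear[OF y]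
    unfolding \<beta>_def \<gamma>_eq[OF y] \<eta>_eq[OF y] q_def distrib_left by linarith
  have row: "\<bar>\<alpha> x + (\<integral>y. \<xi> x y * \<beta> y \<partial>s)\<bar> \<le> KC * Phi4 * q" for x
  proof -
    have "(\<integral>y. \<xi> x y * \<beta> y \<partial>s) = (\<integral>y. \<xi> x y * \<beta>4 y \<partial>s) - (\<integral>y. \<xi> x y * \<beta>3 y \<partial>s) - (\<integral>y. \<xi> x y * \<beta>2 y \<partial>s)"
      using P2.\<xi>\<beta>_int P3.\<xi>\<beta>_int P4.\<xi>\<beta>_int by (simp add: \<beta>_def right_diff_distrib)
    moreover have "KC * Phi4 * q = KC * d2\<^sup>2 * Phi4 + KC * d3\<^sup>2 * Phi4 + KC * d4\<^sup>2 * Phi4"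
      by (simp add: q_def algebra_simps)
    ultimately show ?thesis
      using P2.row_linear[of x] P3.row_linear[of x] P4.row_linear[of x] unfolding \<alpha>_def by linarith
  qed
  have ab: "\<bar>\<alpha> x\<bar> \<le> 3 * KA" for x
    using P2.\<alpha>_le'[of x] P3.\<alpha>_le'[of x] P4.\<alpha>_le'[of x] unfolding \<alpha>_def by linarith
  have bg: "\<bar>\<beta> y + \<gamma> y\<bar> \<le> (KC * q + K * e) * \<phi> y ^ 3" if y: "y \<in> set_pmf s" for y
  proof -
    have "K * \<phi> y * e \<le> K * e * \<phi> y ^ 3"
      using mult_left_mono[OF \<phi>_le_power[of 3 y], of "K * e"] K_pos e0 by (simp add: mult_ac)
    then show ?thesis using col[OF y] \<eta>_le[OF y] by (simp add: algebra_simps abs_le_iff)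
  qed
  have \<xi>\<gamma>i: "integrable (measure_pmf s) (\<lambda>y. \<xi> x y * \<gamma> y)" for x
  proof (rule int_s(1))
    fix y assume y: "y \<in> set_pmf s"
    have "\<bar>\<gamma> y\<bar> \<le> K * \<phi> y * (3 * KA)" unfolding \<gamma>_def
      by (rule pmf_integral_bounded, unfold abs_mult, rule mult_mono[OF P2.\<xi>_bounds(5)[OF y] ab]) (use P2.K\<phi>_nonneg in auto)
    then have "\<bar>\<xi> x y * \<gamma> y\<bar> \<le> (K * \<phi> y) * (K * \<phi> y * (3 * KA))"
      unfolding abs_mult by (intro mult_mono P2.\<xi>_bounds(5)[OF y] P2.K\<phi>_nonneg) auto
    also have "\<dots> = K\<^sup>2 * (3 * KA) * \<phi> y ^ 2" by (simp add: power2_eq_square mult_ac)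
    also have "\<dots> \<le> K\<^sup>2 * (3 * KA) * \<phi> y ^ 4"
      by (rule mult_left_mono[OF \<phi>_power_mono]) (use KA_nonneg in auto)
    finally show "\<bar>\<xi> x y * \<gamma> y\<bar> \<le> K\<^sup>2 * (3 * KA) * \<phi> y ^ 4" .
  qed
  have \<xi>\<beta>i: "integrable (measure_pmf s) (\<lambda>y. \<xi> x y * \<beta> y)" for x
    using P2.\<xi>\<beta>_int P3.\<xi>\<beta>_int P4.\<xi>\<beta>_int by (simp add: \<beta>_def right_diff_distrib)
  have osc: "\<alpha> x - \<alpha> x' \<le> KG * (e + q)" for x x'
  proof -
    have "\<alpha> x - \<alpha> x' \<le> 2 * (KD * (e + q)) / (1 / K * iota)"
    proof (rule doeblin_osc[where k=\<xi> and \<gamma>=\<gamma> and A="3 * KA"])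
      show "0 < 1 / K" using K_pos by simp
      show "1 / K / \<phi> y \<le> \<xi> x y" if "y \<in> set_pmf s" for x y
        using P2.g that by (simp add: good_def)
      show "integrable (measure_pmf s) (\<xi> x)" for x by (rule good_int[OF P2.g])
      show "(\<integral>y. \<xi> x y \<partial>s) = 1" for x using P2.g by (simp add: good_def)
      show "m \<le> \<gamma> y \<and> \<gamma> y \<le> S" if m: "\<And>x. m \<le> \<alpha> x" and S: "\<And>x. \<alpha> x \<le> S" and y: "y \<in> set_pmf s" for m S y
      proof -
        note i = pmf_integrable_bounded[of "\<lambda>x. \<xi> x y", OF P2.\<xi>_bounds(5)[OF y], of r]
        have ia: "integrable (measure_pmf r) (\<lambda>x. \<xi> x y * \<alpha> x)"
          using P2.\<xi>\<alpha>_int[OF y] P3.\<xi>\<alpha>_int[OF y] P4.\<xi>\<alpha>_int[OF y] by (simp add: \<alpha>_def right_diff_distrib)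
        have "(\<integral>x. m * \<xi> x y \<partial>r) \<le> \<gamma> y" "\<gamma> y \<le> (\<integral>x. S * \<xi> x y \<partial>r)" unfolding \<gamma>_def
          by (rule integral_mono; use i ia m S P2.\<xi>_bounds(1)[OF y] in \<open>auto simp: mult.commute intro!: mult_right_mono less_imp_le\<close>)+
        then show ?thesis using P2.column(1)[OF y] by simp
      qed
      show "\<bar>\<alpha> x - (\<integral>y. \<xi> x y * \<gamma> y \<partial>s)\<bar> \<le> KD * (e + q)" for x
      proof -
        \<comment> \<open>The row equation minus the column equations averaged against
          \<open>\<xi>\<close>, which eliminates \<open>\<beta>\<close>.\<close>
        have "\<alpha> x - (\<integral>y. \<xi> x y * \<gamma> y \<partial>s) = (\<alpha> x + (\<integral>y. \<xi> x y * \<beta> y \<partial>s)) - (\<integral>y. \<xi> x y * (\<beta> y + \<gamma> y) \<partial>s)"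
          using \<xi>\<gamma>i \<xi>\<beta>i by (simp add: distrib_left)
        moreover have "\<bar>\<integral>y. \<xi> x y * (\<beta> y + \<gamma> y) \<partial>s\<bar> \<le> (K * (KC * q + K * e)) * Phi4"
        proof (rule int_s(2))
          fix y assume y: "y \<in> set_pmf s"
          have "\<bar>\<xi> x y * (\<beta> y + \<gamma> y)\<bar> \<le> (K * \<phi> y) * ((KC * q + K * e) * \<phi> y ^ 3)"
            unfolding abs_mult by (rule mult_mono[OF P2.\<xi>_bounds(5)[OF y] bg[OF y]]) (use P2.K\<phi>_nonneg in auto)
          also have "\<dots> = (K * (KC * q + K * e)) * \<phi> y ^ 4" by (simp add: power3_eq_cube power4_eq_xxxx)
          finally show "\<bar>\<xi> x y * (\<beta> y + \<gamma> y)\<bar> \<le> (K * (KC * q + K * e)) * \<phi> y ^ 4" .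
        qed
        moreover have "KC * Phi4 * q + (K * (KC * q + K * e)) * Phi4 \<le> KD * (e + q)"
        proof -
          have n: "0 \<le> KC * Phi4 * e" "0 \<le> K * KC * Phi4 * e" "0 \<le> K * K * Phi4 * q"
            using KC_nonneg Phi4_ge K_pos e0 q0 by auto
          have "KD * (e + q) = (KC * Phi4 * q + (K * (KC * q + K * e)) * Phi4) + (KC * Phi4 * e + K * KC * Phi4 * e + K * K * Phi4 * q)"
            by (simp add: KD_def algebra_simps)
          with n show ?thesis by linarith
        qed
        ultimately show ?thesis using row[of x] by linarith
      qed
    qed (use ab in auto)
    then show ?thesis by (simp add: KG_def mult_ac)
  qed
  have "\<alpha> x0 = 0" using P2.x0 P3.x0 P4.x0 by (simp add: \<alpha>_def)
  then have al: "\<bar>\<alpha> x\<bar> \<le> KG * (e + q)" for x using osc[of x x0] osc[of x0 x] by auto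
  have \<gamma>_le: "\<bar>\<gamma> y\<bar> \<le> K * \<phi> y * (KG * (e + q))" unfolding \<gamma>_def
    by (rule pmf_integral_bounded, unfold abs_mult, rule mult_mono[OF P2.\<xi>_bounds(5)[OF y] al]) (use P2.K\<phi>_nonneg in auto)
  have tb: "\<bar>\<alpha> x + \<beta> y\<bar> \<le> KH * (e + q) * \<phi> y ^ 3"
  proof -
    have f: "KG * (e + q) \<le> KG * (e + q) * \<phi> y ^ 3" "K * \<phi> y * (KG * (e + q)) \<le> K * KG * (e + q) * \<phi> y ^ 3"
      using mult_left_mono[OF one_le_\<phi>_power[of y 3], of "KG * (e + q)"]
        mult_left_mono[OF \<phi>_le_power[of 3 y], of "K * KG * (e + q)"] KG_nonneg eq0 K_pos by (simp_all add: mult_ac)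
    have h: "(KC * q + K * e) * \<phi> y ^ 3 \<le> (K + KC) * (e + q) * \<phi> y ^ 3"
      by (rule mult_right_mono) (use KC_nonneg K_pos e0 q0 \<phi>_pos[of y] in \<open>auto simp: algebra_simps\<close>)
    have "KH * (e + q) * \<phi> y ^ 3 = KG * (e + q) * \<phi> y ^ 3 + K * KG * (e + q) * \<phi> y ^ 3 + (K + KC) * (e + q) * \<phi> y ^ 3"
      by (simp add: KH_def algebra_simps)
    then show ?thesis using f h al[of x] \<gamma>_le bg[OF y] by linarith
  qed
  let ?T = "\<lambda>pi \<xi>i \<alpha>i \<beta>i. pmf pi x * \<xi>i x y - pmf r x * \<xi> x y - ((pmf pi x - pmf r x) * \<xi> x y + pmf r x * (\<xi> x y * (\<alpha>i x + \<beta>i y)))"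
  have "pmf p4 x * \<xi>4 x y - pmf p3 x * \<xi>3 x y - (pmf p2 x * \<xi>2 x y - pmf r x * \<xi> x y)
    = ?\<Delta> x * \<xi> x y + pmf r x * (\<xi> x y * (\<alpha> x + \<beta> y)) + ?T p4 \<xi>4 \<alpha>4 \<beta>4 - ?T p3 \<xi>3 \<alpha>3 \<beta>3 - ?T p2 \<xi>2 \<alpha>2 \<beta>2"
    by (simp add: \<alpha>_def \<beta>_def algebra_simps)
  then have "\<bar>pmf p4 x * \<xi>4 x y - pmf p3 x * \<xi>3 x y - (pmf p2 x * \<xi>2 x y - pmf r x * \<xi> x y)\<bar>
    \<le> \<bar>?\<Delta> x * \<xi> x y\<bar> + \<bar>pmf r x * (\<xi> x y * (\<alpha> x + \<beta> y))\<bar> + \<bar>?T p4 \<xi>4 \<alpha>4 \<beta>4\<bar> + \<bar>?T p3 \<xi>3 \<alpha>3 \<beta>3\<bar> + \<bar>?T p2 \<xi>2 \<alpha>2 \<beta>2\<bar>"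
    by linarith
  also have "\<dots> \<le> \<bar>?\<Delta> x\<bar> * (K * \<phi> y ^ 4) + pmf r x * (K * KH * (e + q) * \<phi> y ^ 4)
     + KC * \<phi> y ^ 4 * (\<bar>pmf p4 x - pmf r x\<bar> * d4 + pmf r x * d4\<^sup>2)
     + KC * \<phi> y ^ 4 * (\<bar>pmf p3 x - pmf r x\<bar> * d3 + pmf r x * d3\<^sup>2)
     + KC * \<phi> y ^ 4 * (\<bar>pmf p2 x - pmf r x\<bar> * d2 + pmf r x * d2\<^sup>2)"
  proof (intro add_mono P2.plan_linear P3.plan_linear P4.plan_linear y)
    have "K * \<phi> y \<le> K * \<phi> y ^ 4" using \<phi>_le_power[of 4 y] K_pos by simp
    from mult_left_mono[OF order_trans[OF P2.\<xi>_bounds(5)[OF y] this]]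
    show "\<bar>?\<Delta> x * \<xi> x y\<bar> \<le> \<bar>?\<Delta> x\<bar> * (K * \<phi> y ^ 4)"
      unfolding abs_mult by simp
    have "\<bar>\<xi> x y * (\<alpha> x + \<beta> y)\<bar> \<le> (K * \<phi> y) * (KH * (e + q) * \<phi> y ^ 3)"
      unfolding abs_mult by (rule mult_mono[OF P2.\<xi>_bounds(5)[OF y] tb]) (use P2.K\<phi>_nonneg in auto)
    also have "\<dots> = K * KH * (e + q) * \<phi> y ^ 4" by (simp add: power3_eq_cube power4_eq_xxxx)
    finally show "\<bar>pmf r x * (\<xi> x y * (\<alpha> x + \<beta> y))\<bar> \<le> pmf r x * (K * KH * (e + q) * \<phi> y ^ 4)"
      unfolding abs_mult[of "pmf r x"] by (simp add: mult_left_mono)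
  qed
  also have "\<dots> = \<phi> y ^ 4 * (K * \<bar>?\<Delta> x\<bar> + (K * KH * (e + q) + KC * q) * pmf r x
     + KC * (\<bar>pmf p2 x - pmf r x\<bar> * d2 + \<bar>pmf p3 x - pmf r x\<bar> * d3 + \<bar>pmf p4 x - pmf r x\<bar> * d4))"
    by (simp add: q_def algebra_simps)
  also have "\<dots> \<le> \<phi> y ^ 4 * (KF * \<bar>?\<Delta> x\<bar> + KF * (e + q) * pmf r x
     + KF * (\<bar>pmf p2 x - pmf r x\<bar> * d2 + \<bar>pmf p3 x - pmf r x\<bar> * d3 + \<bar>pmf p4 x - pmf r x\<bar> * d4))"
  proof (intro mult_left_mono add_mono mult_right_mono)
    show "K \<le> KF" "KC \<le> KF" using K_pos KC_nonneg KH_nonneg by (simp_all add: KF_def)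
    have n: "0 \<le> K * (e + q)" "0 \<le> KC * e" using K_pos KC_nonneg e0 eq0 by auto
    have "KF * (e + q) = (K * KH * (e + q) + KC * q) + K * (e + q) + KC * e" by (simp add: KF_def algebra_simps)
    with n show "K * KH * (e + q) + KC * q \<le> KF * (e + q)" by linarith
  qed (use \<phi>_pos[of y] P2.d0 P3.d0 P4.d0 in auto)
  also have "\<dots> = KF * \<phi> y ^ 4 * (\<bar>?\<Delta> x\<bar> + pmf r x * (e + q)
        + (\<bar>pmf p2 x - pmf r x\<bar> * d2 + \<bar>pmf p3 x - pmf r x\<bar> * d3 + \<bar>pmf p4 x - pmf r x\<bar> * d4))"
    by (simp add: algebra_simps)
  finally show ?thesis .
qed

end

section \<open>First-order expansion of the transport plan\<close>

lemma nn_integral_count_space_Times: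
  assumes f: "\<And>x. 0 \<le> f x"
  shows "(\<integral>\<^sup>+z. ennreal (f (fst z) * h (snd z)) \<partial>count_space UNIV)
    = (\<integral>\<^sup>+x. ennreal (f x) \<partial>count_space UNIV) * (\<integral>\<^sup>+y. ennreal (h y) \<partial>count_space UNIV)"
proof -
  have "(\<integral>\<^sup>+z. ennreal (f (fst z) * h (snd z)) \<partial>count_space UNIV)
    = (\<integral>\<^sup>+x. \<integral>\<^sup>+y. ennreal (f x) * ennreal (h y) \<partial>count_space UNIV \<partial>count_space UNIV)"
    by (subst nn_integral_fst_count_space[symmetric]) (simp add: ennreal_mult'[OF f])
  also have "\<dots> = (\<integral>\<^sup>+x. ennreal (f x) \<partial>count_space UNIV) * (\<integral>\<^sup>+y. ennreal (h y) \<partial>count_space UNIV)"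
    by (simp add: nn_integral_cmult nn_integral_multc)
  finally show ?thesis .
qed

lemma summable_on_real_iff_integrable:
  fixes f :: "'a \<Rightarrow> real"
  shows "f summable_on UNIV \<longleftrightarrow> integrable (count_space UNIV) f"
  using abs_summable_equivalent[of f UNIV] summable_on_iff_abs_summable_on_real[of f UNIV]
  unfolding Infinite_Set_Sum.abs_summable_on_def by blast

text \<open>For a family that is not summable the real-valued norm is 0 by convention, so the
  inequality holds in all cases.\<close>

lemma l1_norm_le_wnorm:
  assumes w: "\<And>z. 0 \<le> w z"
  shows "ennreal (l1_norm w a) \<le> wnorm w a"
proof (cases "(\<lambda>z. w z * \<bar>a z\<bar>) summable_on UNIV")
  case True
  have nn: "0 \<le> w z * \<bar>a z\<bar>" for z using w by simp
  have i: "integrable (count_space UNIV) (\<lambda>z. w z * \<bar>a z\<bar>)"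
    using True summable_on_real_iff_integrable[of "\<lambda>z. w z * \<bar>a z\<bar>"] by blast
  have "l1_norm w a = infsetsum (\<lambda>z. w z * \<bar>a z\<bar>) UNIV"
    unfolding l1_norm_def
    by (rule infsetsum_infsum[symmetric]) (use i in \<open>simp add: Infinite_Set_Sum.abs_summable_on_def\<close>)
  also have "\<dots> = (\<integral>z. w z * \<bar>a z\<bar> \<partial>count_space UNIV)" by (simp add: infsetsum_def)
  finally have "ennreal (l1_norm w a) = wnorm w a"
    unfolding wnorm_def using nn_integral_eq_integral[OF i] nn by simp
  then show ?thesis by simp
qed (simp add: l1_norm_def infsum_not_exists)

lemma l1_space_iff: "a \<in> l1_space w \<longleftrightarrow> integrable (count_space UNIV) (\<lambda>z. w z * \<bar>a z\<bar>)"
  unfolding l1_space_def mem_Collect_eq by (rule summable_on_real_iff_integrable)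

lemma wnorm_mono_weight: "(\<And>z. W z \<le> V z) \<Longrightarrow> wnorm W a \<le> wnorm V a"
  by (rule wnorm_mono) (simp add: mult_right_mono)

section \<open>Plan densities as kernels\<close>

context erot_cost begin

abbreviation wXY :: "'x \<times> 'y \<Rightarrow> real" where "wXY \<equiv> osum CX CY"

lemma wXY_nonneg: "0 \<le> wXY z"
  by (auto simp: osum_def C_weight_def split: prod.split)

text \<open>Both weights are at least 1; the product bound lets the double sum factor into one over
  \<open>x\<close> and one over \<open>y\<close>.\<close>

lemma wXY_le: "wXY (x, y) \<le> 2 * (CX x * CY y)"
proof -
  have "CX x * 1 \<le> CX x * CY y" "1 * CY y \<le> CX x * CY y"
    using CX_ge(1)[of x] CY_ge(1)[of y] by (auto intro: mult_left_mono mult_right_mono)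
  then show ?thesis by (simp add: osum_def)
qed

lemma plan_integrable:
  assumes p: "integrable (measure_pmf p) CX"
  shows "integrable (count_space UNIV) (\<lambda>z. wXY z * pmf (erot_plan lam c p s) z)"
proof -
  let ?\<pi> = "erot_plan lam c p s"
  obtain g where g: "g \<in> adm (Nmin p)" "\<And>g'. g' \<in> adm (Nmin p) \<Longrightarrow> dual p g' \<le> dual p g"
    by (rule dual_attained[OF p order_refl]) blast
  have "?\<pi> \<in> couplings p s" by (rule erot_dual(3)[OF p order_refl g])
  then have m: "map_pmf fst ?\<pi> = p" "map_pmf snd ?\<pi> = s" by (auto simp: couplings_def)
  have "integrable (map_pmf fst ?\<pi>) CX" "integrable (map_pmf snd ?\<pi>) CY"
    unfolding m using p CY_int by auto
  then have "integrable ?\<pi> (\<lambda>z. CX (fst z) + CY (snd z))" by simp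
  also have "(\<lambda>z. CX (fst z) + CY (snd z)) = wXY" by (auto simp: fun_eq_iff osum_def)
  finally have "integrable ?\<pi> wXY" .
  then show ?thesis by (simp add: integrable_pmf_count_space mult.commute)
qed

lemma plan_diff_l1:
  assumes "integrable (measure_pmf p) CX" "integrable (measure_pmf q) CX"
  shows "(\<lambda>z. t * (pmf (erot_plan lam c p s) z - pmf (erot_plan lam c q s) z)) \<in> l1_space wXY"
proof -
  let ?P = "\<lambda>p z. wXY z * pmf (erot_plan lam c p s) z"
  have "integrable (count_space UNIV) (\<lambda>z. \<bar>t * (?P p z - ?P q z)\<bar>)"
    using plan_integrable[OF assms(1)] plan_integrable[OF assms(2)] by (intro integrable_abs integrable_mult_right Bochner_Integration.integrable_diff)
  also have "(\<lambda>z. \<bar>t * (?P p z - ?P q z)\<bar>) = (\<lambda>z. wXY z * \<bar>t * (pmf (erot_plan lam c p s) z - pmf (erot_plan lam c q s) z)\<bar>)"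
    by (simp add: fun_eq_iff right_diff_distrib[symmetric] abs_mult abs_of_nonneg[OF wXY_nonneg])
  finally show ?thesis by (simp only: l1_space_iff)
qed

text \<open>The bound \<open>b\<close> on \<open>cXp - cXm\<close> makes the estimates uniform in
  \<open>x\<close>. The lower bound on \<open>h\<close> comes from the column equation: if
  \<open>h y\<close> were too small, the density would stay below 1 for all \<open>x\<close> and
  could not have mean one.\<close>

lemma dens_bounds:
  assumes p: "integrable (measure_pmf p) CX" and h: "h \<in> adm N" and S: "schroedinger p h"
    and b: "\<And>x. cXp x - cXm x \<le> b" "0 \<le> b" and y: "y \<in> set_pmf s"
  defines "K \<equiv> exp ((2 * b + \<bar>lam * ln Phi\<bar> + \<bar>N\<bar>) / lam)"
  shows "1 / (K * phiY y) \<le> dens h x y" and "dens h x y \<le> K * phiY y" and "(\<integral>x. dens h x y \<partial>p) = 1"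
proof -
  let ?L = "\<bar>lam * ln Phi\<bar>" and ?N = "\<bar>N\<bar>"
  have f: "cXm x - ?L \<le> fpot h x" "fpot h x \<le> cXp x + ?N" for x
    using adm_fpot_ge[OF h, of x] adm_fpot_le[OF h, of x] by linarith+
  have hy: "h y \<le> cYp y" using h by (simp add: adm_def)
  have up: "(fpot h x + h y - c (x, y)) / lam \<le> (h y + b + ?N - cYm y) / lam" for x
    by (rule divide_right_mono) (use f[of x] c_ge[of x y] b(1)[of x] lam in auto)
  have one: "(\<integral>\<^sup>+x. ennreal (dens h x y) \<partial>p) = 1"
    using S y by (simp add: schroedinger_def dens_def)
  then show "(\<integral>x. dens h x y \<partial>p) = 1"
    by (subst integral_eq_nn_integral) (auto simp: less_imp_le[OF dens_pos])
  have "1 \<le> (\<integral>\<^sup>+x. ennreal (exp ((h y + b + ?N - cYm y) / lam)) \<partial>p)"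
    unfolding one[symmetric] dens_def by (intro nn_integral_mono ennreal_leI) (use up in simp)
  then have "0 \<le> (h y + b + ?N - cYm y) / lam" by simp
  then have hlow: "cYm y - b - ?N \<le> h y" using lam by (simp add: zero_le_divide_iff)
  have e: "K * phiY y = exp ((2 * b + ?L + ?N + (cYp y - cYm y)) / lam)"
    by (simp add: K_def phi_weight_def exp_add[symmetric] add_divide_distrib)
  have "(fpot h x + h y - c (x, y)) / lam \<le> (2 * b + ?L + ?N + (cYp y - cYm y)) / lam"
    by (rule divide_right_mono) (use f[of x] c_ge[of x y] b(1)[of x] b(2) lam hy in auto)
  then show "dens h x y \<le> K * phiY y" unfolding e by (simp add: dens_def)
  have "- ((2 * b + ?L + ?N + (cYp y - cYm y)) / lam) \<le> (fpot h x + h y - c (x, y)) / lam"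
    unfolding minus_divide_left
    by (rule divide_right_mono) (use f[of x] c_le[of x y] b(1)[of x] lam hlow in auto)
  then show "1 / (K * phiY y) \<le> dens h x y" unfolding e by (simp add: dens_def exp_minus[symmetric] inverse_eq_divide[symmetric])
qed

text \<open>The pointwise bound of \<open>four_point_kernel\<close> is a function of
  \<open>x\<close> times \<open>phiY y ^ 4\<close>. With the weights included, the sum over
  \<open>y\<close> is the integral assumed finite in \<open>Y\<close>, and the sum over
  \<open>x\<close> consists of weighted distances.\<close>

lemma plan_expansion:
  assumes r: "integrable (measure_pmf r) CX" and b: "\<And>x. cXp x - cXm x \<le> b" "0 \<le> b"
    and Y: "integrable (measure_pmf s) (\<lambda>y. CY y * phiY y ^ 4)"
  shows "\<exists>K1>0. \<forall>p2 p3 p4 d2 d3 d4 e. wdist CX p2 r \<le> ennreal d2 \<longrightarrow> wdist CX p3 r \<le> ennreal d3 \<longrightarrow> wdist CX p4 r \<le> ennreal d4 \<longrightarrow>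
     0 \<le> d2 \<longrightarrow> d2 \<le> 1 \<longrightarrow> 0 \<le> d3 \<longrightarrow> d3 \<le> 1 \<longrightarrow> 0 \<le> d4 \<longrightarrow> d4 \<le> 1 \<longrightarrow> 0 \<le> e \<longrightarrow>
     wnorm CX (\<lambda>x. pmf p4 x - pmf p3 x - (pmf p2 x - pmf r x)) \<le> ennreal e \<longrightarrow>
     wnorm wXY (\<lambda>z. pmf (erot_plan lam c p4 s) z - pmf (erot_plan lam c p3 s) z - (pmf (erot_plan lam c p2 s) z - pmf (erot_plan lam c r s) z))
       \<le> ennreal (K1 * (e + (d2\<^sup>2 + d3\<^sup>2 + d4\<^sup>2)))"
proof -
  define N where "N = Nnear r"
  have CX0: "0 \<le> CX x" and CY0: "0 \<le> CY y" for x y using CX_ge(1)[of x] CY_ge(1)[of y] by linarith+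
  note near = near_adm[OF r, folded N_def]
  have rr: "wdist CX r r \<le> ennreal 1" by (simp add: wnorm_def)
  \<comment> \<open>A maximizer for every nearby marginal from the same class \<open>adm N\<close>,
    so that one constant \<open>K\<close> serves all of them.\<close>
  define G where "G p = (SOME g. g \<in> adm N \<and> (\<forall>g'\<in>adm N. dual p g' \<le> dual p g))" for p
  have G: "G p \<in> adm N" "\<And>g'. g' \<in> adm N \<Longrightarrow> dual p g' \<le> dual p (G p)" if d: "wdist CX p r \<le> ennreal 1" for p
  proof -
    have "\<exists>g. g \<in> adm N \<and> (\<forall>g'\<in>adm N. dual p g' \<le> dual p g)"
      by (rule dual_attained[OF near[OF d]]) blast
    from someI_ex[OF this] show "G p \<in> adm N" "\<And>g'. g' \<in> adm N \<Longrightarrow> dual p g' \<le> dual p (G p)"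
      unfolding G_def by blast+
  qed
  define K where "K = exp ((2 * b + \<bar>lam * ln Phi\<bar> + \<bar>N\<bar>) / lam)"
  have K1: "1 \<le> K" using b(2) lam by (simp add: K_def)
  have phi4: "integrable (measure_pmf s) (\<lambda>y. phiY y ^ 4)"
  proof (rule Bochner_Integration.integrable_bound[OF Y])
    have "phiY y ^ 4 \<le> CY y * phiY y ^ 4" for y
      using mult_right_mono[OF CY_ge(1)[of y], of "phiY y ^ 4"] by simp
    then show "AE y in s. norm (phiY y ^ 4) \<le> norm (CY y * phiY y ^ 4)"
      using CY0 by (auto intro!: AE_I2 simp: abs_mult)
  qed simp
  interpret kb: kernel_bounds s phiY K by unfold_locales (use phiY_ge K1 phi4 in auto)
  obtain x0 :: 'x where True by simp
  \<comment> \<open>Logarithmic increments of the potentials relative to \<open>r\<close>, with the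
    value at \<open>x0\<close> moved from the first to the second.\<close>
  let ?a = "\<lambda>p x. (fpot (G p) x - fpot (G r) x) / lam - (fpot (G p) x0 - fpot (G r) x0) / lam"
  let ?b = "\<lambda>p y. (G p y - G r y) / lam + (fpot (G p) x0 - fpot (G r) x0) / lam"
  have good: "kb.good p (dens (G p))" if d: "wdist CX p r \<le> ennreal 1" for p
  proof -
    note Gp = G[OF d]
    have S: "schroedinger p (G p)" by (rule maximizer_schroedinger[OF near[OF d] Gp])
    note D = dens_bounds[OF near(1)[OF d] Gp(1) S b, folded K_def]
    have "(\<integral>y. dens (G p) x y \<partial>s) = 1" for x
      using nn_integral_dens[OF adm_regular[OF Gp(1)], of x]
      by (subst integral_eq_nn_integral) (auto simp: less_imp_le[OF dens_pos])
    then show ?thesis unfolding kb.good_def using D by blast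
  qed
  have pair: "kernel_pair s phiY K r p (dens (G r)) (dens (G p)) (?a p) (?b p) d x0"
    if d: "wdist CX p r \<le> ennreal d" and d01: "0 \<le> d" "d \<le> 1" for p d
  proof
    have d1: "wdist CX p r \<le> ennreal 1" by (rule order_trans[OF d]) (use d01 in simp)
    show "kb.good r (dens (G r))" by (rule good[OF rr])
    show "kb.good p (dens (G p))" by (rule good[OF d1])
    show "wdist (\<lambda>_. 1) p r \<le> ennreal d"
      by (rule order_trans[OF wnorm_mono_weight d]) (rule CX_ge)
    show "dens (G p) x y = dens (G r) x y * exp (?a p x + ?b p y)" for x y
      unfolding dens_def exp_add[symmetric] by (simp add: add_divide_distrib diff_divide_distrib)
    have "\<bar>?a p x\<bar> \<le> 2 * ((b + \<bar>lam * ln Phi\<bar> + \<bar>N\<bar>) / lam)" for x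
    proof -
      have u: "\<bar>(fpot (G p) z - fpot (G r) z) / lam\<bar> \<le> (b + \<bar>lam * ln Phi\<bar> + \<bar>N\<bar>) / lam" for z
        unfolding abs_divide abs_of_pos[OF lam]
        by (rule divide_right_mono)
          (use adm_fpot_le[OF G(1)[OF d1], of z] adm_fpot_ge[OF G(1)[OF d1], of z]
            adm_fpot_le[OF G(1)[OF rr], of z] adm_fpot_ge[OF G(1)[OF rr], of z] b(1)[of z] lam in linarith)+
      show ?thesis using u[of x] u[of x0] by linarith
    qed
    then show "\<exists>A. \<forall>x. \<bar>?a p x\<bar> \<le> A" by blast
  qed (use d01 in auto)
  define Q where "Q = (\<integral>y. CY y * phiY y ^ 4 \<partial>s)"
  define R where "R = (\<integral>x. CX x \<partial>r)"
  have Q0: "0 \<le> Q" unfolding Q_def by (rule integral_nonneg_AE) (use CY0 in auto)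
  have R0: "0 \<le> R" unfolding R_def by (rule integral_nonneg_AE) (use CX0 in auto)
  have Qn: "(\<integral>\<^sup>+y. ennreal (CY y * phiY y ^ 4 * pmf s y) \<partial>count_space UNIV) = ennreal Q"
  proof -
    have "(\<integral>\<^sup>+y. ennreal (CY y * phiY y ^ 4) \<partial>s) = ennreal Q" unfolding Q_def
      by (rule nn_integral_eq_integral[OF Y]) (use CY0 in auto)
    then show ?thesis by (simp add: nn_integral_measure_pmf ennreal_mult''[symmetric] CY0 mult.commute)
  qed
  have Rn: "(\<integral>\<^sup>+x. ennreal (CX x * pmf r x) \<partial>count_space UNIV) = ennreal R"
  proof -
    have "(\<integral>\<^sup>+x. ennreal (CX x) \<partial>r) = ennreal R" unfolding R_def
      by (rule nn_integral_eq_integral[OF r]) (use CX0 in auto)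
    then show ?thesis by (simp add: nn_integral_measure_pmf ennreal_mult''[symmetric] CX0 mult.commute)
  qed
  define K1 where "K1 = 2 * kb.KF * Q * (1 + R) + 1"
  have K1pos: "0 < K1" using kb.KF_nonneg Q0 R0 by (simp add: K1_def add_nonneg_pos)
  show ?thesis
  proof (rule exI[of _ K1], intro conjI allI impI K1pos)
    fix p2 p3 p4 :: "'x pmf" and d2 d3 d4 e :: real
    assume d: "wdist CX p2 r \<le> ennreal d2" "wdist CX p3 r \<le> ennreal d3" "wdist CX p4 r \<le> ennreal d4"
      and d01: "0 \<le> d2" "d2 \<le> 1" "0 \<le> d3" "d3 \<le> 1" "0 \<le> d4" "d4 \<le> 1" and e0: "0 \<le> e"
      and e: "wnorm CX (\<lambda>x. pmf p4 x - pmf p3 x - (pmf p2 x - pmf r x)) \<le> ennreal e"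
    let ?q = "d2\<^sup>2 + d3\<^sup>2 + d4\<^sup>2"
    let ?\<Delta> = "\<lambda>x. pmf p4 x - pmf p3 x - (pmf p2 x - pmf r x)"
    have "wdist CX p2 r \<le> ennreal 1" "wdist CX p3 r \<le> ennreal 1" "wdist CX p4 r \<le> ennreal 1"
      by (rule order_trans[OF d(1)] order_trans[OF d(2)] order_trans[OF d(3)]; use d01 in simp)+
    note plan = erot_dual(2)[OF near[OF this(1)] G[OF this(1)]] erot_dual(2)[OF near[OF this(2)] G[OF this(2)]]
      erot_dual(2)[OF near[OF this(3)] G[OF this(3)]] erot_dual(2)[OF near[OF rr] G[OF rr]]
    have e': "wnorm (\<lambda>_. 1) ?\<Delta> \<le> ennreal e"
      by (rule order_trans[OF wnorm_mono_weight e]) (rule CX_ge)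
    define V where "V x = \<bar>?\<Delta> x\<bar> + pmf r x * (e + ?q)
        + (\<bar>pmf p2 x - pmf r x\<bar> * d2 + \<bar>pmf p3 x - pmf r x\<bar> * d3 + \<bar>pmf p4 x - pmf r x\<bar> * d4)" for x
    have V0: "0 \<le> V x" for x using d01 e0 by (simp add: V_def)
    let ?\<Pi> = "\<lambda>z. pmf (erot_plan lam c p4 s) z - pmf (erot_plan lam c p3 s) z - (pmf (erot_plan lam c p2 s) z - pmf (erot_plan lam c r s) z)"
    have pw: "wXY (x, y) * \<bar>?\<Pi> (x, y)\<bar> \<le> (2 * kb.KF * (CX x * V x)) * (CY y * phiY y ^ 4 * pmf s y)" for x y
    proof (cases "y \<in> set_pmf s")
      case True
      let ?S = "pmf p4 x * dens (G p4) x y - pmf p3 x * dens (G p3) x y - (pmf p2 x * dens (G p2) x y - pmf r x * dens (G r) x y)"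
      have "?\<Pi> (x, y) = pmf s y * ?S" by (simp add: plan algebra_simps)
      then have "\<bar>?\<Pi> (x, y)\<bar> = pmf s y * \<bar>?S\<bar>" by (simp add: abs_mult)
      also have "\<dots> \<le> pmf s y * (kb.KF * phiY y ^ 4 * V x)"
        unfolding V_def
        by (intro mult_left_mono kb.four_point_kernel[OF pair[OF d(1) d01(1,2)] pair[OF d(2) d01(3,4)] pair[OF d(3) d01(5,6)] e' e0 True]) simp
      finally have "wXY (x, y) * \<bar>?\<Pi> (x, y)\<bar> \<le> 2 * (CX x * CY y) * (pmf s y * (kb.KF * phiY y ^ 4 * V x))"
        by (intro mult_mono wXY_le) (use CX0 CY0 in auto)
      then show ?thesis by (simp add: mult_ac)
    next
      case False
      then have "pmf s y = 0" by (simp add: set_pmf_iff)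
      then show ?thesis by (simp add: plan)
    qed
    have CV: "(\<integral>\<^sup>+x. ennreal (CX x * V x) \<partial>count_space UNIV) \<le> ennreal ((1 + R) * (e + ?q))"
    proof -
      have "(\<integral>\<^sup>+x. ennreal (CX x * V x) \<partial>count_space UNIV)
        = (\<integral>\<^sup>+x. ennreal (CX x * \<bar>?\<Delta> x\<bar>) + ennreal (e + ?q) * ennreal (CX x * pmf r x)
          + (ennreal d2 * ennreal (CX x * \<bar>pmf p2 x - pmf r x\<bar>) + ennreal d3 * ennreal (CX x * \<bar>pmf p3 x - pmf r x\<bar>)
            + ennreal d4 * ennreal (CX x * \<bar>pmf p4 x - pmf r x\<bar>)) \<partial>count_space UNIV)"
        using CX0 d01 e0 by (intro nn_integral_cong)
          (simp add: V_def ennreal_mult[symmetric] ennreal_plus[symmetric] distrib_left mult_ac del: ennreal_plus)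
      also have "\<dots> = wnorm CX ?\<Delta> + ennreal (e + ?q) * ennreal R
          + (ennreal d2 * wdist CX p2 r + ennreal d3 * wdist CX p3 r + ennreal d4 * wdist CX p4 r)"
        unfolding wnorm_def Rn[symmetric] by (simp add: nn_integral_add nn_integral_cmult)
      also have "\<dots> \<le> ennreal e + ennreal (e + ?q) * ennreal R + (ennreal d2 * ennreal d2 + ennreal d3 * ennreal d3 + ennreal d4 * ennreal d4)"
        by (intro add_mono mult_left_mono e d order_refl) auto
      also have "\<dots> = ennreal (e + (e + ?q) * R + (d2 * d2 + d3 * d3 + d4 * d4))"
        using d01 e0 R0 by (simp add: ennreal_mult[symmetric] ennreal_plus[symmetric] del: ennreal_plus)
      also have "e + (e + ?q) * R + (d2 * d2 + d3 * d3 + d4 * d4) = (1 + R) * (e + ?q)"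
        by (simp add: power2_eq_square algebra_simps)
      finally show ?thesis .
    qed
    have "wnorm wXY ?\<Pi> \<le> (\<integral>\<^sup>+z. ennreal ((2 * kb.KF * (CX (fst z) * V (fst z))) * (CY (snd z) * phiY (snd z) ^ 4 * pmf s (snd z))) \<partial>count_space UNIV)"
      unfolding wnorm_def
    proof (intro nn_integral_mono ennreal_leI)
      fix z show "wXY z * \<bar>?\<Pi> z\<bar> \<le> (2 * kb.KF * (CX (fst z) * V (fst z))) * (CY (snd z) * phiY (snd z) ^ 4 * pmf s (snd z))"
        using pw[of "fst z" "snd z"] by simp
    qed
    also have "\<dots> = (\<integral>\<^sup>+x. ennreal (2 * kb.KF * (CX x * V x)) \<partial>count_space UNIV) * ennreal Q"
      unfolding Qn[symmetric] by (rule nn_integral_count_space_Times) (use kb.KF_nonneg CX0 V0 in auto)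
    also have "(\<integral>\<^sup>+x. ennreal (2 * kb.KF * (CX x * V x)) \<partial>count_space UNIV) = ennreal (2 * kb.KF) * (\<integral>\<^sup>+x. ennreal (CX x * V x) \<partial>count_space UNIV)"
      by (subst nn_integral_cmult[symmetric]) (auto intro!: nn_integral_cong ennreal_mult' simp: kb.KF_nonneg)
    also have "\<dots> * ennreal Q \<le> (ennreal (2 * kb.KF) * ennreal ((1 + R) * (e + ?q))) * ennreal Q"
      by (intro mult_right_mono mult_left_mono CV) auto
    also have "\<dots> = ennreal (2 * kb.KF * ((1 + R) * (e + ?q)) * Q)"
      using kb.KF_nonneg R0 e0 Q0 by (simp add: ennreal_mult[symmetric])
    also have "\<dots> \<le> ennreal (K1 * (e + ?q))"
    proof (rule ennreal_leI)
      have "K1 * (e + ?q) = 2 * kb.KF * ((1 + R) * (e + ?q)) * Q + (e + ?q)" by (simp add: K1_def algebra_simps)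
      then show "2 * kb.KF * ((1 + R) * (e + ?q)) * Q \<le> K1 * (e + ?q)" using e0 by simp
    qed
    finally show "wnorm wXY ?\<Pi> \<le> ennreal (K1 * (e + ?q))" .
  qed
qed

text \<open>A squared distance \<open>d\<^sup>2\<close> with \<open>d \<le> \<delta>\<close> is at
  most \<open>\<delta> * d\<close>, so the multiple \<open>K * \<delta>\<close> of the weight itself
  can serve as \<open>W\<close>.\<close>

lemma plan_four_point:
  assumes r: "integrable (count_space UNIV) (\<lambda>x. CX x * sqrt (pmf r x))" and b: "\<And>x. cXp x - cXm x \<le> b" "0 \<le> b"
    and Y: "integrable (measure_pmf s) (\<lambda>y. CY y * phiY y ^ 4)"
  shows "four_point_approx CX r (\<lambda>p2 p3 p4. l1_norm wXY (\<lambda>z. pmf (erot_plan lam c p4 s) z - pmf (erot_plan lam c p3 s) z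
      - (pmf (erot_plan lam c p2 s) z - pmf (erot_plan lam c r s) z)))"
proof -
  have CX0: "0 \<le> CX x" for x using CX_ge(1)[of x] by linarith
  from plan_expansion[OF CX_int_of_sqrt[OF r] b Y] obtain K where K: "0 < K"
    and ex: "\<And>p2 p3 p4 d2 d3 d4 e. wdist CX p2 r \<le> ennreal d2 \<Longrightarrow> wdist CX p3 r \<le> ennreal d3 \<Longrightarrow> wdist CX p4 r \<le> ennreal d4 \<Longrightarrow>
     0 \<le> d2 \<Longrightarrow> d2 \<le> 1 \<Longrightarrow> 0 \<le> d3 \<Longrightarrow> d3 \<le> 1 \<Longrightarrow> 0 \<le> d4 \<Longrightarrow> d4 \<le> 1 \<Longrightarrow> 0 \<le> e \<Longrightarrow>
     wnorm CX (\<lambda>x. pmf p4 x - pmf p3 x - (pmf p2 x - pmf r x)) \<le> ennreal e \<Longrightarrow>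
     wnorm wXY (\<lambda>z. pmf (erot_plan lam c p4 s) z - pmf (erot_plan lam c p3 s) z - (pmf (erot_plan lam c p2 s) z - pmf (erot_plan lam c r s) z))
       \<le> ennreal (K * (e + (d2\<^sup>2 + d3\<^sup>2 + d4\<^sup>2)))" by blast
  define A where "A = (\<integral>x. CX x * sqrt (pmf r x) \<partial>count_space UNIV)"
  have A: "0 \<le> A" "(\<integral>\<^sup>+x. ennreal (CX x * sqrt (pmf r x)) \<partial>count_space UNIV) = ennreal A"
    using nn_integral_eq_integral[OF r] CX0 by (auto simp: A_def intro!: integral_nonneg_AE)
  show ?thesis unfolding four_point_approx_def
  proof (rule exI[of _ K], intro conjI allI impI)
    fix \<epsilon> :: real assume e: "0 < \<epsilon>"
    define \<delta> where "\<delta> = min 1 (\<epsilon> / (K * (A + 1)))"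
    have \<delta>: "0 < \<delta>" "\<delta> \<le> 1" using e K A by (simp_all add: \<delta>_def)
    have \<delta>A: "K * \<delta> * A \<le> \<epsilon>"
    proof -
      have "K * \<delta> * A \<le> K * (\<epsilon> / (K * (A + 1))) * A"
        by (intro mult_right_mono mult_left_mono) (use K A in \<open>auto simp: \<delta>_def\<close>)
      also have "\<dots> = \<epsilon> * (A / (A + 1))" using K by simp
      also have "\<dots> \<le> \<epsilon> * 1" by (rule mult_left_mono) (use A e in auto)
      finally show ?thesis by simp
    qed
    define W where "W = (\<lambda>x. (K * \<delta>) * CX x)"
    show "\<exists>\<delta>>0. \<exists>W. (\<forall>x. 0 \<le> W x \<and> W x \<le> K * CX x) \<and>
      (\<integral>\<^sup>+x. ennreal (W x * sqrt (pmf r x)) \<partial>count_space UNIV) \<le> ennreal \<epsilon> \<and>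
      (\<forall>p2 p3 p4. wdist CX p2 r \<le> ennreal \<delta> \<longrightarrow> wdist CX p3 r \<le> ennreal \<delta> \<longrightarrow> wdist CX p4 r \<le> ennreal \<delta> \<longrightarrow>
        ennreal (l1_norm wXY (\<lambda>z. pmf (erot_plan lam c p4 s) z - pmf (erot_plan lam c p3 s) z
            - (pmf (erot_plan lam c p2 s) z - pmf (erot_plan lam c r s) z)))
          \<le> ennreal K * wnorm CX (\<lambda>x. pmf p4 x - pmf p3 x - (pmf p2 x - pmf r x))
          + (wdist W p2 r + wdist W p3 r + wdist W p4 r))"
    proof (rule exI[of _ \<delta>], intro conjI \<delta>(1), rule exI[of _ W], intro conjI allI impI)
      fix x
      show "0 \<le> W x" using K \<delta> CX0[of x] by (simp add: W_def)
      show "W x \<le> K * CX x" unfolding W_def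
        by (rule mult_right_mono[OF _ CX0]) (use K \<delta> in simp)
    next
      have "(\<integral>\<^sup>+x. ennreal (W x * sqrt (pmf r x)) \<partial>count_space UNIV)
        = (\<integral>\<^sup>+x. ennreal (K * \<delta>) * ennreal (CX x * sqrt (pmf r x)) \<partial>count_space UNIV)"
        by (rule nn_integral_cong) (use K \<delta> CX0 in \<open>simp add: W_def ennreal_mult[symmetric] mult.assoc\<close>)
      also have "\<dots> = ennreal (K * \<delta> * A)"
        using K \<delta> A by (simp add: nn_integral_cmult ennreal_mult)
      also have "\<dots> \<le> ennreal \<epsilon>" by (rule ennreal_leI[OF \<delta>A])
      finally show "(\<integral>\<^sup>+x. ennreal (W x * sqrt (pmf r x)) \<partial>count_space UNIV) \<le> ennreal \<epsilon>" .
    next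
      fix p2 p3 p4 :: "'x pmf"
      assume d: "wdist CX p2 r \<le> ennreal \<delta>" "wdist CX p3 r \<le> ennreal \<delta>" "wdist CX p4 r \<le> ennreal \<delta>"
      let ?\<Delta> = "\<lambda>x. pmf p4 x - pmf p3 x - (pmf p2 x - pmf r x)"
      let ?\<Pi> = "\<lambda>z. pmf (erot_plan lam c p4 s) z - pmf (erot_plan lam c p3 s) z - (pmf (erot_plan lam c p2 s) z - pmf (erot_plan lam c r s) z)"
      have dist: "\<exists>t. 0 \<le> t \<and> t \<le> \<delta> \<and> wdist CX p r = ennreal t" if "wdist CX p r \<le> ennreal \<delta>" for p
        using that \<delta> by (cases "wdist CX p r") (auto simp: top_unique)
      obtain d2 where d2: "0 \<le> d2" "d2 \<le> \<delta>" "wdist CX p2 r = ennreal d2" using dist[OF d(1)] by blast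
      obtain d3 where d3: "0 \<le> d3" "d3 \<le> \<delta>" "wdist CX p3 r = ennreal d3" using dist[OF d(2)] by blast
      obtain d4 where d4: "0 \<le> d4" "d4 \<le> \<delta>" "wdist CX p4 r = ennreal d4" using dist[OF d(3)] by blast
      have WD: "wdist W p r = ennreal (K * \<delta> * t)" if "wdist CX p r = ennreal t" "0 \<le> t" for p t
        unfolding W_def using K \<delta> that by (simp add: wnorm_cmult ennreal_mult)
      show "ennreal (l1_norm wXY ?\<Pi>) \<le> ennreal K * wnorm CX ?\<Delta> + (wdist W p2 r + wdist W p3 r + wdist W p4 r)"
      \<comment> \<open>An infinite four-point norm makes the claim trivial, because
        \<open>K\<close> is positive.\<close>
      proof (cases "wnorm CX ?\<Delta>")
        case (real e)
        have "ennreal (l1_norm wXY ?\<Pi>) \<le> wnorm wXY ?\<Pi>" by (rule l1_norm_le_wnorm[OF wXY_nonneg])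
        also have "\<dots> \<le> ennreal (K * (e + (d2\<^sup>2 + d3\<^sup>2 + d4\<^sup>2)))"
          by (rule ex) (use d2 d3 d4 real \<delta> in auto)
        also have "\<dots> \<le> ennreal (K * e + (K * \<delta> * d2 + K * \<delta> * d3 + K * \<delta> * d4))"
        proof (rule ennreal_leI)
          have "d2\<^sup>2 \<le> \<delta> * d2" "d3\<^sup>2 \<le> \<delta> * d3" "d4\<^sup>2 \<le> \<delta> * d4"
            unfolding power2_eq_square by (intro mult_right_mono d2 d3 d4)+
          then have "K * (d2\<^sup>2 + d3\<^sup>2 + d4\<^sup>2) \<le> K * (\<delta> * d2 + \<delta> * d3 + \<delta> * d4)"
            using K by (intro mult_left_mono add_mono) auto
          then show "K * (e + (d2\<^sup>2 + d3\<^sup>2 + d4\<^sup>2)) \<le> K * e + (K * \<delta> * d2 + K * \<delta> * d3 + K * \<delta> * d4)"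
            by (simp add: distrib_left mult.assoc)
        qed
        also have "\<dots> = ennreal K * wnorm CX ?\<Delta> + (wdist W p2 r + wdist W p3 r + wdist W p4 r)"
          using K \<delta> real d2 d3 d4 by (simp add: WD ennreal_mult)
        finally show ?thesis .
      qed (use K in \<open>simp add: ennreal_mult_top\<close>)
    qed
  qed (use K in simp)
qed

end

section \<open>Bootstrap consistency\<close>

lemma integrable_pmf_mono:
  fixes f h :: "'a \<Rightarrow> real"
  assumes h: "(\<lambda>y. h y * pmf s y) summable_on UNIV" and le: "\<And>y. \<bar>f y\<bar> \<le> h y"
  shows "integrable (measure_pmf s) f"
proof (rule Bochner_Integration.integrable_bound)
  show "integrable (measure_pmf s) h"
    using h by (simp add: integrable_pmf_count_space summable_on_real_iff_integrable mult.commute)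
  show "AE y in s. norm (f y) \<le> norm (h y)"
    by (rule AE_I2) (use le in \<open>auto intro: order_trans[OF _ abs_ge_self]\<close>)
qed simp

lemma C_weight_nonneg: "0 \<le> C_weight cm cp z"
  by (simp add: C_weight_def)

context erot_cost begin

lemma erot_bootstrap:
  fixes X :: "nat \<Rightarrow> 'w \<Rightarrow> 'x"
  assumes M: "prob_space M" and X: "iid_sample M X r"
    and Xs: "\<And>n. n > 0 \<Longrightarrow> bootstrap_sample M X n (Xs n)"
    and r: "integrable (count_space UNIV) (\<lambda>x. CX x * sqrt (pmf r x))"
  shows "tendsto_zero_outer_prob M (\<lambda>n. cond_BL_dist M X n (UNIV :: real set) norm
    (\<lambda>\<omega>. sqrt (real n) * (EROT lam c (empirical n (\<lambda>i. Xs n i \<omega>)) s - EROT lam c (empirical n (\<lambda>i. X i \<omega>)) s))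
    (\<lambda>\<omega>. sqrt (real n) * (EROT lam c (empirical n (\<lambda>i. X i \<omega>)) s - EROT lam c r s)))"
proof (rule bootstrap_consistency[where C=CX
    and v="\<lambda>n p q. sqrt (real n) * (EROT lam c q s - EROT lam c p s)"
    and u="\<lambda>n p. sqrt (real n) * (EROT lam c p s - EROT lam c r s)", OF M X Xs _ _ erot_four_point[OF r]])
  show "(\<integral>\<^sup>+x. ennreal (CX x * sqrt (pmf r x)) \<partial>count_space UNIV) < \<infinity>"
    using r by (simp add: integrable_iff_bounded abs_mult C_weight_nonneg)
  fix n :: nat and l z l' :: "'x list"
  let ?E = "\<lambda>l. EROT lam c (emp l) s"
  have "sqrt (real n) * (?E z - ?E l) - sqrt (real n) * (?E l' - EROT lam c r s)
      = sqrt (real n) * (?E z - ?E l - (?E l' - EROT lam c r s))"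
    by (simp add: algebra_simps)
  then show "norm (sqrt (real n) * (?E z - ?E l) - sqrt (real n) * (?E l' - EROT lam c r s))
      \<le> sqrt (real n) * norm (?E z - ?E l - (?E l' - EROT lam c r s))"
    by (simp add: abs_mult)
qed (auto simp: C_weight_nonneg)

lemma plan_bootstrap:
  fixes X :: "nat \<Rightarrow> 'w \<Rightarrow> 'x"
  assumes M: "prob_space M" and X: "iid_sample M X r"
    and Xs: "\<And>n. n > 0 \<Longrightarrow> bootstrap_sample M X n (Xs n)"
    and r: "integrable (count_space UNIV) (\<lambda>x. CX x * sqrt (pmf r x))"
    and b: "\<And>x. cXp x - cXm x \<le> b" "0 \<le> b" and Y: "integrable (measure_pmf s) (\<lambda>y. CY y * phiY y ^ 4)"
  shows "tendsto_zero_outer_prob M (\<lambda>n. cond_BL_dist M X n (l1_space wXY) (l1_norm wXY)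
    (\<lambda>\<omega> z. sqrt (real n) * (pmf (erot_plan lam c (empirical n (\<lambda>i. Xs n i \<omega>)) s) z
        - pmf (erot_plan lam c (empirical n (\<lambda>i. X i \<omega>)) s) z))
    (\<lambda>\<omega> z. sqrt (real n) * (pmf (erot_plan lam c (empirical n (\<lambda>i. X i \<omega>)) s) z - pmf (erot_plan lam c r s) z)))"
proof (rule bootstrap_consistency[where C=CX
    and v="\<lambda>n p q z. sqrt (real n) * (pmf (erot_plan lam c q s) z - pmf (erot_plan lam c p s) z)"
    and u="\<lambda>n p z. sqrt (real n) * (pmf (erot_plan lam c p s) z - pmf (erot_plan lam c r s) z)",
    OF M X Xs _ _ plan_four_point[OF r b Y]])
  show "(\<integral>\<^sup>+x. ennreal (CX x * sqrt (pmf r x)) \<partial>count_space UNIV) < \<infinity>"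
    using r by (simp add: integrable_iff_bounded abs_mult C_weight_nonneg)
  \<comment> \<open>Empirical measures have finite support, so the weight is integrable; this puts
    the rescaled plan differences into the space on which test functions are constrained.\<close>
  have emp_int: "integrable (measure_pmf (emp l)) CX" if "0 < length l" for l
  proof (rule integrable_measure_pmf_finite)
    have "set_pmf (pmf_of_set {..<length l}) = {..<length l}" using that by (intro set_pmf_of_set) auto
    then show "finite (set_pmf (emp l))" by (simp add: emp_def empirical_def)
  qed
  fix n :: nat and l z l' :: "'x list"
  let ?P = "\<lambda>l a. pmf (erot_plan lam c (emp l) s) a" and ?R = "\<lambda>a. pmf (erot_plan lam c r s) a"
  show "(\<lambda>a. sqrt (real n) * (?P z a - ?P l a)) \<in> l1_space wXY" if "0 < length l" "0 < length z"
    by (rule plan_diff_l1[OF emp_int emp_int]) (use that in auto)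
  show "(\<lambda>a. sqrt (real n) * (?P l a - ?R a)) \<in> l1_space wXY" if "0 < length l"
    by (rule plan_diff_l1[OF emp_int CX_int_of_sqrt[OF r]]) (use that in auto)
  have "(\<lambda>a. wXY a * \<bar>((\<lambda>a. sqrt (real n) * (?P z a - ?P l a)) - (\<lambda>a. sqrt (real n) * (?P l' a - ?R a))) a\<bar>)
    = (\<lambda>a. sqrt (real n) * (wXY a * \<bar>?P z a - ?P l a - (?P l' a - ?R a)\<bar>))"
  proof
    fix a
    have "((\<lambda>a. sqrt (real n) * (?P z a - ?P l a)) - (\<lambda>a. sqrt (real n) * (?P l' a - ?R a))) a
      = sqrt (real n) * (?P z a - ?P l a - (?P l' a - ?R a))"
      by (simp add: algebra_simps)
    then show "wXY a * \<bar>((\<lambda>a. sqrt (real n) * (?P z a - ?P l a)) - (\<lambda>a. sqrt (real n) * (?P l' a - ?R a))) a\<bar>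
      = sqrt (real n) * (wXY a * \<bar>?P z a - ?P l a - (?P l' a - ?R a)\<bar>)"
      by (simp add: abs_mult)
  qed
  then show "l1_norm wXY ((\<lambda>a. sqrt (real n) * (?P z a - ?P l a)) - (\<lambda>a. sqrt (real n) * (?P l' a - ?R a)))
      \<le> sqrt (real n) * l1_norm wXY (\<lambda>a. ?P z a - ?P l a - (?P l' a - ?R a))"
    unfolding l1_norm_def by (simp add: infsum_cmult_right')
qed (auto simp: C_weight_nonneg)

end

theorem theorem3p11:
  fixes lam :: real
    and c :: "'x::countable \<times> 'y::countable \<Rightarrow> real"
    and r :: "'x pmf" and s :: "'y pmf"
    and M :: "'w measure"
    and X :: "nat \<Rightarrow> 'w \<Rightarrow> 'x"
    and Xs :: "nat \<Rightarrow> nat \<Rightarrow> 'w \<Rightarrow> 'x"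
    and rh rhs :: "nat \<Rightarrow> 'w \<Rightarrow> 'x pmf"
  assumes lam: "lam > 0"
    and M: "prob_space M"
    and X: "iid_sample M X r"
    and Xs: "\<And>n. n > 0 \<Longrightarrow> bootstrap_sample M X n (Xs n)"
    and rh: "\<And>n \<omega>. rh n \<omega> = empirical n (\<lambda>i. X i \<omega>)"
    and rhs: "\<And>n \<omega>. rhs n \<omega> = empirical n (\<lambda>i. Xs n i \<omega>)"
  shows
    "(\<forall>cXm cXp cYm cYp dXm dXp dYm dYp.
        dominating c cXm cXp cYm cYp \<longrightarrow>
        dominating c dXm dXp dYm dYp \<longrightarrow>
        (\<lambda>x. C_weight cXm cXp x * sqrt (pmf r x)
             + ((C_weight dXm dXp x)\<^sup>2 + (phi_weight lam dXm dXp x)\<^sup>2) * pmf r x) summable_on UNIV \<longrightarrow>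
        (\<lambda>y. (C_weight cYm cYp y + C_weight dYm dYp y + phi_weight lam cYm cYp y) * pmf s y)
             summable_on UNIV \<longrightarrow>
        tendsto_zero_outer_prob M (\<lambda>n.
          cond_BL_dist M X n (UNIV :: real set) norm
            (\<lambda>\<omega>. sqrt (real n) * (EROT lam c (rhs n \<omega>) s - EROT lam c (rh n \<omega>) s))
            (\<lambda>\<omega>. sqrt (real n) * (EROT lam c (rh n \<omega>) s - EROT lam c r s))))
     \<and>
     (\<forall>cXm cXp cYm cYp.
        dominating c cXm cXp cYm cYp \<longrightarrow>
        bounded (range (\<lambda>x. cXp x - cXm x)) \<longrightarrow>
        (\<lambda>x. C_weight cXm cXp x * sqrt (pmf r x)) summable_on UNIV \<longrightarrow>
        (\<lambda>y. C_weight cYm cYp y * (phi_weight lam cYm cYp y) ^ 4 * pmf s y) summable_on UNIV \<longrightarrow>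
        (let w = osum (C_weight cXm cXp) (C_weight cYm cYp) in
         tendsto_zero_outer_prob M (\<lambda>n.
          cond_BL_dist M X n (l1_space w) (l1_norm w)
            (\<lambda>\<omega> z. sqrt (real n) *
                 (pmf (erot_plan lam c (rhs n \<omega>) s) z - pmf (erot_plan lam c (rh n \<omega>) s) z))
            (\<lambda>\<omega> z. sqrt (real n) *
                 (pmf (erot_plan lam c (rh n \<omega>) s) z - pmf (erot_plan lam c r s) z)))))"
proof (intro conjI allI impI)
  fix cXm cXp :: "'x \<Rightarrow> real" and cYm cYp :: "'y \<Rightarrow> real" and dXm dXp :: "'x \<Rightarrow> real" and dYm dYp :: "'y \<Rightarrow> real"
  assume c: "dominating c cXm cXp cYm cYp" and "dominating c dXm dXp dYm dYp"
    and x: "(\<lambda>x. C_weight cXm cXp x * sqrt (pmf r x)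
             + ((C_weight dXm dXp x)\<^sup>2 + (phi_weight lam dXm dXp x)\<^sup>2) * pmf r x) summable_on UNIV"
    and y: "(\<lambda>y. (C_weight cYm cYp y + C_weight dYm dYp y + phi_weight lam cYm cYp y) * pmf s y) summable_on UNIV"
  have C0: "0 \<le> C_weight cYm cYp z" "0 \<le> C_weight dYm dYp z" "0 \<le> phi_weight lam cYm cYp z" for z
    by (simp_all add: C_weight_nonneg phi_weight_def)
  interpret erot_cost lam c cXm cXp cYm cYp s
  proof
    show "integrable (measure_pmf s) (C_weight cYm cYp)" "integrable (measure_pmf s) (phi_weight lam cYm cYp)"
      by (rule integrable_pmf_mono[OF y]; use C0 in \<open>simp add: add_nonneg_nonneg\<close>)+
  qed (use lam c in auto)
  have "integrable (count_space UNIV) (\<lambda>x. C_weight cXm cXp x * sqrt (pmf r x))"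
  proof (rule Bochner_Integration.integrable_bound)
    show "integrable (count_space UNIV) (\<lambda>x. C_weight cXm cXp x * sqrt (pmf r x)
             + ((C_weight dXm dXp x)\<^sup>2 + (phi_weight lam dXm dXp x)\<^sup>2) * pmf r x)"
      using x by (simp add: summable_on_real_iff_integrable)
  qed (auto intro!: AE_I2 simp: C_weight_nonneg abs_mult)
  from erot_bootstrap[OF M X Xs this]
  show "tendsto_zero_outer_prob M (\<lambda>n.
          cond_BL_dist M X n (UNIV :: real set) norm
            (\<lambda>\<omega>. sqrt (real n) * (EROT lam c (rhs n \<omega>) s - EROT lam c (rh n \<omega>) s))
            (\<lambda>\<omega>. sqrt (real n) * (EROT lam c (rh n \<omega>) s - EROT lam c r s)))"
    unfolding rh rhs by simp
next
  fix cXm cXp :: "'x \<Rightarrow> real" and cYm cYp :: "'y \<Rightarrow> real"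
  assume c: "dominating c cXm cXp cYm cYp" and bd: "bounded (range (\<lambda>x. cXp x - cXm x))"
    and x: "(\<lambda>x. C_weight cXm cXp x * sqrt (pmf r x)) summable_on UNIV"
    and y: "(\<lambda>y. C_weight cYm cYp y * (phi_weight lam cYm cYp y) ^ 4 * pmf s y) summable_on UNIV"
  have C1: "1 \<le> C_weight cYm cYp z" for z by (simp add: C_weight_def)
  have p1: "1 \<le> phi_weight lam cYm cYp z" for z
    using c lam by (auto simp: phi_weight_def dominating_def)
  have p4: "phi_weight lam cYm cYp z \<le> phi_weight lam cYm cYp z ^ 4" "1 \<le> phi_weight lam cYm cYp z ^ 4" for z
    using power_increasing[of 1 4 "phi_weight lam cYm cYp z"] p1[of z] by auto
  \<comment> \<open>Both weights are at least 1, so the single summability condition on their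
    product controls each of them.\<close>
  have le: "C_weight cYm cYp z \<le> C_weight cYm cYp z * phi_weight lam cYm cYp z ^ 4"
    "phi_weight lam cYm cYp z \<le> C_weight cYm cYp z * phi_weight lam cYm cYp z ^ 4" for z
    using mult_left_mono[OF p4(2)[of z], of "C_weight cYm cYp z"] mult_mono[OF C1[of z] p4(1)[of z]] C1[of z] p1[of z]
    by auto
  interpret erot_cost lam c cXm cXp cYm cYp s
  proof
    show "integrable (measure_pmf s) (C_weight cYm cYp)"
      by (rule integrable_pmf_mono[OF y]) (use le C1 in \<open>simp add: C_weight_nonneg\<close>)
    show "integrable (measure_pmf s) (phi_weight lam cYm cYp)"
      by (rule integrable_pmf_mono[OF y]) (use le in \<open>simp add: phi_weight_def\<close>)
  qed (use lam c in auto)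
  have r: "integrable (count_space UNIV) (\<lambda>x. C_weight cXm cXp x * sqrt (pmf r x))"
    using x by (simp add: summable_on_real_iff_integrable)
  have Y: "integrable (measure_pmf s) (\<lambda>y. CY y * phiY y ^ 4)"
    by (rule integrable_pmf_mono[OF y]) (simp add: C_weight_nonneg abs_mult)
  obtain b where b: "\<And>x. \<bar>cXp x - cXm x\<bar> \<le> b" using bd by (auto simp: bounded_iff)
  have "cXp x - cXm x \<le> b" "0 \<le> b" for x using b[of x] by linarith+
  from plan_bootstrap[OF M X Xs r this Y]
  show "let w = osum (C_weight cXm cXp) (C_weight cYm cYp) in
         tendsto_zero_outer_prob M (\<lambda>n.
          cond_BL_dist M X n (l1_space w) (l1_norm w)
            (\<lambda>\<omega> z. sqrt (real n) *
                 (pmf (erot_plan lam c (rhs n \<omega>) s) z - pmf (erot_plan lam c (rh n \<omega>) s) z))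
            (\<lambda>\<omega> z. sqrt (real n) *
                 (pmf (erot_plan lam c (rh n \<omega>) s) z - pmf (erot_plan lam c r s) z)))"
    unfolding Let_def rh rhs by simp
qed

end
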